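(* For $\theta\in\mathbb{R}^d$, the law of the process $(B_t+\mu t)_{t\ge0}$ conditioned by $$A_\infty=^{law}\frac{e^{-\sum_{i=1}^d\theta_i^2x_i}}{j_\mu^\theta(0)}\,p(x)\,dx$$ is the law of a Markov process. Moreover, in that case, it solves in law the stochastic differential equation $$dX_t=\nabla\ln h_\mu^\theta(X_t)\,dt+d\beta_t,$$ where $(\beta_t)_{t\ge0}$ is a standard Brownian motion in $\mathbb{R}^n$.
   Context: Let $\alpha_1,\ldots,\alpha_d$ be distinct non-zero vectors in $\mathbb{R}^n$; write $\alpha_i(x)=(\alpha_i,x)$ and $\mu(x)=(\mu,x)$ with $(\cdot,\cdot)$ the usual inner product. Assume $\Omega=\{x\in\mathbb{R}^n:\alpha_i(x)>0\ \forall i\}$ is non-empty and let $\mu\in\Omega$. Let $B$ be a standard Brownian motion in $\mathbb{R}^n$ started at $0$ and $B_t^{(\mu)}=B_t+\mu t$. Set $A_\infty^i=\int_0^\infty e^{-2\alpha_i(B_s^{(\mu)})}ds$, $i=1,\dots,d$ (almost surely finite). $A_\infty=(A_\infty^1,\dots,A_\infty^d)$ has a smooth density $p$ with respect to Lebesgue measure on $\mathbb{R}^d$. For $\theta\in\mathbb{R}^d$ let $$j_\mu^\theta(x)=\mathbb{E}\Big(e^{-\sum_{i=1}^d\theta_i^2e^{-2\alpha_i(x)}A_\infty^i}\Big),\qquad h_\mu^\theta(x)=e^{\mu(x)}j_\mu^\theta(x),\qquad x\in\mathbb{R}^n.$$ Conditioning on a law: let $\mathbb{P}^\mu$ be the law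 of $B^{(\mu)}$ on the space of continuous functions $\mathbb{R}_+\to\mathbb{R}^n$ and $\pi$ the coordinate process. For a probability measure $\nu$ on $(0,\infty)^d$, the law of $(B_t+\mu t)_{t\ge0}$ conditioned by $A_\infty=^{law}\nu$ is $$\int\mathbb{P}^\mu\Big(\,\cdot\,\Big|\int_0^\infty e^{-2\alpha_1(\pi_s)}ds=y_1,\ldots,\int_0^\infty e^{-2\alpha_d(\pi_s)}ds=y_d\Big)\,\nu(dy).$$ For $\nu(dy)=v(y)p(y)dy$ this is the probability measure with density $v\big(\int_0^\infty e^{-2\alpha_1(\pi_s)}ds,\ldots,\int_0^\infty e^{-2\alpha_d(\pi_s)}ds\big)$ with respect to $\mathbb{P}^\mu$. *)

theory Defs
  imports "HOL-Probability.Probability"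
begin

text \<open>Processes are maps \<open>X :: real \<Rightarrow> 'a \<Rightarrow> 'b\<close> of which only the times \<open>t \<ge> 0\<close> matter.\<close>

definition natural_filtration ::
    "'a measure \<Rightarrow> (real \<Rightarrow> 'a \<Rightarrow> 'b::topological_space) \<Rightarrow> real \<Rightarrow> 'a measure" where
  "natural_filtration M X t =
     sigma (space M) {X s -` C \<inter> space M | s C. 0 \<le> s \<and> s \<le> t \<and> C \<in> sets borel}"

text \<open>Standard Brownian motion with respect to a filtration \<open>F\<close>; all paths are continuous.
  The density of the increment is that of the centred Gaussian law with covariance
  \<open>(t - s)\<close> times the identity (the second argument of \<^const>\<open>normal_density\<close> is the
  standard deviation).\<close>

definition brownian_motion_wrt ::
    "'a measure \<Rightarrow> (real \<Rightarrow> 'a measure) \<Rightarrow> (real \<Rightarrow> 'a \<Rightarrow> real ^ 'n) \<Rightarrow> bool" where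
  "brownian_motion_wrt M F B \<longleftrightarrow>
     prob_space M \<and>
     filtration (space M) F \<and> (\<forall>t. sets (F t) \<subseteq> sets M) \<and>
     (\<forall>t\<ge>0. B t \<in> borel_measurable (F t)) \<and>
     (\<forall>\<omega>\<in>space M. B 0 \<omega> = 0) \<and>
     (\<forall>\<omega>\<in>space M. continuous_on {0..} (\<lambda>t. B t \<omega>)) \<and>
     (\<forall>s t. 0 \<le> s \<longrightarrow> s < t \<longrightarrow>
        distributed M lborel (\<lambda>\<omega>. B t \<omega> - B s \<omega>)
          (\<lambda>x. ennreal (\<Prod>i\<in>UNIV. normal_density 0 (sqrt (t - s)) (x $ i))) \<and>
        prob_space.indep_set M (sets (F s))
          (sets (vimage_algebra (space M) (\<lambda>\<omega>. B t \<omega> - B s \<omega>) borel)))"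

definition standard_brownian_motion :: "'a measure \<Rightarrow> (real \<Rightarrow> 'a \<Rightarrow> real ^ 'n) \<Rightarrow> bool" where
  "standard_brownian_motion M B \<longleftrightarrow> brownian_motion_wrt M (natural_filtration M B) B"

text \<open>Continuous paths on \<open>[0,\<infinity>)\<close> with the \<open>\<sigma>\<close>-algebra generated by the coordinates.
  As in every \<^const>\<open>PiM\<close>, a path takes the value \<^const>\<open>undefined\<close> outside the index set \<open>{0..}\<close>.\<close>

definition path_space :: "(real \<Rightarrow> 'b::topological_space) measure" where
  "path_space = restrict_space (Pi\<^sub>M {0..} (\<lambda>_. borel)) {w. continuous_on {0..} w}"

definition path_law ::
    "'a measure \<Rightarrow> (real \<Rightarrow> 'a \<Rightarrow> 'b::topological_space) \<Rightarrow> (real \<Rightarrow> 'b) measure" where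
  "path_law M X = distr M path_space (\<lambda>\<omega>. \<lambda>t\<in>{0..}. X t \<omega>)"

definition markov_process :: "'a measure \<Rightarrow> (real \<Rightarrow> 'a \<Rightarrow> 'b::topological_space) \<Rightarrow> bool" where
  "markov_process M X \<longleftrightarrow>
     prob_space M \<and> (\<forall>t\<ge>0. X t \<in> borel_measurable M) \<and>
     (\<forall>s t C. 0 \<le> s \<longrightarrow> s \<le> t \<longrightarrow> C \<in> sets borel \<longrightarrow>
        (AE \<omega> in M.
           real_cond_exp M (natural_filtration M X s) (\<lambda>\<omega>. indicator C (X t \<omega>)) \<omega> =
           real_cond_exp M (vimage_algebra (space M) (X s) borel) (\<lambda>\<omega>. indicator C (X t \<omega>)) \<omega>))"

text \<open>\<open>cond_prob_given P T E y\<close> is \<open>P(E | T = y)\<close>: the function \<open>f\<close> with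
  \<open>P(E \<inter> {T \<in> C}) = \<integral>\<^sub>C f(y) P\<^sub>T(dy)\<close> for all Borel \<open>C\<close>, where \<open>P\<^sub>T\<close> is the law of \<open>T\<close>
  under \<open>P\<close>.\<close>

definition cond_prob_given ::
    "'a measure \<Rightarrow> ('a \<Rightarrow> 'c::topological_space) \<Rightarrow> 'a set \<Rightarrow> 'c \<Rightarrow> ennreal" where
  "cond_prob_given P T E =
     RN_deriv (distr P borel T) (distr (density P (indicator E)) borel T)"

text \<open>The law \<open>P\<close> conditioned by \<open>T = \<nu>\<close> in law: \<open>E \<mapsto> \<integral> P(E | T = y) \<nu>(dy)\<close>.  As
  \<open>P(E | T = y)\<close> is determined up to sets of measure zero for the law of \<open>T\<close>, this depends on
  the choice of versions unless \<open>\<nu>\<close> is absolutely continuous with respect to that law.\<close>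

definition conditioned_law ::
    "'a measure \<Rightarrow> ('a \<Rightarrow> 'c::topological_space) \<Rightarrow> 'c measure \<Rightarrow> 'a measure" where
  "conditioned_law P T \<nu> =
     measure_of (space P) (sets P) (\<lambda>E. \<integral>\<^sup>+ y. cond_prob_given P T E y \<partial>\<nu>)"

text \<open>The law \<open>Q\<close> solves \<open>dX\<^sub>t = b(X\<^sub>t) dt + d\<beta>\<^sub>t\<close>: there are a filtered probability space,
  a Brownian motion \<open>\<beta>\<close> for its filtration and a continuous adapted process \<open>X\<close> of law \<open>Q\<close> that
  satisfy the integrated equation.  Higher-order logic forces a choice of type for the sample
  space.  The one taken here is no restriction: for any solution, \<open>\<beta>\<close> is almost surely the
  functional \<open>X\<^sub>t - X\<^sub>0 - \<integral>\<^sub>0\<^sup>t b(X\<^sub>s) ds\<close> of \<open>X\<close>, so that the solution can be transported to path space.\<close>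

definition solves_sde_in_law ::
    "(real ^ 'n \<Rightarrow> real ^ 'n) \<Rightarrow> (real \<Rightarrow> real ^ 'n) measure \<Rightarrow> bool" where
  "solves_sde_in_law b Q \<longleftrightarrow>
     (\<exists>(N :: (real \<Rightarrow> real ^ 'n) measure) F X \<beta>.
        brownian_motion_wrt N F \<beta> \<and>
        (\<forall>t\<ge>0. X t \<in> borel_measurable (F t)) \<and>
        (\<forall>\<omega>\<in>space N. continuous_on {0..} (\<lambda>t. X t \<omega>)) \<and>
        path_law N X = Q \<and>
        (AE \<omega> in N. \<forall>t\<ge>0.
           set_integrable lborel {0..t} (\<lambda>s. b (X s \<omega>)) \<and>
           X t \<omega> = X 0 \<omega> + (LINT s:{0..t}|lborel. b (X s \<omega>)) + \<beta> t \<omega>))"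

definition chamber :: "('d \<Rightarrow> real ^ 'n) \<Rightarrow> (real ^ 'n) set" where
  "chamber \<alpha> = {x. \<forall>i. \<alpha> i \<bullet> x > 0}"

definition drifted :: "(real \<Rightarrow> 'a \<Rightarrow> real ^ 'n) \<Rightarrow> real ^ 'n \<Rightarrow> real \<Rightarrow> 'a \<Rightarrow> real ^ 'n" where
  "drifted B \<mu> t \<omega> = B t \<omega> + t *\<^sub>R \<mu>"

text \<open>A component whose integral diverges is \<open>0\<close> by the convention of the Bochner integral; for
  Brownian motion with drift in the chamber this happens with probability zero.\<close>

definition exp_functional :: "('d \<Rightarrow> real ^ 'n) \<Rightarrow> (real \<Rightarrow> real ^ 'n) \<Rightarrow> real ^ 'd" where
  "exp_functional \<alpha> w = (\<chi> i. LINT s:{0..}|lborel. exp (- 2 * (\<alpha> i \<bullet> w s)))"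

definition j_fun ::
    "'a measure \<Rightarrow> (real \<Rightarrow> 'a \<Rightarrow> real ^ 'n) \<Rightarrow> ('d::finite \<Rightarrow> real ^ 'n) \<Rightarrow> real ^ 'n \<Rightarrow> real ^ 'd
      \<Rightarrow> real ^ 'n \<Rightarrow> real" where
  "j_fun M B \<alpha> \<mu> \<theta> x =
     (\<integral>\<omega>. exp (- (\<Sum>i\<in>UNIV. (\<theta> $ i)\<^sup>2 * exp (- 2 * (\<alpha> i \<bullet> x)) *
        exp_functional \<alpha> (\<lambda>s. drifted B \<mu> s \<omega>) $ i)) \<partial>M)"

definition h_fun ::
    "'a measure \<Rightarrow> (real \<Rightarrow> 'a \<Rightarrow> real ^ 'n) \<Rightarrow> ('d::finite \<Rightarrow> real ^ 'n) \<Rightarrow> real ^ 'n \<Rightarrow> real ^ 'd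
      \<Rightarrow> real ^ 'n \<Rightarrow> real" where
  "h_fun M B \<alpha> \<mu> \<theta> x = exp (\<mu> \<bullet> x) * j_fun M B \<alpha> \<mu> \<theta> x"

end

(*
  Under the law P of the drifted Brownian motion, A_infinity splits at time t into its part up to t
  plus exp (-2 alpha_i (X_t)) times the same functional of the increments after t, which are
  independent of the past.  Hence the density D = exp (- sum theta_i^2 A_infinity^i) has conditional
  expectation exp (- int_0^t V(X_s) ds) j(X_t) with V(x) = sum theta_i^2 exp (-2 alpha_i(x)), and the
  Markov property of Q = D / j(0) P follows.

  Ito calculus is avoided as follows.  Put beta_t = X_t - X_0 - int_0^t b(X_s) ds with b = mu + J / j,
  where J is the gradient of j.  The function j has a globally bounded second-order Taylor remainder,
  and |b| <= C (1 + V), which has moments under P.  This gives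
  E [D Y (exp (i v (beta_(r+h) - beta_r)) - 1 + |v|^2 h / 2)] = O(h^(3/2)), uniformly in complex Y
  bounded by 1 and known at time r.  So exp (|v|^2 t / 2) E [D Y exp (i v (beta_t - beta_s))] has zero
  derivative in t, and the increments of beta under Q are Gaussian and independent of the past by
  uniqueness of characteristic functions.
*)
theory Submission
  imports Defs
begin

section \<open>Path space\<close>

text \<open>The obstacle is that \<open>V\<close>, and with it the bound available for
  \<open>b\<close>, can grow exponentially where some \<open>\<alpha> i \<bullet> x\<close> is
  negative, so the drift is treated neither as bounded nor as globally Lipschitz. Instead of
  localising by stopping times, all estimates are made under \<open>P\<close>, where exponential
  moments are explicit, with \<open>D \<le> 1\<close> as a weight. Given the past of time
  \<open>s\<close> this weight becomes \<open>exp (- S s w) * j (w s)\<close>, and the factor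
  \<open>j\<close> absorbs the denominator of \<open>J / j\<close>; this is what controls increments
  of \<open>b\<close>. The Taylor remainder of \<open>j\<close> is global because a move of
  \<open>x\<close> by \<open>\<xi>\<close> multiplies the i-th exponent by
  \<open>exp (- 2 * (\<alpha> i \<bullet> \<xi>))\<close>, and \<open>z * exp (- z)\<close> and
  \<open>z\<^sup>2 * exp (- z)\<close> are bounded for z \<ge> 0. The linear bound of
  \<open>J / j\<close> in \<open>V\<close> is an entropy estimate. The order 3/2 is h (length of a
  time integral) times sqrt h (size of an increment); any exponent above 1 would force the
  derivative to vanish.\<close>

lemma borel_measurable_pair_continuous:
  fixes Z :: "real \<Rightarrow> 'a \<Rightarrow> 'b::{metric_space, second_countable_topology}"
  assumes meas: "\<And>q. Z q \<in> borel_measurable N"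
    and cont: "\<And>w. w \<in> space N \<Longrightarrow> continuous_on UNIV (\<lambda>q. Z q w)"
  shows "(\<lambda>(w, s). Z s w) \<in> borel_measurable (N \<Otimes>\<^sub>M lborel)"
proof (rule borel_measurable_LIMSEQ_metric)
  \<comment> \<open>Rounding \<open>s\<close> down to a grid leaves countably many values, so
    measurability follows by cases on the integer part; the mesh tends to 0 and continuity of the
    path identifies the limit.\<close>
  let ?c = "\<lambda>(n::nat) s. real_of_int \<lfloor>real (Suc n) * s\<rfloor> / real (Suc n)"
  show "(\<lambda>(w, s). Z (?c n s) w) \<in> borel_measurable (N \<Otimes>\<^sub>M lborel)" for n
  proof -
    have "(\<lambda>x. Z (real_of_int i / real (Suc n)) (fst x)) \<in> borel_measurable (N \<Otimes>\<^sub>M lborel)" for i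
      using meas by measurable
    moreover have "(\<lambda>x. \<lfloor>real (Suc n) * snd x\<rfloor>) \<in> measurable (N \<Otimes>\<^sub>M lborel) (count_space UNIV)"
      by measurable
    ultimately have "(\<lambda>x. Z (real_of_int \<lfloor>real (Suc n) * snd x\<rfloor> / real (Suc n)) (fst x))
        \<in> borel_measurable (N \<Otimes>\<^sub>M lborel)"
      by (rule measurable_compose_countable)
    then show ?thesis by (simp add: case_prod_beta')
  qed
  fix x assume "x \<in> space (N \<Otimes>\<^sub>M (lborel :: real measure))"
  then obtain w s where x: "x = (w, s)" and w: "w \<in> space N" by (auto simp: space_pair_measure)
  have "(\<lambda>n. ?c n s) \<longlonglongrightarrow> s"
  proof (rule real_tendsto_sandwich)
    show "\<forall>\<^sub>F n in sequentially. s - 1 / real (Suc n) \<le> ?c n s"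
    proof (intro always_eventually allI)
      fix n
      have "s - 1 / real (Suc n) = (real (Suc n) * s - 1) / real (Suc n)" by (simp add: field_simps)
      also have "\<dots> \<le> ?c n s" by (intro divide_right_mono) linarith+
      finally show "s - 1 / real (Suc n) \<le> ?c n s" .
    qed
    show "\<forall>\<^sub>F n in sequentially. ?c n s \<le> s"
    proof (intro always_eventually allI)
      fix n
      have "?c n s \<le> (real (Suc n) * s) / real (Suc n)" by (intro divide_right_mono) linarith+
      then show "?c n s \<le> s" by simp
    qed
    show "(\<lambda>n. s - 1 / real (Suc n)) \<longlonglongrightarrow> s"
      using tendsto_diff[OF tendsto_const[of s] LIMSEQ_inverse_real_of_nat] by (simp add: inverse_eq_divide)
  qed simp
  moreover have "isCont (\<lambda>q. Z q w) s" using cont[OF w] by (simp add: continuous_on_eq_continuous_at)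
  ultimately have "(\<lambda>n. Z (?c n s) w) \<longlonglongrightarrow> Z s w" by (rule isCont_tendsto_compose[rotated])
  then show "(\<lambda>n. case x of (w, s) \<Rightarrow> Z (?c n s) w) \<longlonglongrightarrow> (case x of (w, s) \<Rightarrow> Z s w)"
    by (simp add: x)
qed

lemma space_path_space:
  "space path_space = {w. w \<in> extensional {0..} \<and> continuous_on {0..} w}"
  by (auto simp: path_space_def space_restrict_space space_PiM PiE_def)

lemma measurable_coordinate_path_space:
  "0 \<le> t \<Longrightarrow> (\<lambda>w. w t) \<in> borel_measurable path_space"
  unfolding path_space_def by (intro measurable_restrict_space1 measurable_component_singleton) simp

lemma measurable_into_path_space:
  assumes "\<And>t. 0 \<le> t \<Longrightarrow> f t \<in> borel_measurable N"
    and "\<And>x. x \<in> space N \<Longrightarrow> continuous_on {0..} (\<lambda>t. f t x)"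
  shows "(\<lambda>x. \<lambda>t\<in>{0..}. f t x) \<in> measurable N path_space"
  unfolding path_space_def
proof (rule measurable_restrict_space2)
  show "(\<lambda>x. \<lambda>t\<in>{0..}. f t x) \<in> N \<rightarrow>\<^sub>M Pi\<^sub>M {0..} (\<lambda>_. borel)"
    by (rule measurable_restrict) (use assms(1) in auto)
  have "continuous_on {0..} (\<lambda>t\<in>{0..}. f t x) \<longleftrightarrow> continuous_on {0..} (\<lambda>t. f t x)" for x
    by (rule continuous_on_cong) simp_all
  then show "(\<lambda>x. \<lambda>t\<in>{0..}. f t x) \<in> space N \<rightarrow> {w. continuous_on {0..} w}"
    using assms(2) by auto
qed

text \<open>Paths are continuous on \<open>{0..}\<close> only, while joint measurability asks for
  continuity on the whole line. Clamping the time supplies it without changing the values on the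
  interval of interest.\<close>

lemma continuous_clamp:
  fixes w :: "real \<Rightarrow> 'b::topological_space"
  assumes "continuous_on {0..} w" "0 \<le> r" "r \<le> u"
  shows "continuous_on UNIV (\<lambda>q. w (max r (min u q)))" "continuous_on UNIV (\<lambda>q. w (max r q))"
  by (rule continuous_on_compose2[OF assms(1)]; use assms in \<open>auto intro!: continuous_intros\<close>)+

text \<open>Clamping the time to \<open>[r, u]\<close> keeps the integrand adapted to the past of \<open>u\<close>.\<close>

lemma measurable_time_integral:
  fixes X :: "real \<Rightarrow> 'a \<Rightarrow> 'b::{metric_space, second_countable_topology}"
    and f :: "'b \<Rightarrow> 'c::{banach, second_countable_topology}"
  assumes X: "\<And>t. r \<le> t \<Longrightarrow> t \<le> u \<Longrightarrow> X t \<in> borel_measurable N"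
    and cont: "\<And>w. w \<in> space N \<Longrightarrow> continuous_on {0..} (\<lambda>t. X t w)"
    and r: "0 \<le> r" "r \<le> u" and f: "continuous_on UNIV f"
  shows "(\<lambda>w. LINT s:{r..u}|lborel. f (X s w)) \<in> borel_measurable N"
proof -
  have j: "(\<lambda>(w, s). X (max r (min u s)) w) \<in> borel_measurable (N \<Otimes>\<^sub>M lborel)"
    by (rule borel_measurable_pair_continuous)
      (use X r in \<open>auto intro!: continuous_clamp(1)[where w="\<lambda>t. X t w" for w] cont\<close>)
  have f': "f \<in> borel_measurable borel" using f by (rule borel_measurable_continuous_onI)
  have "(\<lambda>(w, s). indicator {r..u} s *\<^sub>R f (X (max r (min u s)) w)) \<in> borel_measurable (N \<Otimes>\<^sub>M lborel)"
    using measurable_compose[OF j f'] by (simp add: case_prod_beta')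
  then have "(\<lambda>w. LINT s|lborel. indicator {r..u} s *\<^sub>R f (X (max r (min u s)) w)) \<in> borel_measurable N"
    by (intro lborel.borel_measurable_lebesgue_integral)
  also have "(\<lambda>w. LINT s|lborel. indicator {r..u} s *\<^sub>R f (X (max r (min u s)) w)) =
      (\<lambda>w. LINT s:{r..u}|lborel. f (X s w))"
    by (auto simp: set_lebesgue_integral_def fun_eq_iff indicator_def intro!: Bochner_Integration.integral_cong)
  finally show ?thesis .
qed

lemma borel_measurable_vec_lambda:
  fixes f :: "'d::finite \<Rightarrow> 'a \<Rightarrow> real"
  assumes "\<And>i. f i \<in> borel_measurable M"
  shows "(\<lambda>x. \<chi> i. f i x) \<in> borel_measurable M"
  using assms by (subst borel_measurable_euclidean_space) (auto simp: Basis_vec_def inner_axis)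

lemma measurable_exp_functional:
  fixes \<alpha> :: "'d::finite \<Rightarrow> real ^ 'n"
  shows "exp_functional \<alpha> \<in> borel_measurable path_space"
proof -
  have joint: "(\<lambda>(w :: real \<Rightarrow> real ^ 'n, s). w (max 0 s)) \<in> borel_measurable (path_space \<Otimes>\<^sub>M lborel)"
    by (rule borel_measurable_pair_continuous[where Z="\<lambda>s w. w (max 0 s)"])
      (auto simp: space_path_space intro!: measurable_coordinate_path_space continuous_clamp(2)[OF _ order_refl order_refl])
  have "(\<lambda>w. LINT s:{0..}|lborel. exp (- 2 * (\<alpha> i \<bullet> w s))) \<in> borel_measurable path_space" for i
  proof -
    have "(\<lambda>(w, s). indicator {0..} s *\<^sub>R exp (- 2 * (\<alpha> i \<bullet> w (max 0 s)))) \<in> borel_measurable (path_space \<Otimes>\<^sub>M lborel)"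
      using joint by (simp add: case_prod_beta')
    then have "(\<lambda>w. LINT s|lborel. indicator {0..} s *\<^sub>R exp (- 2 * (\<alpha> i \<bullet> w (max 0 s)))) \<in> borel_measurable path_space"
      by (intro lborel.borel_measurable_lebesgue_integral)
    also have "(\<lambda>w. LINT s|lborel. indicator {0..} s *\<^sub>R exp (- 2 * (\<alpha> i \<bullet> w (max 0 s)))) =
        (\<lambda>w. LINT s:{0..}|lborel. exp (- 2 * (\<alpha> i \<bullet> w s)))"
      by (auto simp: max_def set_lebesgue_integral_def fun_eq_iff indicator_def intro!: Bochner_Integration.integral_cong)
    finally show ?thesis .
  qed
  then show ?thesis
    unfolding exp_functional_def by (intro borel_measurable_vec_lambda)
qed

text \<open>Subtracting \<open>w u\<close> makes the shifted path start at 0, so that it can have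
  the law of the original one and be independent of the past; the position \<open>w u\<close> is
  then carried along as a separate argument.\<close>

definition path_shift :: "real \<Rightarrow> (real \<Rightarrow> 'b::real_normed_vector) \<Rightarrow> real \<Rightarrow> 'b" where
  "path_shift u w = (\<lambda>t\<in>{0..}. w (u + t) - w u)"

lemma continuous_on_path_shift:
  fixes w :: "real \<Rightarrow> 'b::real_normed_vector"
  assumes "continuous_on {0..} w" "0 \<le> u" shows "continuous_on {0..} (\<lambda>t. w (u + t) - w u)"
proof -
  have "continuous_on {0..} (\<lambda>t. w (u + t))"
    by (rule continuous_on_compose2[OF assms(1)]) (use assms in \<open>auto intro!: continuous_intros\<close>)
  then show ?thesis by (intro continuous_intros)
qed

lemma measurable_path_shift:
  assumes "0 \<le> u"
  shows "path_shift u \<in> measurable path_space (path_space :: (real \<Rightarrow> 'b::{real_normed_vector,second_countable_topology}) measure)"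
  unfolding path_shift_def[abs_def]
  by (rule measurable_into_path_space)
    (use assms in \<open>auto simp: space_path_space intro!: continuous_on_path_shift borel_measurable_diff measurable_coordinate_path_space\<close>)

section \<open>Natural filtrations and uniqueness of laws on path space\<close>

lemma space_natural_filtration [simp]: "space (natural_filtration M X t) = space M"
  unfolding natural_filtration_def by (rule space_measure_of) auto

lemma sets_natural_filtration:
  "sets (natural_filtration M X t) =
    sigma_sets (space M) {X s -` C \<inter> space M | s C. 0 \<le> s \<and> s \<le> t \<and> C \<in> sets borel}"
  unfolding natural_filtration_def by (rule sets_measure_of) auto

lemma measurable_natural_filtration:
  "0 \<le> s \<Longrightarrow> s \<le> t \<Longrightarrow> X s \<in> borel_measurable (natural_filtration M X t)"
  by (rule measurableI) (auto simp: sets_natural_filtration)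

lemma sets_natural_filtration_mono:
  "s \<le> t \<Longrightarrow> sets (natural_filtration M X s) \<subseteq> sets (natural_filtration M X t)"
  unfolding sets_natural_filtration by (rule sigma_sets_mono') force

lemma sets_natural_filtration_subset:
  assumes "\<And>t. 0 \<le> t \<Longrightarrow> X t \<in> borel_measurable M"
  shows "sets (natural_filtration M X t) \<subseteq> sets M"
  unfolding sets_natural_filtration
  by (rule sets.sigma_sets_subset) (auto intro: measurable_sets assms)

lemma filtration_natural_filtration: "filtration (space M) (natural_filtration M X)"
  by unfold_locales (simp_all add: sets_natural_filtration_mono)

lemma natural_filtration_cong:
  "space M = space N \<Longrightarrow> natural_filtration M X = natural_filtration N X"
  by (simp add: natural_filtration_def fun_eq_iff)

text \<open>A measurable set of paths is the trace of a product-measurable set, hence its preimage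
  under the inclusion into the product. Finite-dimensional laws determine the image measures on the
  product and therefore the measures on path space; the set of continuous paths itself never has to
  be product-measurable.\<close>

lemma measure_eqI_path_space:
  fixes P Q :: "(real \<Rightarrow> 'b::topological_space) measure"
  assumes sets: "sets P = sets path_space" "sets Q = sets path_space" and fin: "finite_measure P"
    and eq: "\<And>J C. finite J \<Longrightarrow> J \<subseteq> {0..} \<Longrightarrow> (\<And>t. t \<in> J \<Longrightarrow> C t \<in> sets borel) \<Longrightarrow>
      emeasure P {w \<in> space path_space. \<forall>t\<in>J. w t \<in> C t} = emeasure Q {w \<in> space path_space. \<forall>t\<in>J. w t \<in> C t}"
  shows "P = Q"
proof -
  let ?S = "Pi\<^sub>M {0..} (\<lambda>_::real. borel :: 'b measure)"
  have sp: "space P = space path_space" "space Q = space path_space"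
    using sets by (auto dest: sets_eq_imp_space_eq)
  have id: "(\<lambda>w. w) \<in> measurable path_space ?S"
    unfolding path_space_def by (rule measurable_restrict_space1) simp
  have idP: "(\<lambda>w. w) \<in> measurable P ?S" "(\<lambda>w. w) \<in> measurable Q ?S"
    using id sets by (simp_all cong: measurable_cong_sets)
  have "distr P ?S (\<lambda>w. w) = distr Q ?S (\<lambda>w. w)"
  proof (rule measure_eqI_PiM_infinite)
    show "finite_measure (distr P ?S (\<lambda>w. w))"
      using fin idP(1) by (rule finite_measure.finite_measure_distr)
    fix A J assume J: "finite J" "J \<subseteq> {0::real..}" and A: "\<And>i. i \<in> J \<Longrightarrow> A i \<in> sets (borel :: 'b measure)"
    let ?E = "prod_emb {0..} (\<lambda>_. borel) J (Pi\<^sub>E J A)"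
    have E: "?E \<in> sets ?S" using J A by (intro sets_PiM_I) auto
    have *: "(\<lambda>w. w) -` ?E \<inter> space path_space = {w \<in> space path_space. \<forall>t\<in>J. w t \<in> A t}"
      using J by (auto simp: prod_emb_def space_path_space PiE_iff extensional_def restrict_def Pi_def)
    show "emeasure (distr P ?S (\<lambda>w. w)) ?E = emeasure (distr Q ?S (\<lambda>w. w)) ?E"
      using eq[OF J A] * by (simp add: emeasure_distr[OF _ E] idP sp)
  qed simp_all
  then have *: "emeasure (distr P ?S (\<lambda>w. w)) E = emeasure (distr Q ?S (\<lambda>w. w)) E" for E by simp
  show ?thesis
  proof (rule measure_eqI)
    fix E assume "E \<in> sets P"
    then obtain E' where E': "E' \<in> sets ?S" "E = {w. continuous_on {0..} w} \<inter> E'"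
      using sets by (auto simp: path_space_def sets_restrict_space)
    have "(\<lambda>w. w) -` E' \<inter> space path_space = E"
      using E' sets.sets_into_space[OF E'(1)] by (auto simp: path_space_def space_restrict_space)
    then show "emeasure P E = emeasure Q E"
      using *[of E'] by (simp add: emeasure_distr[OF _ E'(1)] idP sp)
  qed (simp add: sets)
qed

section \<open>Brownian motion with drift on path space\<close>

text \<open>The joint law of the identity, seen through \<open>F\<close>, and of \<open>Y\<close> is
  a product measure because it factorises on rectangles; Tonelli does the rest. This is the
  mechanism for freezing what is known and integrating out an independent \<open>Y\<close>.\<close>

lemma nn_integral_indep_pair:
  assumes M: "prob_space M" and F: "sets F \<subseteq> sets M" "space F = space M"
    and Y: "Y \<in> measurable M T"
    and indep: "\<And>A B. A \<in> sets F \<Longrightarrow> B \<in> sets T \<Longrightarrow>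
      emeasure M (A \<inter> (Y -` B \<inter> space M)) = emeasure M A * emeasure M (Y -` B \<inter> space M)"
    and g: "g \<in> borel_measurable (F \<Otimes>\<^sub>M T)"
  shows "(\<integral>\<^sup>+w. g (w, Y w) \<partial>M) = (\<integral>\<^sup>+w. \<integral>\<^sup>+y. g (w, y) \<partial>distr M T Y \<partial>M)"
proof -
  interpret prob_space M by fact
  have id: "(\<lambda>w. w) \<in> measurable M F" using F by (intro measurableI) (auto dest: sets.sets_into_space)
  have pair: "(\<lambda>w. (w, Y w)) \<in> measurable M (F \<Otimes>\<^sub>M T)" using id Y by simp
  interpret D: prob_space "distr M T Y" using Y by (rule prob_space_distr)
  interpret D': prob_space "distr M F (\<lambda>w. w)" using id by (rule prob_space_distr)
  have eq: "distr M F (\<lambda>w. w) \<Otimes>\<^sub>M distr M T Y = distr M (F \<Otimes>\<^sub>M T) (\<lambda>w. (w, Y w))"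
  proof (rule pair_measure_eqI)
    fix A B assume "A \<in> sets (distr M F (\<lambda>w. w))" "B \<in> sets (distr M T Y)"
    then have AB: "A \<in> sets F" "B \<in> sets T" by simp_all
    then have "(\<lambda>w. (w, Y w)) -` (A \<times> B) \<inter> space M = A \<inter> (Y -` B \<inter> space M)" "(\<lambda>w. w) -` A \<inter> space M = A"
      using F sets.sets_into_space[OF AB(1)] by auto
    then show "emeasure (distr M F (\<lambda>w. w)) A * emeasure (distr M T Y) B =
        emeasure (distr M (F \<Otimes>\<^sub>M T) (\<lambda>w. (w, Y w))) (A \<times> B)"
      using AB indep[OF AB] by (simp add: emeasure_distr id Y pair)
  qed (unfold_locales, simp)
  have gm: "g \<in> borel_measurable (F \<Otimes>\<^sub>M distr M T Y)" using g by (simp cong: measurable_cong_sets)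
  have "(\<integral>\<^sup>+w. g (w, Y w) \<partial>M) = (\<integral>\<^sup>+x. g x \<partial>(distr M F (\<lambda>w. w) \<Otimes>\<^sub>M distr M T Y))"
    unfolding eq by (simp add: nn_integral_distr pair g)
  also have "\<dots> = (\<integral>\<^sup>+w. \<integral>\<^sup>+y. g (w, y) \<partial>distr M T Y \<partial>distr M F (\<lambda>w. w))"
    by (rule D.nn_integral_fst[symmetric]) (use gm in \<open>simp cong: measurable_cong_sets\<close>)
  also have "\<dots> = (\<integral>\<^sup>+w. \<integral>\<^sup>+y. g (w, y) \<partial>distr M T Y \<partial>M)"
    by (rule nn_integral_distr[OF id]) (use D.borel_measurable_nn_integral_fst[OF gm] in simp)
  finally show ?thesis .
qed

text \<open>Chapman-Kolmogorov iteration: the probability that a process with independent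
  increments, at \<open>z\<close> at time \<open>s\<close>, lies in \<open>C t\<close> at each later
  time \<open>t\<close> of the list, \<open>\<nu>\<close> giving the law of an increment as a
  function of the time lag.\<close>

primrec cylinder_kernel ::
    "(real \<Rightarrow> 'b::real_normed_vector measure) \<Rightarrow> (real \<Rightarrow> 'b set) \<Rightarrow> real list \<Rightarrow> real \<Rightarrow> 'b \<Rightarrow> ennreal" where
  "cylinder_kernel \<nu> C [] s z = 1"
| "cylinder_kernel \<nu> C (t # ts) s z =
    (\<integral>\<^sup>+y. indicator (C t) (z + y) * cylinder_kernel \<nu> C ts t (z + y) \<partial>\<nu> (t - s))"

lemma measurable_cylinder_kernel:
  fixes \<nu> :: "real \<Rightarrow> 'b::{real_normed_vector, second_countable_topology} measure"
  assumes \<nu>: "\<And>d. sigma_finite_measure (\<nu> d)" "\<And>d. sets (\<nu> d) = sets borel"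
    and C: "\<And>t. t \<in> set ts \<Longrightarrow> C t \<in> sets borel"
  shows "cylinder_kernel \<nu> C ts s \<in> borel_measurable borel"
  using C
proof (induction ts arbitrary: s)
  case (Cons t ts)
  have [measurable]: "cylinder_kernel \<nu> C ts t \<in> borel_measurable borel" "C t \<in> sets borel"
    using Cons by auto
  interpret sigma_finite_measure "\<nu> (t - s)" by (rule \<nu>)
  have "(\<lambda>(z, y). indicator (C t) (z + y) * cylinder_kernel \<nu> C ts t (z + y) :: ennreal)
      \<in> borel_measurable (borel \<Otimes>\<^sub>M \<nu> (t - s))"
    using \<nu>(2) by (simp add: measurable_cong_sets[OF sets_pair_measure_cong[OF refl \<nu>(2)] refl] case_prod_beta')
  then show ?case unfolding cylinder_kernel.simps by (rule borel_measurable_nn_integral)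
next
  case Nil
  have "cylinder_kernel \<nu> C [] s = (\<lambda>_. 1)" for s by (rule ext) simp
  then show ?case by simp
qed

definition gauss :: "real \<Rightarrow> (real ^ 'n) measure" where
  "gauss h = density lborel (\<lambda>x. ennreal (\<Prod>i\<in>UNIV. normal_density 0 (sqrt h) (x $ i)))"

abbreviation coordinate_filtration ::
    "(real \<Rightarrow> 'b::topological_space) measure \<Rightarrow> real \<Rightarrow> (real \<Rightarrow> 'b) measure" where
  "coordinate_filtration P \<equiv> natural_filtration P (\<lambda>t w. w t)"

text \<open>Brownian motion with drift is described by its increments on the canonical space, where
  shifts act. The start at 0 holds only almost everywhere because path space contains paths with
  every starting point.\<close>

locale drifted_brownian_law = prob_space P
  for P :: "(real \<Rightarrow> real ^ 'n) measure" +
  fixes \<mu> :: "real ^ 'n"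
  assumes sets_P [measurable_cong]: "sets P = sets path_space"
    and start: "AE w in P. w 0 = 0"
    and increment_law: "0 \<le> s \<Longrightarrow> s < t \<Longrightarrow>
      distr P borel (\<lambda>w. w t - w s - (t - s) *\<^sub>R \<mu>) = gauss (t - s)"
    and increment_indep: "0 \<le> s \<Longrightarrow> s < t \<Longrightarrow> A \<in> sets (coordinate_filtration P s) \<Longrightarrow> C \<in> sets borel \<Longrightarrow>
      emeasure P (A \<inter> ((\<lambda>w. w t - w s) -` C \<inter> space P)) =
      emeasure P A * emeasure P ((\<lambda>w. w t - w s) -` C \<inter> space P)"
begin

abbreviation "\<F> \<equiv> coordinate_filtration P"

lemma space_P: "space P = space path_space"
  using sets_P by (rule sets_eq_imp_space_eq)

lemma continuous_path: "w \<in> space P \<Longrightarrow> continuous_on {0..} w"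
  by (simp add: space_P space_path_space)

lemma measurable_coordinate: "0 \<le> t \<Longrightarrow> (\<lambda>w. w t) \<in> borel_measurable P"
  using measurable_coordinate_path_space by (simp add: measurable_cong_sets[OF sets_P refl])

lemma measurable_coordinate_filtration: "0 \<le> s \<Longrightarrow> s \<le> t \<Longrightarrow> (\<lambda>w. w s) \<in> borel_measurable (\<F> t)"
  by (rule measurable_natural_filtration)

lemma sets_filtration: "sets (\<F> t) \<subseteq> sets P"
  by (rule sets_natural_filtration_subset) (rule measurable_coordinate)

lemma subalgebra_filtration: "subalgebra P (\<F> t)"
  using sets_filtration space_natural_filtration[of P] unfolding subalgebra_def by blast

lemma measurable_filtrationD: "f \<in> measurable (\<F> t) N \<Longrightarrow> f \<in> measurable P N"
  by (rule measurable_from_subalg[OF subalgebra_filtration])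

lemma measurable_filtration_mono:
  assumes "s \<le> t" "f \<in> measurable (\<F> s) N" shows "f \<in> measurable (\<F> t) N"
proof (rule measurable_from_subalg[OF _ assms(2)])
  show "subalgebra (\<F> t) (\<F> s)"
    unfolding subalgebra_def
    by (intro conjI sets_natural_filtration_mono assms(1)) (simp only: space_natural_filtration)
qed

definition "incr_law d = distr P borel (\<lambda>w. w d - w 0)"

lemma measurable_increment: "0 \<le> s \<Longrightarrow> 0 \<le> t \<Longrightarrow> (\<lambda>w. w t - w s) \<in> borel_measurable P"
  by (intro borel_measurable_diff measurable_coordinate)

lemma increment_law':
  assumes "0 \<le> s" "s \<le> t" shows "distr P borel (\<lambda>w. w t - w s) = incr_law (t - s)"
proof (cases "s = t")
  case False
  have *: "distr P borel (\<lambda>w. w t - w s) = distr (gauss (t - s)) borel (\<lambda>x. x + (t - s) *\<^sub>R \<mu>)"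
    if "0 \<le> s" "s < t" for s t
    unfolding increment_law[OF that, symmetric]
    by (subst distr_distr)
      (use that measurable_coordinate in \<open>auto simp: comp_def intro!: borel_measurable_diff\<close>)
  show ?thesis using *[of s t] *[of 0 "t - s"] assms False by (simp add: incr_law_def)
qed (use assms in \<open>simp add: incr_law_def\<close>)

lemma increment_indep':
  assumes "0 \<le> s" "s \<le> t" "A \<in> sets (\<F> s)" "C \<in> sets borel"
  shows "emeasure P (A \<inter> ((\<lambda>w. w t - w s) -` C \<inter> space P)) =
      emeasure P A * emeasure P ((\<lambda>w. w t - w s) -` C \<inter> space P)"
proof (cases "s = t")
  case True
  have "A \<subseteq> space P" using assms sets_filtration by (auto dest: sets.sets_into_space)
  then show ?thesis using True by (cases "0 \<in> C") (auto simp: Int_absorb2 emeasure_space_1)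
qed (use increment_indep assms in auto)

text \<open>\<open>H\<close> collects the indicators already met and \<open>Z\<close> the current
  position; both must be general for the induction to pass from \<open>t0\<close> to
  \<open>t\<close>. The induction hypothesis first integrates out the later increments, then the
  first increment is removed by its independence of the past of \<open>u + t0\<close>.\<close>

lemma nn_integral_cylinder:
  assumes "sorted (t0 # ts)" "0 \<le> u" "0 \<le> t0" "\<And>t. t \<in> set ts \<Longrightarrow> C t \<in> sets borel"
    and "H \<in> borel_measurable (\<F> (u + t0))" "Z \<in> borel_measurable (\<F> (u + t0))"
  shows "(\<integral>\<^sup>+w. H w * (\<Prod>t\<leftarrow>ts. indicator (C t) (Z w + (w (u + t) - w (u + t0)))) \<partial>P) =
    (\<integral>\<^sup>+w. H w * cylinder_kernel (\<lambda>d. incr_law (max 0 d)) C ts t0 (Z w) \<partial>P)"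
  using assms
proof (induction ts arbitrary: t0 H Z)
  case (Cons t ts)
  let ?K = "cylinder_kernel (\<lambda>d. incr_law (max 0 d)) C"
  let ?Y = "\<lambda>w. w (u + t) - w (u + t0)"
  have t: "0 \<le> t0" "t0 \<le> t" "sorted (t # ts)" "0 \<le> t" "0 \<le> u" using Cons.prems by auto
  define Z' where "Z' w = Z w + ?Y w" for w
  define H' where "H' w = H w * indicator (C t) (Z' w)" for w
  have [measurable]: "C t \<in> sets borel" using Cons.prems by simp
  note [measurable] = Cons.prems(5,6)
  have K[measurable]: "?K ts t \<in> borel_measurable borel"
    using Cons.prems by (intro measurable_cylinder_kernel)
      (auto simp: incr_law_def intro!: prob_space_imp_sigma_finite prob_space_distr measurable_increment)
  have Zm: "Z \<in> borel_measurable (\<F> (u + t))" "H \<in> borel_measurable (\<F> (u + t))"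
    using Cons.prems t by (auto intro!: measurable_filtration_mono[of "u + t0" "u + t"])
  have Z': "Z' \<in> borel_measurable (\<F> (u + t))"
    unfolding Z'_def using t
    by (intro borel_measurable_add borel_measurable_diff Zm measurable_coordinate_filtration) auto
  have H': "H' \<in> borel_measurable (\<F> (u + t))"
    unfolding H'_def using Z' Zm by measurable
  have "(\<integral>\<^sup>+w. H w * (\<Prod>t\<leftarrow>t # ts. indicator (C t) (Z w + (w (u + t) - w (u + t0)))) \<partial>P) =
      (\<integral>\<^sup>+w. H' w * (\<Prod>t'\<leftarrow>ts. indicator (C t') (Z' w + (w (u + t') - w (u + t)))) \<partial>P)"
    by (simp add: H'_def Z'_def algebra_simps)
  also have "\<dots> = (\<integral>\<^sup>+w. H' w * ?K ts t (Z' w) \<partial>P)"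
    by (rule Cons.IH) (use t Cons.prems H' Z' in auto)
  also have "\<dots> = (\<integral>\<^sup>+w. (\<lambda>(w, y). H w * (indicator (C t) (Z w + y) * ?K ts t (Z w + y))) (w, ?Y w) \<partial>P)"
    by (simp add: H'_def Z'_def mult.assoc)
  also have "\<dots> = (\<integral>\<^sup>+w. \<integral>\<^sup>+y. (\<lambda>(w, y). H w * (indicator (C t) (Z w + y) * ?K ts t (Z w + y))) (w, y)
      \<partial>distr P borel ?Y \<partial>P)"
  proof (rule nn_integral_indep_pair[where F="\<F> (u + t0)"])
    show "emeasure P (A \<inter> (?Y -` B \<inter> space P)) = emeasure P A * emeasure P (?Y -` B \<inter> space P)"
      if "A \<in> sets (\<F> (u + t0))" "B \<in> sets borel" for A B
      using that t by (intro increment_indep') auto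
  qed (use t in \<open>auto intro!: measurable_increment sets_filtration prob_space_axioms\<close>)
  also have "\<dots> = (\<integral>\<^sup>+w. H w * (\<integral>\<^sup>+y. indicator (C t) (Z w + y) * ?K ts t (Z w + y) \<partial>distr P borel ?Y) \<partial>P)"
    by (simp add: nn_integral_cmult)
  \<comment> \<open>\<open>max 0\<close> makes \<open>incr_law\<close> a probability law for every
    lag, as measurability of the kernel demands; along a sorted list of times it changes
    nothing.\<close>
  also have "distr P borel ?Y = incr_law (max 0 (t - t0))"
    using t by (subst increment_law') (auto simp: max_def)
  finally show ?case by simp
qed simp

lemma prod_list_indicator:
  "(\<Prod>t\<leftarrow>ts. indicator (C t) (f t) :: ennreal) = of_bool (\<forall>t\<in>set ts. f t \<in> C t)"
  by (induction ts) (auto simp: indicator_def)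

text \<open>The right-hand side sees \<open>A\<close> only through its probability and does not
  contain \<open>u\<close>, which expresses independence of the past and stationarity at the same
  time.\<close>

lemma emeasure_cylinder_shift:
  assumes J: "finite J" "J \<subseteq> {0..}" and C: "\<And>t. t \<in> J \<Longrightarrow> C t \<in> sets borel"
    and u: "0 \<le> u" and A: "A \<in> sets (\<F> u)"
  shows "emeasure P (A \<inter> {w \<in> space P. \<forall>t\<in>J. path_shift u w t \<in> C t}) =
    emeasure P A * cylinder_kernel (\<lambda>d. incr_law (max 0 d)) C (sorted_list_of_set J) 0 0"
proof -
  let ?ts = "sorted_list_of_set J" and ?E = "{w \<in> space P. \<forall>t\<in>J. path_shift u w t \<in> C t}"
  have ts: "set ?ts = J" "sorted (0 # ?ts)" using J by auto
  have AP: "A \<in> sets P" using A sets_filtration by auto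
  have "emeasure P (A \<inter> ?E) = (\<integral>\<^sup>+w. indicator (A \<inter> ?E) w \<partial>P)"
  proof (rule nn_integral_indicator[symmetric])
    have "{w \<in> space P. \<forall>t\<in>J. w (u + t) - w u \<in> C t} \<in> sets P"
      using J C u by (intro sets.sets_Collect_finite_All)
        (auto intro!: measurable_sets_Collect[OF measurable_increment, where P="\<lambda>x. x \<in> C t" for t, simplified])
    also have "{w \<in> space P. \<forall>t\<in>J. w (u + t) - w u \<in> C t} = ?E" using J by (auto simp: path_shift_def)
    finally show "A \<inter> ?E \<in> sets P" using AP by auto
  qed
  also have "\<dots> = (\<integral>\<^sup>+w. indicator A w * (\<Prod>t\<leftarrow>?ts. indicator (C t) (0 + (w (u + t) - w (u + 0)))) \<partial>P)"
    using J unfolding prod_list_indicator ts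
    by (intro nn_integral_cong) (auto simp: indicator_def path_shift_def subset_eq)
  also have "\<dots> = (\<integral>\<^sup>+w. indicator A w * cylinder_kernel (\<lambda>d. incr_law (max 0 d)) C ?ts 0 0 \<partial>P)"
    by (rule nn_integral_cylinder[where Z="\<lambda>_. 0"]) (use ts u A C in auto)
  also have "\<dots> = emeasure P A * cylinder_kernel (\<lambda>d. incr_law (max 0 d)) C ?ts 0 0"
    using AP by (simp add: nn_integral_multc)
  finally show ?thesis .
qed

lemma emeasure_cylinder:
  assumes J: "finite J" "J \<subseteq> {0..}" and C: "\<And>t. t \<in> J \<Longrightarrow> C t \<in> sets borel"
  shows "emeasure P {w \<in> space P. \<forall>t\<in>J. w t \<in> C t} =
    cylinder_kernel (\<lambda>d. incr_law (max 0 d)) C (sorted_list_of_set J) 0 0"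
proof -
  have m: "{w \<in> space P. \<forall>t\<in>J. f w t \<in> C t} \<in> sets P"
    if "\<And>t. t \<in> J \<Longrightarrow> (\<lambda>w. f w t) \<in> borel_measurable P" for f
    using J C that by (intro sets.sets_Collect_finite_All)
      (auto intro!: measurable_sets_Collect[where P="\<lambda>x. x \<in> C t" for t, simplified])
  have sh: "(\<lambda>w. path_shift 0 w t) \<in> borel_measurable P" if "t \<in> J" for t
    using that J by (auto simp: path_shift_def intro!: borel_measurable_diff measurable_coordinate)
  have "emeasure P {w \<in> space P. \<forall>t\<in>J. w t \<in> C t} =
      emeasure P {w \<in> space P. \<forall>t\<in>J. path_shift 0 w t \<in> C t}"
    using start
    by (intro emeasure_eq_AE m sh) (use J in \<open>auto elim!: eventually_mono simp: path_shift_def intro!: measurable_coordinate\<close>)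
  also have "\<dots> = emeasure P (space P \<inter> {w \<in> space P. \<forall>t\<in>J. path_shift 0 w t \<in> C t})"
    by (simp add: Int_def)
  also have "\<dots> = cylinder_kernel (\<lambda>d. incr_law (max 0 d)) C (sorted_list_of_set J) 0 0"
    using sets.top[of "\<F> 0"] emeasure_space_1
    by (subst emeasure_cylinder_shift[OF J C]) auto
  finally show ?thesis .
qed

text \<open>As functions of \<open>E\<close> both sides are finite measures: the image under the
  shift of \<open>P\<close> restricted to \<open>A\<close>, and \<open>P\<close> scaled by the
  probability of \<open>A\<close>. They agree on cylinders.\<close>

lemma emeasure_shift:
  assumes u: "0 \<le> u" and A: "A \<in> sets (\<F> u)" and E: "E \<in> sets path_space"
  shows "emeasure P (A \<inter> (path_shift u -` E \<inter> space P)) = emeasure P A * emeasure P E"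
proof -
  have AP: "A \<in> sets P" using A sets_filtration by auto
  have sh: "path_shift u \<in> measurable P path_space"
    using measurable_path_shift[OF u] by (simp add: measurable_cong_sets[OF sets_P refl])
  then have sh': "path_shift u \<in> measurable (density P (indicator A)) path_space" by simp
  have Am: "indicator A \<in> borel_measurable P" using AP by simp
  have dens: "emeasure (density P (indicator A)) B = emeasure P (A \<inter> B)" if "B \<in> sets P" for B
    using AP that by (simp add: emeasure_density flip: indicator_inter_arith)
  have eq: "distr (density P (indicator A)) path_space (path_shift u) = scale_measure (emeasure P A) P"
  proof (rule measure_eqI_path_space)
    show "finite_measure (distr (density P (indicator A)) path_space (path_shift u))"
      by (intro finite_measure.finite_measure_distr sh' finite_measureI)
        (use AP in \<open>simp add: dens emeasure_eq_measure\<close>)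
    fix J C assume J: "finite J" "J \<subseteq> {0::real..}" and C: "\<And>t. t \<in> J \<Longrightarrow> C t \<in> sets (borel :: (real^'n) measure)"
    let ?E = "{w \<in> space path_space. \<forall>t\<in>J. w t \<in> C t}"
    have E: "?E \<in> sets path_space"
      using J C by (intro sets.sets_Collect_finite_All)
        (auto intro!: measurable_sets_Collect[OF measurable_coordinate_path_space, where P="\<lambda>x. x \<in> C t" for t, simplified])
    have *: "path_shift u -` ?E \<inter> space P = {w \<in> space P. \<forall>t\<in>J. path_shift u w t \<in> C t}"
      using measurable_space[OF sh] by auto
    have "emeasure (distr (density P (indicator A)) path_space (path_shift u)) ?E
        = emeasure P (A \<inter> {w \<in> space P. \<forall>t\<in>J. path_shift u w t \<in> C t})"
      using measurable_sets[OF sh E] unfolding emeasure_distr[OF sh' E] space_density * by (rule dens)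
    also have "\<dots> = emeasure P A * emeasure P ?E"
      using emeasure_cylinder_shift[OF J _ u A, of C] emeasure_cylinder[OF J, of C] C by (simp add: space_P)
    finally show "emeasure (distr (density P (indicator A)) path_space (path_shift u)) ?E =
        emeasure (scale_measure (emeasure P A) P) ?E" by simp
  qed (simp_all add: sets_P)
  have "emeasure P (A \<inter> (path_shift u -` E \<inter> space P)) = emeasure (distr (density P (indicator A)) path_space (path_shift u)) E"
    using measurable_sets[OF sh E] by (subst emeasure_distr[OF sh' E]) (simp add: dens)
  then show ?thesis unfolding eq by simp
qed

lemma distr_shift:
  assumes u: "0 \<le> u" shows "distr P path_space (path_shift u) = P"
proof (rule measure_eqI)
  have sh: "path_shift u \<in> measurable P path_space"
    using measurable_path_shift[OF u] by (simp add: measurable_cong_sets[OF sets_P refl])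
  fix E assume "E \<in> sets (distr P path_space (path_shift u))"
  then show "emeasure (distr P path_space (path_shift u)) E = emeasure P E"
    using emeasure_shift[OF u, of "space P" E] sets.top[of "\<F> u"] emeasure_space_1
    by (simp add: emeasure_distr[OF sh] Int_absorb1)
qed (simp add: sets_P)

text \<open>The Markov property in freezing form: the shifted path is independent of the past of
  \<open>u\<close> and again has law \<open>P\<close>, so \<open>w u\<close> acts as a constant in
  the inner integral.\<close>

lemma nn_integral_freeze:
  assumes u: "0 \<le> u" and H: "H \<in> borel_measurable (\<F> u)"
    and \<Phi>: "(\<lambda>(x, w). \<Phi> x w) \<in> borel_measurable (borel \<Otimes>\<^sub>M path_space)"
  shows "(\<integral>\<^sup>+w. H w * \<Phi> (w u) (path_shift u w) \<partial>P) = (\<integral>\<^sup>+w. H w * (\<integral>\<^sup>+w'. \<Phi> (w u) w' \<partial>P) \<partial>P)"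
proof -
  have sh: "path_shift u \<in> measurable P path_space"
    using measurable_path_shift[OF u] by (simp add: measurable_cong_sets[OF sets_P refl])
  have c: "(\<lambda>w. w u) \<in> borel_measurable (\<F> u)" using u by (intro measurable_coordinate_filtration) auto
  have "(\<lambda>x. (fst x u, snd x)) \<in> measurable (\<F> u \<Otimes>\<^sub>M path_space) (borel \<Otimes>\<^sub>M path_space)"
    using c by measurable
  from measurable_compose[OF this \<Phi>]
  have m: "(\<lambda>(w, w'). H w * \<Phi> (w u) w') \<in> borel_measurable (\<F> u \<Otimes>\<^sub>M path_space)"
    using H by (simp add: case_prod_beta')
  have "(\<integral>\<^sup>+w. (\<lambda>(w, w'). H w * \<Phi> (w u) w') (w, path_shift u w) \<partial>P) =
      (\<integral>\<^sup>+w. \<integral>\<^sup>+w'. (\<lambda>(w, w'). H w * \<Phi> (w u) w') (w, w') \<partial>distr P path_space (path_shift u) \<partial>P)"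
  proof (rule nn_integral_indep_pair[OF prob_space_axioms sets_filtration _ sh _ m])
    fix A B assume A: "A \<in> sets (\<F> u)" and B: "B \<in> sets (path_space :: (real \<Rightarrow> real^'n) measure)"
    have "emeasure P (path_shift u -` B \<inter> space P) = emeasure P B"
      using emeasure_distr[OF sh B] by (simp add: distr_shift[OF u])
    then show "emeasure P (A \<inter> (path_shift u -` B \<inter> space P)) = emeasure P A * emeasure P (path_shift u -` B \<inter> space P)"
      using emeasure_shift[OF u A B] by simp
  qed simp
  also have "\<dots> = (\<integral>\<^sup>+w. H w * (\<integral>\<^sup>+w'. \<Phi> (w u) w' \<partial>P) \<partial>P)"
  proof (intro nn_integral_cong)
    fix w assume "w \<in> space P"
    have "(\<lambda>w'. \<Phi> (w u) w') \<in> borel_measurable path_space"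
      using measurable_compose[OF measurable_Pair1' \<Phi>, of "w u"] by simp
    then have "(\<lambda>w'. \<Phi> (w u) w') \<in> borel_measurable P" by (simp add: measurable_cong_sets[OF sets_P refl])
    then show "(\<integral>\<^sup>+w'. (\<lambda>(w, w'). H w * \<Phi> (w u) w') (w, w') \<partial>distr P path_space (path_shift u)) =
        H w * (\<integral>\<^sup>+w'. \<Phi> (w u) w' \<partial>P)"
      by (simp add: distr_shift[OF u] nn_integral_cmult)
  qed
  finally show ?thesis by simp
qed

end

section \<open>Characteristic functions in several variables\<close>

text \<open>The value at \<open>t = 0\<close> is the total mass, so both measures can be normalised
  to probability laws and Levy's uniqueness theorem applies. Mass zero is separate, since there is
  nothing to normalise.\<close>

lemma finite_measure_eq_of_char_eq:
  fixes M N :: "real measure"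
  assumes "finite_measure M" "finite_measure N" "sets M = sets borel" "sets N = sets borel"
    and eq: "\<And>t. (CLINT x|M. iexp (t * x)) = (CLINT x|N. iexp (t * x))"
  shows "M = N"
proof -
  interpret M: finite_measure M by fact
  interpret N: finite_measure N by fact
  have [simp]: "space M = UNIV" "space N = UNIV"
    using assms(3,4) by (auto dest: sets_eq_imp_space_eq)
  have mass: "measure M UNIV = measure N UNIV"
    using eq[of 0] by (simp del: of_real_eq_iff add: of_real_eq_iff[symmetric])
  show ?thesis
  proof (cases "measure M UNIV = 0")
    case True
    have "emeasure M A = 0" "emeasure N A = 0" for A
      using True mass emeasure_space[of M A] emeasure_space[of N A]
      by (simp_all add: M.emeasure_eq_measure N.emeasure_eq_measure)
    then show ?thesis by (intro measure_eqI) (simp_all add: assms)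
  next
    case False
    define c where "c = 1 / measure M UNIV"
    have c: "c > 0" using False by (simp add: c_def zero_less_measure_iff)
    have rd: "real_distribution (density K (\<lambda>_. ennreal c))"
      if "finite_measure K" "sets K = sets borel" "measure K UNIV = measure M UNIV" for K :: "real measure"
    proof -
      have [simp]: "space K = UNIV" using that(2) by (auto dest: sets_eq_imp_space_eq)
      have "ennreal c * emeasure K UNIV = 1"
        using c False that by (simp add: finite_measure.emeasure_eq_measure c_def ennreal_mult[symmetric])
      then show ?thesis
        unfolding real_distribution_def real_distribution_axioms_def
        using that by (auto intro!: prob_spaceI simp: emeasure_density_const)
    qed
    have ch: "char (density K (\<lambda>_. ennreal c)) t = c *\<^sub>R (CLINT x|K. iexp (t * x))"
      if "sets K = sets borel" for K t
      using c that unfolding char_def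
      by (subst integral_density) (auto simp: measurable_cong_sets[OF that refl])
    have "density M (\<lambda>_. ennreal c) = density N (\<lambda>_. ennreal c)"
      by (rule Levy_uniqueness) (use assms mass ch in \<open>auto intro!: rd simp: fun_eq_iff\<close>)
    then have "density (density M (\<lambda>_. ennreal c)) (\<lambda>_. ennreal (1 / c)) =
        density (density N (\<lambda>_. ennreal c)) (\<lambda>_. ennreal (1 / c))" by simp
    moreover have "ennreal c * ennreal (1 / c) = 1" using c by (simp add: ennreal_mult[symmetric])
    ultimately show ?thesis by (simp add: density_density_eq density_1)
  qed
qed

text \<open>Uniqueness in one dimension, applied to the images under \<open>f\<close> of the
  measures with density \<open>w\<close>; the bounds on \<open>w\<close> make these images finite
  positive measures.\<close>

lemma integral_weight_eq_of_char_eq: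
  fixes M N :: "'a measure" and w f :: "'a \<Rightarrow> real"
  assumes fin: "finite_measure M" "finite_measure N" and sets: "sets M = sets N"
    and w: "w \<in> borel_measurable M" "\<And>x. 0 \<le> w x" "\<And>x. w x \<le> b"
    and f: "f \<in> borel_measurable M"
    and eq: "\<And>t. (CLINT x|M. w x * iexp (t * f x)) = (CLINT x|N. w x * iexp (t * f x))"
    and C: "C \<in> sets borel"
  shows "(LINT x|M. w x * indicator C (f x)) = (LINT x|N. w x * indicator C (f x))"
proof -
  have key: "finite_measure (distr (density K w) borel f) \<and>
      (\<forall>t. (CLINT x|distr (density K w) borel f. iexp (t * x)) = (CLINT x|K. w x * iexp (t * f x))) \<and>
      measure (distr (density K w) borel f) C = (LINT x|K. w x * indicator C (f x))"
    if "finite_measure K" "sets K = sets M" for K :: "'a measure"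
  proof -
    interpret finite_measure K by fact
    have [measurable]: "w \<in> borel_measurable K" "f \<in> borel_measurable K"
      using w f by (simp_all add: measurable_cong_sets[OF that(2) refl])
    note C[measurable]
    have int: "integrable K w" by (rule integrable_const_bound[where B=b]) (use w in auto)
    have "emeasure (density K w) (space K) = (\<integral>\<^sup>+x. w x \<partial>K)"
      by (subst emeasure_density) (auto intro!: nn_integral_cong)
    also have "\<dots> < \<infinity>" using int w by (subst nn_integral_eq_integral) auto
    finally have fin: "finite_measure (density K w)" by (intro finite_measureI) auto
    moreover have "(CLINT x|distr (density K w) borel f. iexp (t * x)) = (CLINT x|K. w x * iexp (t * f x))" for t
      using w by (subst integral_distr) (auto simp: integral_density scaleR_conv_of_real)
    moreover have "measure (distr (density K w) borel f) C = (LINT x|distr (density K w) borel f. indicator C x)"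
      by simp
    moreover have "\<dots> = (LINT x|K. w x * indicator C (f x))"
      using w by (subst integral_distr) (auto simp: integral_density)
    ultimately show ?thesis
      by (auto intro!: finite_measure.finite_measure_distr)
  qed
  have "distr (density M w) borel f = distr (density N w) borel f"
    using key[OF fin(1) refl] key[OF fin(2) sets[symmetric]] eq
    by (intro finite_measure_eq_of_char_eq) auto
  then show ?thesis using key[OF fin(1) refl] key[OF fin(2) sets[symmetric]] by metis
qed

text \<open>Vectors are turned into functions on the index set, where rectangles determine a finite
  measure, and the equality is carried back by the inverse map.\<close>

lemma vec_eqI_measure_cylinder:
  fixes M N :: "(real ^ 'n) measure"
  assumes fin: "finite_measure M" and sets: "sets M = sets borel" "sets N = sets borel"
    and eq: "\<And>S C. (\<And>i. i \<in> S \<Longrightarrow> C i \<in> sets borel) \<Longrightarrow>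
      emeasure M {x. \<forall>i\<in>S. x $ i \<in> C i} = emeasure N {x. \<forall>i\<in>S. x $ i \<in> C i}"
  shows "M = N"
proof -
  let ?S = "Pi\<^sub>M (UNIV :: 'n set) (\<lambda>_. borel :: real measure)"
  have [simp]: "space M = UNIV" "space N = UNIV"
    using sets by (auto dest: sets_eq_imp_space_eq)
  have m: "(\<lambda>x. \<lambda>i\<in>UNIV. x $ i) \<in> measurable borel ?S" by (rule measurable_restrict) simp
  then have m: "($) \<in> measurable M ?S" "($) \<in> measurable N ?S"
    by (simp_all add: measurable_cong_sets[OF sets(1) refl] measurable_cong_sets[OF sets(2) refl] restrict_def)
  have "(\<lambda>f. f i) \<in> borel_measurable ?S" for i by (rule measurable_component_singleton) simp
  then have l: "(\<lambda>f. \<chi> i. f i) \<in> borel_measurable ?S" by (rule borel_measurable_vec_lambda)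
  have "distr M ?S ($) = distr N ?S ($)"
  proof (rule measure_eqI_PiM_infinite)
    fix A and J :: "'n set" assume A: "\<And>i. i \<in> J \<Longrightarrow> A i \<in> sets (borel :: real measure)"
    have E: "prod_emb UNIV (\<lambda>_. borel) J (Pi\<^sub>E J A) \<in> sets ?S"
      using A by (intro sets_PiM_I) auto
    have "($) -` prod_emb UNIV (\<lambda>_. borel) J (Pi\<^sub>E J A) = {x :: real^'n. \<forall>i\<in>J. x $ i \<in> A i}"
      by (auto simp: prod_emb_def)
    then show "emeasure (distr M ?S ($)) (prod_emb UNIV (\<lambda>_. borel) J (Pi\<^sub>E J A)) =
        emeasure (distr N ?S ($)) (prod_emb UNIV (\<lambda>_. borel) J (Pi\<^sub>E J A))"
      using eq[OF A] by (simp add: emeasure_distr m E)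
  qed (use fin m in \<open>auto intro: finite_measure.finite_measure_distr\<close>)
  then have "distr (distr M ?S ($)) borel (\<lambda>f. \<chi> i. f i) = distr (distr N ?S ($)) borel (\<lambda>f. \<chi> i. f i)" by simp
  then have "distr M borel (\<lambda>x. x) = distr N borel (\<lambda>x. x)" using m l by (simp add: distr_distr comp_def)
  then show ?thesis using sets by (simp add: distr_id2)
qed

text \<open>Induction on the set of coordinates in which the exponential has been replaced by an
  indicator.  The weights \<open>1 + Re (c e\<^sup>i\<^sup>v\<^sup>x)\<close> with \<open>c = 1, -i\<close> are nonnegative, so that the
  one-dimensional uniqueness theorem for positive measures applies to each coordinate.\<close>

theorem char_uniqueness_vec:
  fixes M N :: "(real ^ 'n) measure"
  assumes fin: "finite_measure M" "finite_measure N" and sets: "sets M = sets borel" "sets N = sets borel"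
    and eq: "\<And>v. (CLINT x|M. iexp (v \<bullet> x)) = (CLINT x|N. iexp (v \<bullet> x))"
  shows "M = N"
proof -
  have [measurable_cong]: "sets M = sets borel" "sets N = sets borel" by fact+
  let ?I = "\<lambda>S C (x :: real ^ 'n). \<Prod>i\<in>S. indicator (C i) (x $ i) :: real"
  have P01: "0 \<le> ?I S C x" "?I S C x \<le> 1" for S C and x :: "real ^ 'n"
    by (auto intro!: prod_nonneg prod_le_1)
  have Pm: "?I S C \<in> borel_measurable borel" if "\<And>i. i \<in> S \<Longrightarrow> C i \<in> sets borel" for S and C :: "'n \<Rightarrow> real set"
    using measurable_compose[OF borel_measurable_nth borel_measurable_indicator] that
    by (intro borel_measurable_prod) auto
  have int: "integrable K (\<lambda>x. complex_of_real (?I S C x) * iexp (v \<bullet> x))"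
    if "finite_measure K" "sets K = sets borel" "\<And>i. i \<in> S \<Longrightarrow> C i \<in> sets borel" for K S C v
  proof (rule finite_measure.integrable_const_bound[OF that(1), where B=1])
    have [measurable]: "?I S C \<in> borel_measurable borel" using that(3) by (rule Pm)
    show "(\<lambda>x. complex_of_real (?I S C x) * iexp (v \<bullet> x)) \<in> borel_measurable K"
      unfolding measurable_cong_sets[OF that(2) refl] by measurable
  qed (use P01 in \<open>auto simp: norm_mult abs_of_nonneg simp del: of_real_prod\<close>)
  \<comment> \<open>Coordinates in \<open>S\<close> are tested by indicators, the others by
    exponentials; therefore \<open>v\<close> has to vanish on \<open>S\<close>. The case of empty
    \<open>S\<close> is the hypothesis, and \<open>v = 0\<close> is what is finally used.\<close>
  have main: "(CLINT x|M. ?I S C x * iexp (v \<bullet> x)) = (CLINT x|N. ?I S C x * iexp (v \<bullet> x))"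
    if "\<And>i. i \<in> S \<Longrightarrow> C i \<in> sets borel" "\<And>i. i \<in> S \<Longrightarrow> v $ i = 0" for S C v
    using finite[of S] that
  proof (induction S arbitrary: v rule: finite_induct)
    case empty
    then show ?case using eq by simp
  next
    case (insert k S)
    have C: "\<And>i. i \<in> S \<Longrightarrow> C i \<in> sets borel" "C k \<in> sets borel" using insert.prems by auto
    have [measurable]: "?I S C \<in> borel_measurable borel" using C(1) by (rule Pm)
    have weights: "(LINT x|M. ?I S C x * (1 + Re (c * iexp (v \<bullet> x))) * indicator (C k) (x $ k)) =
        (LINT x|N. ?I S C x * (1 + Re (c * iexp (v \<bullet> x))) * indicator (C k) (x $ k))"
      if c: "cmod c = 1" and v: "\<And>i. i \<in> insert k S \<Longrightarrow> v $ i = 0" for c v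
    proof (rule integral_weight_eq_of_char_eq[where b=2])
      have Re1: "\<bar>Re (c * iexp (v \<bullet> x))\<bar> \<le> 1" for x
        using abs_Re_le_cmod[of "c * iexp (v \<bullet> x)"] c by (simp add: norm_mult)
      show "0 \<le> ?I S C x * (1 + Re (c * iexp (v \<bullet> x)))" for x
        using Re1[of x] P01[where S=S and C=C and x=x] by (intro mult_nonneg_nonneg) auto
      show "?I S C x * (1 + Re (c * iexp (v \<bullet> x))) \<le> 2" for x
        using mult_mono[of "?I S C x" 1 "1 + Re (c * iexp (v \<bullet> x))" 2] Re1[of x] P01[where S=S and C=C and x=x] by auto
      fix t
      \<comment> \<open>Writing a real part as half the sum of a number and its conjugate splits the
        weight into pure exponentials. The three frequencies vanish on \<open>S\<close>, so the
        induction hypothesis covers each of them.\<close>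
      have expand: "(CLINT x|K. ?I S C x * (1 + Re (c * iexp (v \<bullet> x))) * iexp (t * x $ k)) =
          (CLINT x|K. ?I S C x * iexp ((t *\<^sub>R axis k 1) \<bullet> x)) +
          c / 2 * (CLINT x|K. ?I S C x * iexp ((v + t *\<^sub>R axis k 1) \<bullet> x)) +
          cnj c / 2 * (CLINT x|K. ?I S C x * iexp ((- v + t *\<^sub>R axis k 1) \<bullet> x))"
        if "finite_measure K" "sets K = sets borel" for K
      proof -
        have i: "integrable K (\<lambda>x. complex_of_real (?I S C x) * iexp (v \<bullet> x))" for v
          using int[OF that, of S C] C(1) by blast
        have "?I S C x * (1 + Re (c * iexp (v \<bullet> x))) * iexp (t * x $ k) =
          ?I S C x * iexp ((t *\<^sub>R axis k 1) \<bullet> x) +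
          c / 2 * (?I S C x * iexp ((v + t *\<^sub>R axis k 1) \<bullet> x)) +
          cnj c / 2 * (?I S C x * iexp ((- v + t *\<^sub>R axis k 1) \<bullet> x))" for x
        proof -
          define z u q where "z = iexp (v \<bullet> x)" and "u = iexp (t * x $ k)" and "q = complex_of_real (?I S C x)"
          have "complex_of_real (1 + Re (c * z)) = 1 + (c * z + cnj c * cnj z) / 2"
            using complex_add_cnj[of "c * z"] by simp
          moreover have "iexp ((v + t *\<^sub>R axis k 1) \<bullet> x) = z * u"
            "iexp ((- v + t *\<^sub>R axis k 1) \<bullet> x) = cnj z * u"
            "iexp ((t *\<^sub>R axis k 1) \<bullet> x) = u"
            by (simp_all add: z_def u_def inner_add_left inner_diff_left inner_axis' exp_add exp_diff
                ring_distribs exp_cnj exp_minus divide_inverse)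
          ultimately show ?thesis
            unfolding q_def[symmetric] z_def[symmetric] u_def[symmetric]
            unfolding of_real_mult q_def[symmetric]
            by (simp only:) (simp add: field_simps)
        qed
        then show ?thesis
          by (simp only: Bochner_Integration.integral_add Bochner_Integration.integrable_add
              integrable_mult_right i integral_mult_right_zero)
      qed
      have vk: "\<And>i. i \<in> S \<Longrightarrow> i \<noteq> k" using insert.hyps by auto
      show "(CLINT x|M. (?I S C x * (1 + Re (c * iexp (v \<bullet> x)))) * iexp (t * x $ k)) =
          (CLINT x|N. (?I S C x * (1 + Re (c * iexp (v \<bullet> x)))) * iexp (t * x $ k))"
      proof -
        have IH: "(CLINT x|M. ?I S C x * iexp (u \<bullet> x)) = (CLINT x|N. ?I S C x * iexp (u \<bullet> x))"
          if "u = t *\<^sub>R axis k 1 \<or> u = v + t *\<^sub>R axis k 1 \<or> u = - v + t *\<^sub>R axis k 1" for u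
          by (rule insert.IH) (use that C v vk in \<open>auto simp: axis_def\<close>)
        show ?thesis
          unfolding expand[OF fin(1) sets(1)] expand[OF fin(2) sets(2)] by (simp only: IH simp_thms)
      qed
    qed (use C fin sets in simp_all)
    have fact: "?I (insert k S) C x = ?I S C x * indicator (C k) (x $ k)" for x
      using insert.hyps by simp
    have reint: "integrable K (\<lambda>x. ?I (insert k S) C x)"
       "integrable K (\<lambda>x. ?I (insert k S) C x * Re (c * iexp (v \<bullet> x)))"
      if "finite_measure K" "sets K = sets borel" for K c v
    proof -
      show "integrable K (\<lambda>x. ?I (insert k S) C x)"
        using integrable_Re[OF int[OF that, of "insert k S" C 0]] insert.prems(1) by (simp del: of_real_prod)
      have "integrable K (\<lambda>x. Re (c * (complex_of_real (?I (insert k S) C x) * iexp (v \<bullet> x))))"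
        by (intro integrable_Re integrable_mult_right int that) (use C in auto)
      then show "integrable K (\<lambda>x. ?I (insert k S) C x * Re (c * iexp (v \<bullet> x)))"
        by (rule Bochner_Integration.integrable_cong[THEN iffD1, rotated 2]) (simp_all add: algebra_simps del: of_real_prod)
    qed
    \<comment> \<open>For \<open>c = 1\<close> and frequency 0 the weight is the constant 2.\<close>
    have zero: "(LINT x|M. ?I (insert k S) C x) = (LINT x|N. ?I (insert k S) C x)"
      using weights[of 1 0] by (simp add: fact mult.assoc mult.left_commute[of _ 2])
    have re: "(LINT x|M. ?I (insert k S) C x * Re (c * iexp (v \<bullet> x))) =
        (LINT x|N. ?I (insert k S) C x * Re (c * iexp (v \<bullet> x)))" if "cmod c = 1" for c
    proof -
      have "(LINT x|K. ?I S C x * (1 + Re (c * iexp (v \<bullet> x))) * indicator (C k) (x $ k)) =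
          (LINT x|K. ?I (insert k S) C x) + (LINT x|K. ?I (insert k S) C x * Re (c * iexp (v \<bullet> x)))"
        if "finite_measure K" "sets K = sets borel" for K
        using reint[OF that] by (subst Bochner_Integration.integral_add[symmetric])
           (auto simp: fact algebra_simps intro!: Bochner_Integration.integral_cong)
      then show ?thesis using weights[OF that, of v] insert.prems zero fin sets by auto
    qed
    show ?case
    proof (rule complex_eqI)
      have *: "integrable K (\<lambda>x. complex_of_real (?I (insert k S) C x) * iexp (v \<bullet> x))"
        if "finite_measure K" "sets K = sets borel" for K using that insert.prems(1) by (rule int)
      show "Re (CLINT x|M. ?I (insert k S) C x * iexp (v \<bullet> x)) = Re (CLINT x|N. ?I (insert k S) C x * iexp (v \<bullet> x))"
        using re[of 1] *[OF fin(1) sets(1)] *[OF fin(2) sets(2)]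
        by (simp add: integral_Re[symmetric] del: of_real_prod)
      \<comment> \<open>The real part of \<open>- \<i> * z\<close> is the imaginary part of
        \<open>z\<close>, so the two choices of \<open>c\<close> recover the complex
        integral.\<close>
      show "Im (CLINT x|M. ?I (insert k S) C x * iexp (v \<bullet> x)) = Im (CLINT x|N. ?I (insert k S) C x * iexp (v \<bullet> x))"
        using re[of "- \<i>"] *[OF fin(1) sets(1)] *[OF fin(2) sets(2)]
        by (simp add: integral_Im[symmetric] del: of_real_prod)
    qed
  qed
  show ?thesis
  proof (rule vec_eqI_measure_cylinder[OF fin(1) sets])
    fix S and C :: "'n \<Rightarrow> real set" assume C: "\<And>i. i \<in> S \<Longrightarrow> C i \<in> sets borel"
    let ?E = "{x :: real ^ 'n. \<forall>i\<in>S. x $ i \<in> C i}"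
    have ind: "?I S C x = indicator ?E x" for x by (auto simp: indicator_def)
    have "?I S C \<in> borel_measurable borel" using C by (rule Pm)
    then have E: "?E \<in> sets borel"
      unfolding ind by (simp add: borel_measurable_indicator_iff)
    have "(CLINT x|M. complex_of_real (indicator ?E x)) = (CLINT x|N. complex_of_real (indicator ?E x))"
      using main[where S=S and C=C and v=0] C unfolding ind by (simp del: of_real_prod)
    then have "measure M ?E = measure N ?E"
      using E sets by (simp del: of_real_indicator)
    then show "emeasure M ?E = emeasure N ?E"
      using fin by (simp add: finite_measure.emeasure_eq_measure)
  qed
qed

section \<open>Gaussian vectors\<close>

definition centred_normal :: "real \<Rightarrow> real measure" where
  "centred_normal h = density lborel (\<lambda>x. ennreal (normal_density 0 (sqrt h) x))"

lemma space_centred_normal [simp]: "space (centred_normal h) = UNIV"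
  and sets_centred_normal [simp, measurable_cong]: "sets (centred_normal h) = sets borel"
  by (simp_all add: centred_normal_def)

lemma space_gauss [simp]: "space (gauss h) = UNIV"
  and sets_gauss [simp, measurable_cong]: "sets (gauss h) = sets borel"
  by (simp_all add: gauss_def)

lemma prob_space_centred_normal: "h > 0 \<Longrightarrow> prob_space (centred_normal h)"
  unfolding centred_normal_def by (rule prob_space_normal_density) simp

lemma prod_Basis_vec: "(\<Prod>b\<in>(Basis :: (real ^ 'n) set). f b) = (\<Prod>i\<in>UNIV. f (axis i 1))"
proof -
  have "(Basis :: (real ^ 'n) set) = (\<lambda>i. axis i 1) ` UNIV" by (auto simp: Basis_vec_def)
  moreover have "inj (\<lambda>i :: 'n. axis i (1 :: real))" by (auto simp: inj_def axis_eq_axis)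
  ultimately show ?thesis using prod.reindex[of "\<lambda>i :: 'n. axis i (1 :: real)" UNIV f] by (simp only: comp_def)
qed

lemma nn_integral_lborel_vec_prod:
  fixes f :: "'n::finite \<Rightarrow> real \<Rightarrow> ennreal"
  assumes [measurable]: "\<And>i. f i \<in> borel_measurable borel"
  shows "(\<integral>\<^sup>+x. (\<Prod>i\<in>UNIV. f i (x $ i)) \<partial>lborel) = (\<Prod>i\<in>UNIV. \<integral>\<^sup>+x. f i x \<partial>lborel)"
proof -
  \<comment> \<open>Product integration over Euclidean space is indexed by basis vectors;
    \<open>THE\<close> recovers the coordinate to which a basis vector belongs.\<close>
  define g where "g b = f (THE i. b = axis i 1)" for b :: "real ^ 'n"
  have g: "g (axis i 1) = f i" for i by (simp add: g_def axis_eq_axis)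
  have "(\<integral>\<^sup>+x. (\<Prod>b\<in>Basis. g b (x \<bullet> b)) \<partial>lborel) = (\<Prod>b\<in>Basis. \<integral>\<^sup>+x. g b x \<partial>lborel)"
    by (rule nn_integral_lborel_prod) (simp_all add: g_def)
  then show ?thesis by (simp add: prod_Basis_vec g inner_axis)
qed

lemma measurable_coordinates_gauss:
  "(\<lambda>x i. (x :: real ^ 'n) $ i) \<in> measurable (gauss h) (Pi\<^sub>M UNIV (\<lambda>_. centred_normal h))"
proof -
  have "(\<lambda>x. \<lambda>i\<in>UNIV. (x :: real ^ 'n) $ i) \<in> measurable (gauss h) (Pi\<^sub>M UNIV (\<lambda>_. centred_normal h))"
    by (rule measurable_restrict) simp
  then show ?thesis by (simp add: restrict_def)
qed

text \<open>Opens the way to the product-measure theorems: integrability and integrals of products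
  over coordinates reduce to one dimension.\<close>

lemma distr_gauss_coordinates:
  assumes h: "h > 0"
  shows "distr (gauss h) (Pi\<^sub>M UNIV (\<lambda>_ :: 'n. centred_normal h)) (\<lambda>x i. (x :: real ^ 'n) $ i) =
    Pi\<^sub>M UNIV (\<lambda>_. centred_normal h)"
proof -
  interpret prob_space "centred_normal h" using h by (rule prob_space_centred_normal)
  interpret product_sigma_finite "\<lambda>_ :: 'n. centred_normal h" by unfold_locales
  let ?S = "Pi\<^sub>M UNIV (\<lambda>_ :: 'n. centred_normal h)"
  have m: "(\<lambda>x i. (x :: real ^ 'n) $ i) \<in> measurable (gauss h) ?S"
    by (rule measurable_coordinates_gauss)
  show ?thesis
  proof (rule PiM_eqI)
    fix A assume A: "\<And>i :: 'n. i \<in> UNIV \<Longrightarrow> A i \<in> sets (centred_normal h)"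
    then have [measurable]: "A i \<in> sets borel" for i by simp
    have E: "Pi\<^sub>E UNIV A \<in> sets ?S" using A by (intro sets_PiM_I_finite) auto
    have pre: "(\<lambda>x i. (x :: real ^ 'n) $ i) -` Pi\<^sub>E UNIV A \<inter> space (gauss h) = {x. \<forall>i. x $ i \<in> A i}"
      by auto
    have "{x :: real ^ 'n. \<forall>i. x $ i \<in> A i} \<in> sets (gauss h)"
      using measurable_sets[OF m E] unfolding pre .
    then have "emeasure (gauss h) {x :: real ^ 'n. \<forall>i. x $ i \<in> A i} =
        (\<integral>\<^sup>+x. ennreal (\<Prod>i\<in>UNIV. normal_density 0 (sqrt h) (x $ i)) * indicator {x. \<forall>i. x $ i \<in> A i} x \<partial>(lborel :: (real ^ 'n) measure))"
      unfolding gauss_def by (subst emeasure_density) auto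
    also have "\<dots> = (\<integral>\<^sup>+x. (\<Prod>i\<in>UNIV. ennreal (normal_density 0 (sqrt h) (x $ i)) * indicator (A i) (x $ i)) \<partial>(lborel :: (real ^ 'n) measure))"
    proof (intro nn_integral_cong)
      fix x :: "real ^ 'n"
      have "indicator {x. \<forall>i. x $ i \<in> A i} x = (\<Prod>i\<in>UNIV. indicator (A i) (x $ i) :: ennreal)"
        by (auto simp: indicator_def)
      then show "ennreal (\<Prod>i\<in>UNIV. normal_density 0 (sqrt h) (x $ i)) * indicator {x. \<forall>i. x $ i \<in> A i} x =
          (\<Prod>i\<in>UNIV. ennreal (normal_density 0 (sqrt h) (x $ i)) * indicator (A i) (x $ i))"
        by (simp add: prod.distrib prod_ennreal)
    qed
    also have "\<dots> = (\<Prod>i\<in>UNIV. \<integral>\<^sup>+x. ennreal (normal_density 0 (sqrt h) x) * indicator (A i) x \<partial>lborel)"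
      by (rule nn_integral_lborel_vec_prod) simp
    also have "\<dots> = (\<Prod>i\<in>UNIV. emeasure (centred_normal h) (A i))"
      unfolding centred_normal_def by (simp add: emeasure_density)
    finally show "emeasure (distr (gauss h) ?S (\<lambda>x i. x $ i)) (Pi\<^sub>E UNIV A) =
        (\<Prod>i\<in>UNIV. emeasure (centred_normal h) (A i))"
      unfolding emeasure_distr[OF m E] pre .
  qed simp_all
qed

lemma prob_space_gauss: "h > 0 \<Longrightarrow> prob_space (gauss h :: (real ^ 'n) measure)"
proof -
  assume h: "h > 0"
  interpret product_prob_space "\<lambda>_ :: 'n. centred_normal h" UNIV
    using h by (simp add: product_prob_space_def product_prob_space_axioms_def product_sigma_finite_def
        prob_space_centred_normal prob_space_imp_sigma_finite)
  have m: "(\<lambda>x i. (x :: real ^ 'n) $ i) \<in> measurable (gauss h) (Pi\<^sub>M UNIV (\<lambda>_. centred_normal h))"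
    by (rule measurable_coordinates_gauss)
  show ?thesis
    by (rule prob_space_distrD[OF m]) (simp add: distr_gauss_coordinates[OF h] P.prob_space_axioms)
qed

lemma gauss_prod:
  fixes f :: "'n::finite \<Rightarrow> real \<Rightarrow> 'b::{real_normed_field, banach, second_countable_topology}"
  assumes h: "h > 0" and f: "\<And>i. integrable (centred_normal h) (f i)"
  shows integrable_gauss_prod: "integrable (gauss h) (\<lambda>x. \<Prod>i\<in>UNIV. f i (x $ i))"
    and integral_gauss_prod: "(LINT x|gauss h. (\<Prod>i\<in>UNIV. f i (x $ i))) = (\<Prod>i\<in>UNIV. LINT y|centred_normal h. f i y)"
proof -
  interpret prob_space "centred_normal h" using h by (rule prob_space_centred_normal)
  interpret product_sigma_finite "\<lambda>_ :: 'n. centred_normal h" by unfold_locales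
  let ?S = "Pi\<^sub>M UNIV (\<lambda>_ :: 'n. centred_normal h)"
  have m: "(\<lambda>x i. (x :: real ^ 'n) $ i) \<in> measurable (gauss h) ?S"
    by (rule measurable_coordinates_gauss)
  have i: "integrable ?S (\<lambda>x. \<Prod>i\<in>UNIV. f i (x i))" by (rule product_integrable_prod) (use f in auto)
  then have b: "(\<lambda>x. \<Prod>i\<in>UNIV. f i (x i)) \<in> borel_measurable ?S" by auto
  show "integrable (gauss h) (\<lambda>x. \<Prod>i\<in>UNIV. f i (x $ i))"
    using i integrable_distr_eq[OF m b] unfolding distr_gauss_coordinates[OF h] by blast
  have "(LINT x|gauss h. (\<Prod>i\<in>UNIV. f i (x $ i))) = (LINT x|?S. (\<Prod>i\<in>UNIV. f i (x i)))"
    using integral_distr[OF m b] unfolding distr_gauss_coordinates[OF h] by simp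
  also have "\<dots> = (\<Prod>i\<in>UNIV. LINT y|centred_normal h. f i y)" by (rule product_integral_prod) (use f in auto)
  finally show "(LINT x|gauss h. (\<Prod>i\<in>UNIV. f i (x $ i))) = (\<Prod>i\<in>UNIV. LINT y|centred_normal h. f i y)" .
qed

lemma centred_normal_moments:
  assumes h: "h > 0"
  shows "has_bochner_integral (centred_normal h) (\<lambda>x. x) 0"
    and "has_bochner_integral (centred_normal h) (\<lambda>x. x\<^sup>2) h"
    and "has_bochner_integral (centred_normal h) (\<lambda>x. x ^ 4) (3 * h\<^sup>2)"
    and "has_bochner_integral (centred_normal h) (\<lambda>x. exp (c * x)) (exp (c\<^sup>2 * h / 2))"
proof -
  have *: "has_bochner_integral (centred_normal h) f v"
    if "has_bochner_integral lborel (\<lambda>x. normal_density 0 (sqrt h) x * f x) v" "f \<in> borel_measurable borel" for f v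
    using that unfolding centred_normal_def by (intro has_bochner_integral_density) auto
  have s: "0 < sqrt h" using h by simp
  show "has_bochner_integral (centred_normal h) (\<lambda>x. x) 0"
    using normal_moment_odd[OF s, of 0 0] by (intro *) simp_all
  show "has_bochner_integral (centred_normal h) (\<lambda>x. x\<^sup>2) h"
    using normal_moment_even[OF s, of 0 1] h by (intro *) (simp_all add: fact_2)
  show "has_bochner_integral (centred_normal h) (\<lambda>x. x ^ 4) (3 * h\<^sup>2)"
    using normal_moment_even[OF s, of 0 2] h
    by (intro *) (simp_all add: fact_2 fact_numeral power_divide field_simps)
  \<comment> \<open>Completing the square: tilting the centred normal law by an exponential gives a
    multiple of the normal density with mean \<open>c * h\<close>, and the multiple is the moment
    generating function.\<close>
  have "normal_density 0 (sqrt h) x * exp (c * x) = exp (c\<^sup>2 * h / 2) * normal_density (c * h) (sqrt h) x" for x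
  proof -
    have "- x\<^sup>2 / (2 * h) + c * x = c\<^sup>2 * h / 2 + (- (x - c * h)\<^sup>2 / (2 * h))"
      using h by (simp add: field_simps power2_eq_square)
    then show ?thesis using h by (simp add: normal_density_def exp_add[symmetric])
  qed
  moreover have "has_bochner_integral lborel (normal_density (c * h) (sqrt h)) 1"
    using s by (simp add: has_bochner_integral_iff integrable_normal_density integral_normal_density)
  ultimately show "has_bochner_integral (centred_normal h) (\<lambda>x. exp (c * x)) (exp (c\<^sup>2 * h / 2))"
    using has_bochner_integral_mult_right[of "exp (c\<^sup>2 * h / 2)" lborel "normal_density (c * h) (sqrt h)" 1] by (intro *) simp_all
qed

lemma char_centred_normal:
  assumes h: "h > 0"
  shows "(CLINT x|centred_normal h. iexp (c * x)) = exp (- c\<^sup>2 * h / 2)"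
proof -
  have "(CLINT x|centred_normal h. iexp (c * x)) = (CLINT x|lborel. normal_density 0 (sqrt h) x *\<^sub>R iexp (c * x))"
    unfolding centred_normal_def by (subst integral_density) auto
  \<comment> \<open>Substituting \<open>sqrt h * x\<close> reduces the claim to the standard normal
    law, whose characteristic function is known.\<close>
  also have "\<dots> = sqrt h *\<^sub>R (CLINT x|lborel. normal_density 0 (sqrt h) (sqrt h * x) *\<^sub>R iexp (c * (sqrt h * x)))"
    using lborel_integral_real_affine[of "sqrt h" "\<lambda>x. normal_density 0 (sqrt h) x *\<^sub>R iexp (c * x)" 0] h by simp
  also have "\<dots> = (CLINT x|lborel. std_normal_density x *\<^sub>R iexp (c * sqrt h * x))"
  proof -
    have "sqrt h * normal_density 0 (sqrt h) (sqrt h * x) = std_normal_density x" for x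
      using h by (simp add: normal_density_def power_mult_distrib real_sqrt_mult)
    then show ?thesis
      by (subst integral_scaleR_right[symmetric]) (simp only: scaleR_scaleR mult.assoc)
  qed
  also have "\<dots> = char std_normal_distribution (c * sqrt h)"
    unfolding char_def by (subst integral_density) auto
  also have "\<dots> = exp (- c\<^sup>2 * h / 2)" using h by (simp add: char_std_normal_distribution power_mult_distrib)
  finally show ?thesis .
qed

lemma gauss_moments:
  fixes v :: "real ^ 'n"
  assumes h: "h > 0"
  shows "has_bochner_integral (gauss h) (\<lambda>x. (x :: real ^ 'n) $ k) 0"
    and "has_bochner_integral (gauss h) (\<lambda>x. (x :: real ^ 'n) $ k * x $ l) (if k = l then h else 0)"
    and "has_bochner_integral (gauss h) (\<lambda>x. ((x :: real ^ 'n) $ k) ^ 4) (3 * h\<^sup>2)"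
    and "has_bochner_integral (gauss h) (\<lambda>x. exp (v \<bullet> x)) (exp ((norm v)\<^sup>2 * h / 2))"
    and "(CLINT x|gauss h. iexp (v \<bullet> x)) = exp (- (norm v)\<^sup>2 * h / 2)"
proof -
  interpret prob_space "centred_normal h" using h by (rule prob_space_centred_normal)
  note m = centred_normal_moments[OF h, unfolded has_bochner_integral_iff]
  have P: "has_bochner_integral (gauss h) (\<lambda>x. \<Prod>i\<in>UNIV. f i (x $ i)) (\<Prod>i\<in>UNIV. LINT y|centred_normal h. f i y)"
    if "\<And>i. integrable (centred_normal h) (f i)" for f :: "'n \<Rightarrow> real \<Rightarrow> real"
    using gauss_prod[OF h, of f] that unfolding has_bochner_integral_iff by blast
  have single: "has_bochner_integral (gauss h) (\<lambda>x. g (x $ k)) (LINT y|centred_normal h. g y)"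
    if "integrable (centred_normal h) g" for g :: "real \<Rightarrow> real" and k :: 'n
  proof -
    have 1: "(\<Prod>i\<in>UNIV. if i = k then g (x $ i) else 1) = g (x $ k)" for x :: "real ^ 'n" by simp
    have 2: "(\<Prod>i\<in>UNIV. LINT y|centred_normal h. (if i = k then g y else 1)) = (LINT y|centred_normal h. g y)"
      using prob_space by (subst prod.remove[of _ k]) auto
    have "has_bochner_integral (gauss h) (\<lambda>x. \<Prod>i\<in>UNIV. if i = k then g (x $ i) else 1)
        (\<Prod>i\<in>UNIV. LINT y|centred_normal h. (if i = k then g y else 1))"
    proof (rule P)
      show "integrable (centred_normal h) (\<lambda>y. if i = k then g y else 1)" for i
        by (cases "i = k") (use that in auto)
    qed
    then show ?thesis unfolding 1 2 .
  qed
  show "has_bochner_integral (gauss h) (\<lambda>x. (x :: real ^ 'n) $ k) 0" using single[of "\<lambda>x. x" k] m(1) by simp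
  show "has_bochner_integral (gauss h) (\<lambda>x. ((x :: real ^ 'n) $ k) ^ 4) (3 * h\<^sup>2)" using single[of "\<lambda>x. x ^ 4" k] m(3) by simp
  show "has_bochner_integral (gauss h) (\<lambda>x. (x :: real ^ 'n) $ k * x $ l) (if k = l then h else 0)"
  proof (cases "k = l")
    case True
    then show ?thesis using single[of "\<lambda>x. x\<^sup>2" k] m(2) by (simp add: power2_eq_square)
  next
    case False
    \<comment> \<open>Only the factors \<open>k\<close> and \<open>l\<close> are non-constant, and
      each of them has mean zero, so the product of the integrals vanishes.\<close>
    let ?f = "\<lambda>i y. if i = k \<or> i = l then y else 1 :: real"
    have 1: "(\<Prod>i\<in>UNIV. ?f i (x $ i)) = x $ k * x $ l" for x :: "real ^ 'n"
    proof -
      have "(\<Prod>i\<in>UNIV. ?f i (x $ i)) = (\<Prod>i\<in>{k, l}. x $ i)"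
        by (rule prod.mono_neutral_cong_right) auto
      then show ?thesis using False by simp
    qed
    have i: "integrable (centred_normal h) (?f i)" for i using m(1) by (cases "i = k \<or> i = l") auto
    have 2: "(\<Prod>i\<in>UNIV. LINT y|centred_normal h. ?f i y) = 0"
      by (rule prod_zero) (use m(1) in \<open>auto intro!: exI[of _ k]\<close>)
    show ?thesis using P[of ?f, OF i] False unfolding 1 2 by simp
  qed
  have "has_bochner_integral (gauss h) (\<lambda>x. \<Prod>i\<in>UNIV. exp (v $ i * x $ i)) (\<Prod>i\<in>UNIV. LINT y|centred_normal h. exp (v $ i * y))"
    using m(4) by (intro P) auto
  then show "has_bochner_integral (gauss h) (\<lambda>x. exp (v \<bullet> x)) (exp ((norm v)\<^sup>2 * h / 2))"
    using m(4) unfolding power2_norm_eq_inner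
    by (simp add: exp_sum[symmetric] inner_vec_def sum_divide_distrib sum_distrib_right power2_eq_square)
  have i: "integrable (centred_normal h) (\<lambda>x. iexp (c * x))" for c
    by (rule integrable_const_bound[where B=1]) auto
  have "(CLINT x|gauss h. (\<Prod>i\<in>UNIV. iexp (v $ i * x $ i))) = (\<Prod>i\<in>UNIV. CLINT y|centred_normal h. iexp (v $ i * y))"
    using i by (intro integral_gauss_prod h) auto
  also have "\<dots> = (\<Prod>i\<in>UNIV. of_real (exp (- (v $ i)\<^sup>2 * h / 2)))" by (simp only: char_centred_normal[OF h])
  also have "\<dots> = of_real (exp (\<Sum>i\<in>UNIV. - (v $ i)\<^sup>2 * h / 2))" unfolding exp_sum[OF finite] of_real_prod ..
  also have "(\<Sum>i\<in>UNIV. - (v $ i)\<^sup>2 * h / 2) = - (norm v)\<^sup>2 * h / 2"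
    unfolding power2_norm_eq_inner
    by (simp add: inner_vec_def sum_divide_distrib sum_distrib_right power2_eq_square sum_negf)
  also have "(CLINT x|gauss h. (\<Prod>i\<in>UNIV. iexp (v $ i * x $ i))) = (CLINT x|gauss h. iexp (v \<bullet> x))"
    by (simp add: exp_sum[symmetric] inner_vec_def sum_distrib_left)
  finally show "(CLINT x|gauss h. iexp (v \<bullet> x)) = exp (- (norm v)\<^sup>2 * h / 2)" by simp
qed

section \<open>The Laplace transform of the exponential functionals\<close>

lemma norm_integral_mono_AE:
  fixes f :: "'a \<Rightarrow> 'b::{banach, second_countable_topology}"
  assumes "integrable M g" "AE x in M. norm (f x) \<le> g x"
  shows "norm (LINT x|M. f x) \<le> (LINT x|M. g x)"
  by (rule order_trans[OF integral_norm_bound integral_mono_AE'])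
    (use assms in \<open>auto elim!: eventually_mono intro: order_trans[OF norm_ge_zero]\<close>)

lemma taylor2_bound:
  fixes f f' f'' :: "real \<Rightarrow> real"
  assumes "\<And>t. (f has_real_derivative f' t) (at t)" "\<And>t. (f' has_real_derivative f'' t) (at t)"
    and "\<And>t. \<bar>f'' t\<bar> \<le> B"
  shows "\<bar>f 1 - f 0 - f' 0\<bar> \<le> B / 2"
proof -
  define d where "d m = (if m = 0 then f else if m = 1 then f' else f'')" for m :: nat
  have "\<exists>t>0. t < 1 \<and> f 1 = (\<Sum>m<2. d m 0 / fact m * 1 ^ m) + d 2 t / fact 2 * 1 ^ 2"
    by (rule Maclaurin) (use assms in \<open>auto simp: d_def less_2_cases_iff\<close>)
  then obtain t where "f 1 = (\<Sum>m<2. d m 0 / fact m * 1 ^ m) + d 2 t / fact 2 * 1 ^ 2" by blast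
  then have "f 1 - f 0 - f' 0 = f'' t / 2" by (simp add: d_def numeral_2_eq_2)
  then have "\<bar>f 1 - f 0 - f' 0\<bar> = \<bar>f'' t\<bar> / 2" by (simp only: abs_divide abs_numeral)
  then show ?thesis using assms(3)[of t] by linarith
qed

text \<open>Compare the expansions of \<open>f (x + \<xi> + \<eta>)\<close> at \<open>x\<close> and at \<open>x + \<xi>\<close>, with \<open>\<eta>\<close> a vector of the
  length of \<open>\<xi>\<close> in the direction of the difference of the gradients.\<close>

lemma gradient_lipschitz:
  fixes f :: "'a::real_inner \<Rightarrow> real" and G :: "'a \<Rightarrow> 'a"
  assumes taylor: "\<And>x \<xi>. \<bar>f (x + \<xi>) - f x - G x \<bullet> \<xi>\<bar> \<le> C * (norm \<xi>)\<^sup>2"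
  shows "norm (G (x + \<xi>) - G x) \<le> 6 * C * norm \<xi>"
proof (cases "\<xi> = 0 \<or> G (x + \<xi>) = G x")
  case True
  have "0 \<le> C * (norm \<xi>)\<^sup>2" using taylor[of x \<xi>] by linarith
  then have "0 \<le> C * norm \<xi>" by (cases "\<xi> = 0") (auto simp: zero_le_mult_iff)
  with True show ?thesis by auto
next
  case False
  define g where "g = G (x + \<xi>) - G x"
  define \<eta> where "\<eta> = (norm \<xi> / norm g) *\<^sub>R g"
  have n: "norm g > 0" "norm \<xi> > 0" using False by (auto simp: g_def)
  have \<eta>: "norm \<eta> = norm \<xi>" "g \<bullet> \<eta> = norm \<xi> * norm g"
    using n by (simp_all add: \<eta>_def power2_norm_eq_inner[symmetric] power2_eq_square)
  have C: "0 \<le> C" using taylor[of x \<xi>] n by (smt (verit) mult_neg_pos zero_less_power)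
  have "norm (\<xi> + \<eta>) \<le> 2 * norm \<xi>" using norm_triangle_ineq[of \<xi> \<eta>] \<eta> by simp
  then have "(norm (\<xi> + \<eta>))\<^sup>2 \<le> (2 * norm \<xi>)\<^sup>2" by (intro power_mono) auto
  then have "C * (norm (\<xi> + \<eta>))\<^sup>2 \<le> C * (4 * (norm \<xi>)\<^sup>2)" using C by (intro mult_left_mono) (simp_all add: power_mult_distrib)
  moreover have "g \<bullet> \<eta> = G (x + \<xi>) \<bullet> \<eta> + G x \<bullet> \<xi> - G x \<bullet> (\<xi> + \<eta>)"
    by (simp add: g_def inner_diff_left inner_add_right)
  \<comment> \<open>In the combination of the three expansions the values of \<open>f\<close>
    cancel; what is left are remainders of at most 4, 1 and 1 times
    \<open>C * (norm \<xi>)\<^sup>2\<close>.\<close>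
  ultimately have "norm \<xi> * norm g \<le> 6 * C * (norm \<xi>)\<^sup>2"
    using taylor[of x \<xi>] taylor[of "x + \<xi>" \<eta>] taylor[of x "\<xi> + \<eta>"] \<eta> by (simp add: add.assoc)
  then have "norm \<xi> * norm g \<le> norm \<xi> * (6 * C * norm \<xi>)" by (simp add: power2_eq_square algebra_simps)
  then show ?thesis using n unfolding g_def[symmetric] by (simp only: mult_le_cancel_left_pos)
qed

lemma exp_minus_bounds:
  fixes z :: real assumes "0 \<le> z"
  shows "z * exp (- z) \<le> 1" "z\<^sup>2 * exp (- z) \<le> 4"
proof -
  have "z \<le> exp z" using exp_ge_add_one_self[of z] by linarith
  then show "z * exp (- z) \<le> 1" by (simp add: exp_minus field_simps)
  \<comment> \<open>Squaring this bound for the exponential of z / 2 yields z^2 / 4 \<le> exp z,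
    whence the constant 4.\<close>
  have "(1 + z / 2)\<^sup>2 \<le> (exp (z / 2))\<^sup>2" using assms by (intro power_mono exp_ge_add_one_self) auto
  also have "(exp (z / 2))\<^sup>2 = exp z" by (simp add: exp_double[symmetric])
  finally have "z\<^sup>2 \<le> 4 * exp z" using assms by (simp add: power2_eq_square field_simps)
  then show "z\<^sup>2 * exp (- z) \<le> 4" by (simp add: exp_minus field_simps)
qed

text \<open>Taylor expansion of \<open>exp (- Z t)\<close> between t = 0 and t = 1. Its second
  derivative is \<open>exp (- Z t) * ((Y t)\<^sup>2 - X t)\<close> with
  \<open>\<bar>Y t\<bar> \<le> K * Z t\<close> and \<open>X t \<le> K\<^sup>2 * Z t\<close>. Since
  \<open>Z\<^sup>2 * exp (- Z)\<close> is at most 4 and \<open>Z * exp (- Z)\<close> at most 1, it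
  is bounded by \<open>5 * K\<^sup>2\<close> however large the coefficients \<open>z i\<close> are;
  that is the reason for a remainder valid everywhere.\<close>

lemma exp_neg_sum_exp_taylor:
  fixes z k :: "'d::finite \<Rightarrow> real"
  assumes z: "\<And>i. 0 \<le> z i" and k: "\<And>i. \<bar>k i\<bar> \<le> K"
  shows "\<bar>exp (- (\<Sum>i\<in>UNIV. z i * exp (- k i))) - exp (- (\<Sum>i\<in>UNIV. z i)) -
    exp (- (\<Sum>i\<in>UNIV. z i)) * (\<Sum>i\<in>UNIV. k i * z i)\<bar> \<le> 5 / 2 * K\<^sup>2"
proof -
  define Z where "Z t = (\<Sum>i\<in>UNIV. z i * exp (- t * k i))" for t
  define Y where "Y t = (\<Sum>i\<in>UNIV. k i * (z i * exp (- t * k i)))" for t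
  define X where "X t = (\<Sum>i\<in>UNIV. (k i)\<^sup>2 * (z i * exp (- t * k i)))" for t
  have K: "0 \<le> K" using k[of undefined] by linarith
  have Z0: "0 \<le> Z t" for t unfolding Z_def using z by (intro sum_nonneg mult_nonneg_nonneg) auto
  have dZ: "(Z has_real_derivative - Y t) (at t)" for t
    unfolding Z_def[abs_def] Y_def by (auto intro!: derivative_eq_intros sum.cong simp: sum_negf[symmetric])
  have dY: "(Y has_real_derivative - X t) (at t)" for t
    unfolding X_def Y_def[abs_def] by (auto intro!: derivative_eq_intros sum.cong simp: sum_negf[symmetric] power2_eq_square)
  have Yb: "\<bar>Y t\<bar> \<le> K * Z t" for t
  proof -
    have "\<bar>Y t\<bar> \<le> (\<Sum>i\<in>UNIV. \<bar>k i * (z i * exp (- t * k i))\<bar>)" unfolding Y_def by (rule sum_abs)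
    also have "\<dots> \<le> (\<Sum>i\<in>UNIV. K * (z i * exp (- t * k i)))"
      using z k by (intro sum_mono) (auto simp: abs_mult intro!: mult_right_mono)
    finally show ?thesis by (simp add: Z_def sum_distrib_left)
  qed
  have Xb: "0 \<le> X t" "X t \<le> K\<^sup>2 * Z t" for t
  proof -
    show "0 \<le> X t" unfolding X_def using z by (intro sum_nonneg) auto
    have "(k i)\<^sup>2 \<le> K\<^sup>2" for i using power_mono[OF k[of i], of 2] by simp
    then show "X t \<le> K\<^sup>2 * Z t"
      unfolding X_def Z_def sum_distrib_left using z by (intro sum_mono mult_right_mono) auto
  qed
  have "\<bar>exp (- Z 1) - exp (- Z 0) - exp (- Z 0) * Y 0\<bar> \<le> 5 * K\<^sup>2 / 2"
  proof (rule taylor2_bound[where f="\<lambda>t. exp (- Z t)" and f'="\<lambda>t. exp (- Z t) * Y t"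
        and f''="\<lambda>t. exp (- Z t) * ((Y t)\<^sup>2 - X t)"])
    fix t
    show "((\<lambda>t. exp (- Z t)) has_real_derivative exp (- Z t) * Y t) (at t)"
      by (auto intro!: derivative_eq_intros dZ)
    show "((\<lambda>t. exp (- Z t) * Y t) has_real_derivative exp (- Z t) * ((Y t)\<^sup>2 - X t)) (at t)"
      by (auto intro!: derivative_eq_intros dZ dY simp: power2_eq_square algebra_simps)
    have "(Y t)\<^sup>2 \<le> K\<^sup>2 * (Z t)\<^sup>2" using power_mono[OF Yb[of t], of 2] by (simp add: power_mult_distrib)
    then have "\<bar>(Y t)\<^sup>2 - X t\<bar> \<le> K\<^sup>2 * (Z t)\<^sup>2 + K\<^sup>2 * Z t"
      using Xb[of t] zero_le_power2[of "Y t"] by linarith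
    then have "\<bar>exp (- Z t) * ((Y t)\<^sup>2 - X t)\<bar> \<le> exp (- Z t) * (K\<^sup>2 * (Z t)\<^sup>2 + K\<^sup>2 * Z t)"
      by (simp add: abs_mult)
    also have "\<dots> = K\<^sup>2 * ((Z t)\<^sup>2 * exp (- Z t) + Z t * exp (- Z t))" by (simp add: algebra_simps)
    also have "\<dots> \<le> K\<^sup>2 * (4 + 1)" using exp_minus_bounds[OF Z0[of t]] by (intro mult_left_mono add_mono) auto
    finally show "\<bar>exp (- Z t) * ((Y t)\<^sup>2 - X t)\<bar> \<le> 5 * K\<^sup>2" by simp
  qed
  then show ?thesis by (simp add: Z_def Y_def)
qed

lemma exp_functional_nonneg: "0 \<le> exp_functional \<alpha> w $ i"
  by (simp add: exp_functional_def set_lebesgue_integral_def integral_nonneg_AE)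

locale conditioned_brownian_law = drifted_brownian_law P \<mu>
  for P :: "(real \<Rightarrow> real ^ 'n) measure" and \<mu> :: "real ^ 'n" +
  fixes \<alpha> :: "'d::finite \<Rightarrow> real ^ 'n" and \<theta> :: "real ^ 'd"
  assumes functional_finite:
    "AE w in P. \<forall>i. set_integrable lborel {0..} (\<lambda>s. exp (- 2 * (\<alpha> i \<bullet> w s)))"
begin

abbreviation "A w i \<equiv> exp_functional \<alpha> w $ i"

definition "cost i x = (\<theta> $ i)\<^sup>2 * exp (- 2 * (\<alpha> i \<bullet> x))"
text \<open>\<open>V\<close> acts as a killing rate: \<open>exp (- S u w)\<close> below is the
  Feynman-Kac weight collected along the path up to time \<open>u\<close>.\<close>

definition "V x = (\<Sum>i\<in>UNIV. cost i x)"
definition "Z x w = (\<Sum>i\<in>UNIV. cost i x * A w i)"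
definition "\<psi> x w = exp (- Z x w)"
definition "D w = \<psi> 0 w"
definition "j x = (LINT w|P. \<psi> x w)"
text \<open>The gradient of \<open>\<psi>\<close> in \<open>x\<close> for a fixed path:
  differentiating \<open>cost i\<close> brings out \<open>- 2 *\<^sub>R \<alpha> i\<close>, and the
  minus sign in the exponent turns it positive.\<close>

definition "grad\<psi> x w = \<psi> x w *\<^sub>R (\<Sum>i\<in>UNIV. (2 * cost i x * A w i) *\<^sub>R \<alpha> i)"
definition "J x = (LINT w|P. grad\<psi> x w)"
definition "b x = \<mu> + (1 / j x) *\<^sub>R J x"
definition "S u w = (LINT s:{0..u}|lborel. V (w s))"
definition "L = (\<Sum>i\<in>UNIV. norm (\<alpha> i))"

lemma norm_alpha_le: "norm (\<alpha> i) \<le> L" and L_nonneg: "0 \<le> L"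
  unfolding L_def by (auto intro: member_le_sum sum_nonneg)

lemma cost_nonneg: "0 \<le> cost i x" by (simp add: cost_def)
lemma V_nonneg: "0 \<le> V x" unfolding V_def by (intro sum_nonneg cost_nonneg)
lemma Z_nonneg: "0 \<le> Z x w"
  unfolding Z_def by (intro sum_nonneg mult_nonneg_nonneg cost_nonneg exp_functional_nonneg)
lemma \<psi>_pos: "0 < \<psi> x w" and \<psi>_le_1: "\<psi> x w \<le> 1" by (simp_all add: \<psi>_def Z_nonneg)

lemma measurable_A [measurable]: "(\<lambda>w. A w i) \<in> borel_measurable path_space"
  by (rule measurable_compose[OF measurable_exp_functional borel_measurable_nth])

lemma measurable_cost [measurable]: "cost i \<in> borel_measurable borel"
  unfolding cost_def[abs_def] by measurable

lemma continuous_V: "continuous_on UNIV V"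
  unfolding V_def[abs_def] cost_def by (intro continuous_intros)

lemma measurable_\<psi>_pair: "(\<lambda>(x, w). \<psi> x w) \<in> borel_measurable (borel \<Otimes>\<^sub>M path_space)"
  unfolding \<psi>_def Z_def by measurable

lemma measurable_\<psi> [measurable]: "\<psi> x \<in> borel_measurable path_space"
  unfolding \<psi>_def[abs_def] Z_def by measurable

lemma measurable_grad\<psi> [measurable]: "grad\<psi> x \<in> borel_measurable path_space"
  unfolding grad\<psi>_def[abs_def] by measurable

lemma measurable_PI: "f \<in> borel_measurable path_space \<Longrightarrow> f \<in> borel_measurable P"
  by (simp add: measurable_cong_sets[OF sets_P refl])

lemma integrable_\<psi>: "integrable P (\<psi> x)"
  by (rule integrable_const_bound[where B=1])
    (auto intro!: measurable_PI simp: \<psi>_le_1 less_imp_le[OF \<psi>_pos])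

lemma norm_grad\<psi>_le: "norm (grad\<psi> x w) \<le> 2 * L * (Z x w * exp (- Z x w))"
proof -
  have "norm (\<Sum>i\<in>UNIV. (2 * cost i x * A w i) *\<^sub>R \<alpha> i) \<le> (\<Sum>i\<in>UNIV. norm ((2 * cost i x * A w i) *\<^sub>R \<alpha> i))"
    by (rule norm_sum)
  also have "\<dots> \<le> (\<Sum>i\<in>UNIV. (2 * cost i x * A w i) * L)"
    using norm_alpha_le cost_nonneg exp_functional_nonneg[of \<alpha> w]
    by (intro sum_mono) (auto simp: abs_mult intro!: mult_left_mono)
  also have "\<dots> = 2 * L * Z x w" by (simp add: Z_def sum_distrib_left sum_distrib_right algebra_simps)
  finally have "\<psi> x w * norm (\<Sum>i\<in>UNIV. (2 * cost i x * A w i) *\<^sub>R \<alpha> i) \<le> \<psi> x w * (2 * L * Z x w)"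
    using \<psi>_pos[of x w] by (intro mult_left_mono) auto
  then show ?thesis using \<psi>_pos[of x w] by (simp add: grad\<psi>_def \<psi>_def algebra_simps)
qed

lemma norm_grad\<psi>_bound: "norm (grad\<psi> x w) \<le> 2 * L"
proof -
  have "2 * L * (Z x w * exp (- Z x w)) \<le> 2 * L * 1"
    using exp_minus_bounds(1)[OF Z_nonneg] L_nonneg by (intro mult_left_mono) auto
  then show ?thesis using norm_grad\<psi>_le[of x w] by simp
qed

lemma integrable_grad\<psi>: "integrable P (grad\<psi> x)"
  by (rule integrable_const_bound[where B="2 * L"]) (auto intro!: measurable_PI norm_grad\<psi>_bound)

text \<open>A move by \<open>\<xi>\<close> multiplies \<open>cost i\<close> by the exponential of
  \<open>- 2 * (\<alpha> i \<bullet> \<xi>)\<close>, so the expansion applies with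
  \<open>K = 2 * L * norm \<xi>\<close>; the constant 10 is 5/2 times 4.\<close>

lemma \<psi>_taylor: "\<bar>\<psi> (x + \<xi>) w - \<psi> x w - grad\<psi> x w \<bullet> \<xi>\<bar> \<le> 10 * L\<^sup>2 * (norm \<xi>)\<^sup>2"
proof -
  have k: "\<bar>2 * (\<alpha> i \<bullet> \<xi>)\<bar> \<le> 2 * L * norm \<xi>" for i
  proof -
    have "\<bar>\<alpha> i \<bullet> \<xi>\<bar> \<le> norm (\<alpha> i) * norm \<xi>" by (rule Cauchy_Schwarz_ineq2)
    also have "\<dots> \<le> L * norm \<xi>" by (intro mult_right_mono norm_alpha_le) simp
    finally show ?thesis by simp
  qed
  have c: "cost i (x + \<xi>) = cost i x * exp (- (2 * (\<alpha> i \<bullet> \<xi>)))" for i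
    by (simp add: cost_def inner_add_right exp_add[symmetric] algebra_simps)
  have 1: "\<psi> (x + \<xi>) w = exp (- (\<Sum>i\<in>UNIV. (cost i x * A w i) * exp (- (2 * (\<alpha> i \<bullet> \<xi>)))))"
    unfolding \<psi>_def Z_def c by (simp add: algebra_simps)
  have 2: "grad\<psi> x w \<bullet> \<xi> = exp (- (\<Sum>i\<in>UNIV. cost i x * A w i)) * (\<Sum>i\<in>UNIV. 2 * (\<alpha> i \<bullet> \<xi>) * (cost i x * A w i))"
    unfolding grad\<psi>_def \<psi>_def Z_def by (simp add: inner_sum_left algebra_simps)
  have "\<bar>\<psi> (x + \<xi>) w - \<psi> x w - grad\<psi> x w \<bullet> \<xi>\<bar> \<le> 5 / 2 * (2 * L * norm \<xi>)\<^sup>2"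
    unfolding 1 2 unfolding \<psi>_def Z_def
    by (rule exp_neg_sum_exp_taylor) (auto intro: mult_nonneg_nonneg cost_nonneg exp_functional_nonneg k)
  then show ?thesis by (simp add: power_mult_distrib mult_ac)
qed

text \<open>The pathwise remainder is uniform in the path, so integrating it replaces any
  differentiation under the integral sign.\<close>

lemma j_taylor: "\<bar>j (x + \<xi>) - j x - J x \<bullet> \<xi>\<bar> \<le> 10 * L\<^sup>2 * (norm \<xi>)\<^sup>2"
proof -
  have "j (x + \<xi>) - j x - J x \<bullet> \<xi> = (LINT w|P. \<psi> (x + \<xi>) w - \<psi> x w - grad\<psi> x w \<bullet> \<xi>)"
    using integrable_\<psi> integrable_grad\<psi> by (simp add: j_def J_def)
  also have "\<bar>\<dots>\<bar> \<le> (LINT w|P. 10 * L\<^sup>2 * (norm \<xi>)\<^sup>2)"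
    unfolding real_norm_def[symmetric]
    by (rule norm_integral_mono_AE) (use \<psi>_taylor in auto)
  finally show ?thesis by (simp add: prob_space)
qed

lemma J_lipschitz: "norm (J (x + \<xi>) - J x) \<le> 60 * L\<^sup>2 * norm \<xi>"
  using gradient_lipschitz[of j J "10 * L\<^sup>2", OF j_taylor] by simp

lemma norm_J_le: "norm (J x) \<le> 2 * L"
proof -
  have "norm (J x) \<le> (LINT w|P. 2 * L)"
    unfolding J_def by (rule norm_integral_mono_AE) (use norm_grad\<psi>_bound in auto)
  then show ?thesis by (simp add: prob_space)
qed

lemma j_pos: "0 < j x"
proof -
  have "j x \<noteq> 0"
  proof
    assume "j x = 0"
    then have "AE w in P. \<psi> x w = 0"
      using integral_nonneg_eq_0_iff_AE[OF integrable_\<psi>] \<psi>_pos by (auto simp: j_def less_imp_le)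
    then have "AE w in P. False" by eventually_elim (use \<psi>_pos in \<open>auto simp: less_le\<close>)
    then show False by simp
  qed
  moreover have "0 \<le> j x" unfolding j_def by (rule integral_nonneg_AE) (simp add: less_imp_le[OF \<psi>_pos])
  ultimately show ?thesis by simp
qed

lemma j_le_1: "j x \<le> 1"
  using integral_mono[OF integrable_\<psi>, of "\<lambda>_. 1" x] \<psi>_le_1 by (simp add: j_def prob_space)

lemma GDERIV_j: "GDERIV j x :> J x"
proof -
  have "((\<lambda>\<xi>. norm (j (x + \<xi>) - j x - \<xi> \<bullet> J x) / norm \<xi>) \<longlongrightarrow> 0) (at 0)"
  proof (rule tendsto_sandwich[OF _ _ tendsto_const])
    show "((\<lambda>\<xi> :: real ^ 'n. 10 * L\<^sup>2 * norm \<xi>) \<longlongrightarrow> 0) (at 0)"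
      by (intro tendsto_mult_right_zero tendsto_norm_zero tendsto_ident_at)
    show "\<forall>\<^sub>F \<xi> in at 0. norm (j (x + \<xi>) - j x - \<xi> \<bullet> J x) / norm \<xi> \<le> 10 * L\<^sup>2 * norm \<xi>"
    proof (rule eventually_mono[OF eventually_neq_at_within[of 0]])
      fix \<xi> :: "real ^ 'n" assume "\<xi> \<noteq> 0"
      then show "norm (j (x + \<xi>) - j x - \<xi> \<bullet> J x) / norm \<xi> \<le> 10 * L\<^sup>2 * norm \<xi>"
        using j_taylor[of x \<xi>] by (simp add: inner_commute divide_le_eq power2_eq_square mult.assoc)
    qed
  qed (auto intro!: always_eventually)
  then show ?thesis
    by (simp add: gderiv_def has_derivative_at bounded_linear_inner_left)
qed

lemma continuous_j: "continuous_on UNIV j"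
proof (rule continuous_at_imp_continuous_on, rule ballI)
  show "isCont j x" for x using GDERIV_j[of x] unfolding gderiv_def by (rule has_derivative_continuous)
qed

lemma continuous_J: "continuous_on UNIV J"
proof (rule lipschitz_on_continuous_on[where L="60 * L\<^sup>2"], rule lipschitz_onI)
  fix x y
  show "dist (J x) (J y) \<le> 60 * L\<^sup>2 * dist x y"
    using J_lipschitz[of y "x - y"] by (simp add: dist_norm)
qed simp

lemma continuous_b: "continuous_on UNIV b"
  unfolding b_def[abs_def] using j_pos
  by (intro continuous_intros continuous_j continuous_J) (simp add: less_imp_neq[symmetric])

lemma GDERIV_log_j: "GDERIV (\<lambda>x. ln (exp (\<mu> \<bullet> x) * j x)) x :> b x"
proof -
  have "ln (exp (\<mu> \<bullet> x) * j x) = \<mu> \<bullet> x + ln (j x)" for x using j_pos[of x] by (simp add: ln_mult_pos)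
  moreover have "GDERIV (\<lambda>x. \<mu> \<bullet> x + ln (j x)) x :> b x"
  proof -
    have "GDERIV (\<lambda>x. \<mu> \<bullet> x) x :> \<mu>"
      unfolding gderiv_def by (auto intro!: derivative_eq_intros simp: inner_commute)
    moreover have "GDERIV (\<lambda>x. ln (j x)) x :> inverse (j x) *\<^sub>R J x"
      using GDERIV_j[of x] j_pos[of x] by (intro GDERIV_DERIV_compose DERIV_ln)
    ultimately show ?thesis unfolding b_def by (simp add: GDERIV_add inverse_eq_divide)
  qed
  ultimately show ?thesis by simp
qed

text \<open>With \<open>m = - ln (j x)\<close>, integrate \<open>z e\<^sup>-\<^sup>z \<le> m e\<^sup>-\<^sup>z + e\<^sup>-\<^sup>m\<close>.\<close>

lemma norm_J_le_entropy: "norm (J x) \<le> 2 * L * (j x * (1 - ln (j x)))"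
proof -
  define m where "m = - ln (j x)"
  have "norm (grad\<psi> x w) \<le> 2 * L * (m * \<psi> x w + j x)" for w
  proof -
    let ?z = "Z x w"
    have "?z \<le> m + exp (?z - m)" using exp_ge_add_one_self[of "?z - m"] by linarith
    then have "?z * exp (- ?z) \<le> (m + exp (?z - m)) * exp (- ?z)" by (intro mult_right_mono) auto
    also have "\<dots> = m * \<psi> x w + j x"
      using j_pos[of x] by (simp add: \<psi>_def m_def ring_distribs exp_add[symmetric])
    finally have "2 * L * (?z * exp (- ?z)) \<le> 2 * L * (m * \<psi> x w + j x)"
      using L_nonneg by (intro mult_left_mono) auto
    then show ?thesis using norm_grad\<psi>_le[of x w] by simp
  qed
  then have "norm (J x) \<le> (LINT w|P. 2 * L * (m * \<psi> x w + j x))"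
    unfolding J_def using integrable_\<psi> by (intro norm_integral_mono_AE) auto
  also have "\<dots> = 2 * L * (j x * (1 - ln (j x)))"
    using integrable_\<psi> by (simp add: prob_space j_def[symmetric] m_def algebra_simps)
  finally show ?thesis .
qed

text \<open>The sum of the functionals is a real number for each path, so for some \<open>K\<close>
  it stays below \<open>K\<close> with positive probability \<open>p0\<close>. On that event
  \<open>Z x w \<le> K * V x\<close>, hence \<open>j x\<close> is at least
  \<open>p0 * exp (- (K * V x))\<close>.\<close>

lemma j_lower_bound: "\<exists>K C. 0 \<le> K \<and> 0 \<le> C \<and> (\<forall>x. - ln (j x) \<le> K * V x + C)"
proof -
  let ?a = "\<lambda>w. \<Sum>i\<in>UNIV. A w i"
  have am[measurable]: "?a \<in> borel_measurable P" by (rule measurable_PI) measurable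
  have "\<exists>K::nat. measure P {w \<in> space P. ?a w \<le> real K} > 0"
  proof (rule ccontr)
    assume "\<not> ?thesis"
    then have "measure P {w \<in> space P. ?a w \<le> real K} = 0" for K :: nat
      by (simp add: zero_less_measure_iff)
    then have "AE w in P. \<not> ?a w \<le> real K" for K :: nat
      by (subst AE_iff_measurable[OF _ refl]) (auto simp: emeasure_eq_measure)
    then have "AE w in P. \<forall>K::nat. \<not> ?a w \<le> real K" by (simp add: AE_all_countable)
    then have "AE w in P. False" by eventually_elim (use real_arch_simple in blast)
    then show False by simp
  qed
  then obtain K :: nat where K: "measure P {w \<in> space P. ?a w \<le> real K} > 0" by blast
  define p0 where "p0 = measure P {w \<in> space P. ?a w \<le> real K}"
  have p0: "0 < p0" "p0 \<le> 1" using K by (auto simp: p0_def)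
  have "- ln (j x) \<le> real K * V x + (- ln p0)" for x
  proof -
    have ev: "{w \<in> space P. ?a w \<le> real K} \<in> sets P" by measurable
    have "exp (- (real K * V x)) * indicator {w \<in> space P. ?a w \<le> real K} w \<le> \<psi> x w" for w
    proof (cases "?a w \<le> real K")
      case True
      have Ai: "A w i \<le> real K" for i
      proof -
        have "A w i \<le> ?a w" by (rule member_le_sum) (auto intro: exp_functional_nonneg)
        then show ?thesis using True by simp
      qed
      have "Z x w \<le> (\<Sum>i\<in>UNIV. cost i x * real K)"
        unfolding Z_def by (intro sum_mono mult_left_mono Ai cost_nonneg)
      then have "Z x w \<le> real K * V x" by (simp add: V_def sum_distrib_left mult.commute)
      then show ?thesis by (auto simp: \<psi>_def indicator_def)
    qed (simp add: less_imp_le[OF \<psi>_pos])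
    then have "(LINT w|P. exp (- (real K * V x)) * indicator {w \<in> space P. ?a w \<le> real K} w) \<le> j x"
      unfolding j_def using ev integrable_\<psi> by (intro integral_mono) (auto simp: emeasure_eq_measure)
    then have "exp (- (real K * V x)) * p0 \<le> j x" using ev by (simp add: p0_def)
    then have "ln (exp (- (real K * V x)) * p0) \<le> ln (j x)" using p0 j_pos by (subst ln_le_cancel_iff) auto
    then show ?thesis using p0 by (simp add: ln_mult_pos)
  qed
  moreover have "0 \<le> - ln p0" using p0 by simp
  ultimately show ?thesis by (intro exI[of _ "real K"] exI[of _ "- ln p0"]) auto
qed

text \<open>The entropy estimate bounds \<open>norm (J x) / j x\<close> by a multiple of
  \<open>1 - ln (j x)\<close>, and \<open>- ln (j x)\<close> is at most affine in
  \<open>V x\<close>.\<close>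

lemma b_bound: "\<exists>C\<ge>0. \<forall>x. norm (b x) \<le> C * (1 + V x)"
proof -
  obtain K C where K: "0 \<le> K" "0 \<le> C" "\<And>x. - ln (j x) \<le> K * V x + C" using j_lower_bound by blast
  define C' where "C' = norm \<mu> + 2 * L * (1 + C + K)"
  have "norm (b x) \<le> C' * (1 + V x)" for x
  proof -
    have "norm (b x) \<le> norm \<mu> + norm (J x) / j x"
      unfolding b_def using j_pos[of x] norm_triangle_ineq[of \<mu> "(1 / j x) *\<^sub>R J x"] by simp
    also have "norm (J x) / j x \<le> 2 * L * (1 - ln (j x))"
      using norm_J_le_entropy[of x] j_pos[of x]
      by (simp only: pos_divide_le_eq[OF j_pos]) (simp add: algebra_simps)
    also have "\<dots> \<le> 2 * L * (1 + (K * V x + C))"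
      using K(3)[of x] L_nonneg by (intro mult_left_mono) auto
    also have "norm \<mu> + \<dots> \<le> C' * (1 + V x)"
    proof -
      have "0 \<le> norm \<mu> * V x" "0 \<le> L * V x" "0 \<le> L * C * V x" "0 \<le> L * K"
        using K L_nonneg V_nonneg[of x] by (auto intro: mult_nonneg_nonneg)
      then show ?thesis by (simp add: C'_def algebra_simps)
    qed
    finally show ?thesis by simp
  qed
  moreover have "0 \<le> C'" using K L_nonneg by (simp add: C'_def)
  ultimately show ?thesis by blast
qed

end

section \<open>Time integrals along continuous paths\<close>

lemma set_integrable_continuous:
  fixes f :: "real \<Rightarrow> 'b::{banach, second_countable_topology}"
  assumes "continuous_on {0..} f" "0 \<le> r" shows "set_integrable lborel {r..u} f"
  using continuous_on_subset[OF assms(1), of "{r..u}"] assms(2)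
  unfolding set_integrable_def by (intro borel_integrable_compact) auto

lemma set_integral_combine:
  fixes f :: "real \<Rightarrow> 'b::euclidean_space"
  assumes "continuous_on {0..} f" "0 \<le> a" "a \<le> r" "r \<le> u"
  shows "(LINT s:{a..u}|lborel. f s) = (LINT s:{a..r}|lborel. f s) + (LINT s:{r..u}|lborel. f s)"
proof -
  have "f integrable_on {a..u}"
    by (rule integrable_continuous_real) (rule continuous_on_subset[OF assms(1)], use assms in auto)
  then show ?thesis
    using Henstock_Kurzweil_Integration.integral_combine[of a r u f] assms
    by (simp add: set_borel_integral_eq_integral set_integrable_continuous)
qed

context drifted_brownian_law
begin

lemma continuous_along_path:
  "w \<in> space P \<Longrightarrow> continuous_on UNIV f \<Longrightarrow> continuous_on {0..} (\<lambda>s. f (w s))"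
  by (rule continuous_on_compose2[of UNIV f]) (auto intro: continuous_path)

lemma measurable_path_integral:
  fixes f :: "real ^ 'n \<Rightarrow> 'c::{banach, second_countable_topology}"
  assumes "continuous_on UNIV f" "0 \<le> r" "r \<le> u"
  shows "(\<lambda>w. LINT s:{r..u}|lborel. f (w s)) \<in> borel_measurable (\<F> u)"
  by (rule measurable_time_integral)
    (use assms in \<open>auto intro!: measurable_coordinate_filtration continuous_path\<close>)

end

section \<open>Splitting at a fixed time, the conditioned law and its Markov property\<close>

context conditioned_brownian_law
begin

text \<open>In the tail, substitute \<open>u + s\<close> for the time: \<open>w (u + s)\<close> is
  \<open>w u\<close> plus the shifted path at \<open>s\<close>, so the exponential factorises and
  the part depending on \<open>w u\<close> leaves the integral.\<close>

lemma integral_functional_split: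
  assumes w: "w \<in> space P" and u: "0 \<le> u"
    and int: "set_integrable lborel {0..} (\<lambda>s. exp (- 2 * (\<alpha> i \<bullet> w s)))"
  shows "(\<theta> $ i)\<^sup>2 * A w i = (LINT s:{0..u}|lborel. cost i (w s)) + cost i (w u) * A (path_shift u w) i"
proof -
  let ?f = "\<lambda>s. exp (- 2 * (\<alpha> i \<bullet> w s))"
  \<comment> \<open>The first piece is half-open to make the union disjoint; the endpoint
    \<open>u\<close> has measure zero and is added afterwards.\<close>
  have ivl: "{0..} = {0..<u} \<union> {u..}" using u by auto
  have sub: "set_integrable lborel {0..<u} ?f" "set_integrable lborel {0..u} ?f" "set_integrable lborel {u..} ?f"
    by (rule set_integrable_subset[OF int]; use u in auto)+
  have "(LINT s:{0..<u}|lborel. ?f s) = (LINT s:{0..u}|lborel. ?f s)"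
  proof (rule set_integral_cong_set)
    show "AE s in lborel. (s \<in> {0..u}) = (s \<in> {0..<u})"
      using AE_lborel_singleton[of u] by eventually_elim auto
  qed (use sub in \<open>auto simp: set_borel_measurable_def set_integrable_def\<close>)
  then have "(LINT s:{0..}|lborel. ?f s) = (LINT s:{0..u}|lborel. ?f s) + (LINT s:{u..}|lborel. ?f s)"
    unfolding ivl using sub by (subst set_integral_Un) auto
  then have "A w i = (LINT s:{0..u}|lborel. ?f s) + (LINT s:{u..}|lborel. ?f s)"
    by (simp add: exp_functional_def)
  moreover have "(\<theta> $ i)\<^sup>2 * (LINT s:{0..u}|lborel. ?f s) = (LINT s:{0..u}|lborel. cost i (w s))"
    by (simp add: cost_def)
  moreover have "(\<theta> $ i)\<^sup>2 * (LINT s:{u..}|lborel. ?f s) = cost i (w u) * A (path_shift u w) i"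
  proof -
    have "(LINT s:{u..}|lborel. ?f s) = (LINT s|lborel. indicator {u..} (u + s) * ?f (u + s))"
      using lborel_integral_real_affine[of 1 "\<lambda>s. indicator {u..} s * ?f s" u]
      by (simp add: set_lebesgue_integral_def)
    then have "(\<theta> $ i)\<^sup>2 * (LINT s:{u..}|lborel. ?f s) =
        (LINT s|lborel. (\<theta> $ i)\<^sup>2 * (indicator {u..} (u + s) * ?f (u + s)))" by simp
    also have "\<dots> = (LINT s|lborel. cost i (w u) * (indicator {0..} s * exp (- 2 * (\<alpha> i \<bullet> path_shift u w s))))"
      by (intro Bochner_Integration.integral_cong)
        (auto simp: indicator_def path_shift_def cost_def inner_diff_right exp_add[symmetric] algebra_simps)
    finally show ?thesis by (simp add: exp_functional_def set_lebesgue_integral_def)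
  qed
  ultimately show ?thesis by (simp add: distrib_left)
qed

text \<open>The sum over \<open>i\<close> in the exponent turns the additive splitting into a
  product. The exceptional set consists only of paths with a divergent integral and thus serves all
  \<open>u\<close> at once.\<close>

lemma D_split: "AE w in P. \<forall>u\<ge>0. D w = exp (- S u w) * \<psi> (w u) (path_shift u w)"
  using functional_finite AE_space
proof eventually_elim
  fix w assume fin: "\<forall>i. set_integrable lborel {0..} (\<lambda>s. exp (- 2 * (\<alpha> i \<bullet> w s)))" and w: "w \<in> space P"
  show "\<forall>u\<ge>0. D w = exp (- S u w) * \<psi> (w u) (path_shift u w)"
  proof (intro allI impI)
    fix u :: real assume u: "0 \<le> u"
    have "S u w = (\<Sum>i\<in>UNIV. LINT s:{0..u}|lborel. cost i (w s))"
    proof -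
      have "set_integrable lborel {0..u} (\<lambda>s. cost i (w s))" for i
        using w by (intro set_integrable_continuous continuous_along_path)
          (auto simp: cost_def[abs_def] intro!: continuous_intros)
      then have "(LINT s|lborel. (\<Sum>i\<in>UNIV. indicator {0..u} s *\<^sub>R cost i (w s))) =
          (\<Sum>i\<in>UNIV. LINT s|lborel. indicator {0..u} s *\<^sub>R cost i (w s))"
        unfolding set_integrable_def by (rule Bochner_Integration.integral_sum)
      then show ?thesis
        unfolding S_def V_def set_lebesgue_integral_def by (simp only: scaleR_sum_right)
    qed
    moreover have "Z 0 w = (\<Sum>i\<in>UNIV. (\<theta> $ i)\<^sup>2 * A w i)" by (simp add: Z_def cost_def)
    ultimately have "Z 0 w = S u w + Z (w u) (path_shift u w)"
      using integral_functional_split[OF w u] fin by (simp add: Z_def sum.distrib)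
    then show "D w = exp (- S u w) * \<psi> (w u) (path_shift u w)"
      by (simp add: D_def \<psi>_def exp_add[symmetric])
  qed
qed

lemma S_nonneg: "0 \<le> S u w"
  by (simp add: S_def set_lebesgue_integral_def integral_nonneg_AE V_nonneg)

lemma measurable_S: "0 \<le> u \<Longrightarrow> S u \<in> borel_measurable (\<F> u)"
  unfolding S_def[abs_def] by (rule measurable_path_integral[OF continuous_V]) auto

lemma S_combine:
  "w \<in> space P \<Longrightarrow> 0 \<le> r \<Longrightarrow> r \<le> u \<Longrightarrow> S u w = S r w + (LINT s:{r..u}|lborel. V (w s))"
  unfolding S_def by (rule set_integral_combine) (auto intro!: continuous_along_path continuous_V)

lemma measurable_j [measurable]: "j \<in> borel_measurable borel"
  and measurable_J [measurable]: "J \<in> borel_measurable borel"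
  and measurable_b [measurable]: "b \<in> borel_measurable borel"
  and measurable_V [measurable]: "V \<in> borel_measurable borel"
  by (intro borel_measurable_continuous_onI continuous_j continuous_J continuous_b continuous_V)+

lemma measurable_D [measurable]: "D \<in> borel_measurable P"
  unfolding D_def[abs_def] by (rule measurable_PI) simp

lemma D_pos: "0 < D w" and D_le_1: "D w \<le> 1"
  by (simp_all add: D_def \<psi>_pos \<psi>_le_1)

text \<open>The freezing rule under the weight \<open>D\<close>: the past contributes the factor
  \<open>exp (- S u w)\<close>, and the rest of \<open>D\<close> is a function of \<open>w u\<close>
  and of the independent shifted path.\<close>

lemma nn_integral_D_freeze:
  assumes u: "0 \<le> u" and H: "H \<in> borel_measurable (\<F> u)"
    and \<Phi>: "(\<lambda>(x, w). \<Phi> x w) \<in> borel_measurable (borel \<Otimes>\<^sub>M path_space)"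
  shows "(\<integral>\<^sup>+w. H w * \<Phi> (w u) (path_shift u w) * ennreal (D w) \<partial>P) =
    (\<integral>\<^sup>+w. H w * ennreal (exp (- S u w)) * (\<integral>\<^sup>+w'. \<Phi> (w u) w' * ennreal (\<psi> (w u) w') \<partial>P) \<partial>P)"
proof -
  have "(\<integral>\<^sup>+w. H w * \<Phi> (w u) (path_shift u w) * ennreal (D w) \<partial>P) =
    (\<integral>\<^sup>+w. (H w * ennreal (exp (- S u w))) * (\<Phi> (w u) (path_shift u w) * ennreal (\<psi> (w u) (path_shift u w))) \<partial>P)"
  proof (rule nn_integral_cong_AE)
    show "AE w in P. H w * \<Phi> (w u) (path_shift u w) * ennreal (D w) =
        H w * ennreal (exp (- S u w)) * (\<Phi> (w u) (path_shift u w) * ennreal (\<psi> (w u) (path_shift u w)))"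
      using D_split by eventually_elim
        (use u in \<open>simp add: ennreal_mult less_imp_le[OF \<psi>_pos] algebra_simps\<close>)
  qed
  also have "\<dots> = (\<integral>\<^sup>+w. H w * ennreal (exp (- S u w)) * (\<integral>\<^sup>+w'. \<Phi> (w u) w' * ennreal (\<psi> (w u) w') \<partial>P) \<partial>P)"
  proof (rule nn_integral_freeze[OF u])
    show "(\<lambda>w. H w * ennreal (exp (- S u w))) \<in> borel_measurable (\<F> u)"
      using H measurable_S[OF u] by measurable
    show "(\<lambda>(x, w). \<Phi> x w * ennreal (\<psi> x w)) \<in> borel_measurable (borel \<Otimes>\<^sub>M path_space)"
      using \<Phi> measurable_\<psi>_pair by (simp add: case_prod_beta')
  qed
  finally show ?thesis .
qed

lemma nn_integral_\<psi>: "(\<integral>\<^sup>+w. ennreal (\<psi> x w) \<partial>P) = ennreal (j x)"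
  unfolding j_def by (rule nn_integral_eq_integral[OF integrable_\<psi>]) (simp add: less_imp_le[OF \<psi>_pos])

text \<open>Taking \<open>\<Phi>\<close> constant 1 shows that
  \<open>exp (- S u w) * j (w u)\<close> is the conditional expectation of \<open>D\<close> given
  the past of \<open>u\<close>.\<close>

lemma nn_integral_D:
  assumes u: "0 \<le> u" and H: "H \<in> borel_measurable (\<F> u)"
  shows "(\<integral>\<^sup>+w. H w * ennreal (D w) \<partial>P) = (\<integral>\<^sup>+w. H w * ennreal (exp (- S u w) * j (w u)) \<partial>P)"
  using nn_integral_D_freeze[OF u H, of "\<lambda>_ _. 1"]
  by (simp add: nn_integral_\<psi> ennreal_mult less_imp_le[OF j_pos] mult.assoc)

text \<open>The measures with density \<open>D\<close> and with its conditional expectation coincide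
  on the past of \<open>u\<close>, so they give every measurable \<open>Y\<close> the same integral,
  the default value 0 in the non-integrable case included.\<close>

lemma integral_D:
  fixes Y :: "(real \<Rightarrow> real ^ 'n) \<Rightarrow> 'c::{banach, second_countable_topology}"
  assumes u: "0 \<le> u" and Y: "Y \<in> borel_measurable (\<F> u)"
  shows "(LINT w|P. D w *\<^sub>R Y w) = (LINT w|P. (exp (- S u w) * j (w u)) *\<^sub>R Y w)"
proof -
  let ?E = "\<lambda>w. exp (- S u w) * j (w u)"
  have E: "?E \<in> borel_measurable P" and E0: "0 \<le> ?E w" for w
    using measurable_filtrationD[OF measurable_S[OF u]] measurable_coordinate[OF u] j_pos
    by (measurable, simp add: less_imp_le)
  have YP: "Y \<in> borel_measurable P" using Y by (rule measurable_filtrationD)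
  have id: "(\<lambda>w. w) \<in> measurable (density P f) (\<F> u)" for f
    using sets_filtration[of u] by (intro measurableI) (auto dest: sets.sets_into_space)
  have "distr (density P D) (\<F> u) (\<lambda>w. w) = distr (density P ?E) (\<F> u) (\<lambda>w. w)"
  proof (rule measure_eqI)
    fix B assume "B \<in> sets (distr (density P D) (\<F> u) (\<lambda>w. w))"
    then have B: "B \<in> sets (\<F> u)" "B \<in> sets P" using sets_filtration by auto
    have *: "(\<lambda>w. w) -` B \<inter> space P = B" using sets.sets_into_space[OF B(2)] by auto
    show "emeasure (distr (density P D) (\<F> u) (\<lambda>w. w)) B = emeasure (distr (density P ?E) (\<F> u) (\<lambda>w. w)) B"
      using nn_integral_D[OF u, of "indicator B"] B E
      by (simp add: emeasure_distr[OF id B(1)] * emeasure_density mult.commute)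
  qed simp
  then have "(LINT w|distr (density P D) (\<F> u) (\<lambda>w. w). Y w) = (LINT w|distr (density P ?E) (\<F> u) (\<lambda>w. w). Y w)"
    by simp
  then show ?thesis
    using E E0 YP D_pos
    by (simp add: integral_distr[OF id Y] integral_density less_imp_le)
qed

definition "Q = density P (\<lambda>w. ennreal (D w / j 0))"

lemma space_Q [simp]: "space Q = space P" and sets_Q [simp, measurable_cong]: "sets Q = sets P"
  by (simp_all add: Q_def)

lemma nn_integral_Q: "f \<in> borel_measurable P \<Longrightarrow>
    (\<integral>\<^sup>+w. f w \<partial>Q) = (\<integral>\<^sup>+w. f w * ennreal (D w) \<partial>P) * ennreal (1 / j 0)"
proof -
  assume f: "f \<in> borel_measurable P"
  have "(\<integral>\<^sup>+w. f w \<partial>Q) = (\<integral>\<^sup>+w. ennreal (D w / j 0) * f w \<partial>P)"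
    unfolding Q_def using f by (subst nn_integral_density) auto
  also have "\<dots> = (\<integral>\<^sup>+w. (f w * ennreal (D w)) * ennreal (1 / j 0) \<partial>P)"
  proof (intro nn_integral_cong)
    fix w
    have "ennreal (D w / j 0) = ennreal (D w) * ennreal (1 / j 0)"
      using D_pos[of w] j_pos[of 0] by (simp add: ennreal_mult[symmetric])
    then show "ennreal (D w / j 0) * f w = f w * ennreal (D w) * ennreal (1 / j 0)" by (simp add: mult_ac)
  qed
  finally show ?thesis using f by (simp add: nn_integral_multc)
qed

lemma prob_space_Q: "prob_space Q"
proof (rule prob_spaceI)
  have "emeasure Q (space Q) = (\<integral>\<^sup>+w. 1 \<partial>Q)" by simp
  also have "\<dots> = 1"
    unfolding nn_integral_Q[OF borel_measurable_const] D_def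
    using j_pos[of 0] by (simp add: nn_integral_\<psi> ennreal_mult[symmetric])
  finally show "emeasure Q (space Q) = 1" .
qed

lemma filtration_Q: "coordinate_filtration Q = \<F>"
  by (rule natural_filtration_cong) simp

text \<open>Given the past of \<open>s\<close>, the weight \<open>exp (- S s w)\<close> appears both
  in the weighted probability of \<open>C\<close> and in the conditional expectation of
  \<open>D\<close>. It cancels in the quotient, and a function of \<open>w s\<close> alone
  remains.\<close>

theorem markov_Q: "markov_process Q (\<lambda>t w. w t)"
  unfolding markov_process_def
proof (intro conjI allI impI)
  show "prob_space Q" by (rule prob_space_Q)
  show "(\<lambda>w. w t) \<in> borel_measurable Q" if "0 \<le> t" for t
    using measurable_coordinate[OF that] by (simp add: measurable_cong_sets[OF sets_Q refl])
  fix s t :: real and C :: "(real ^ 'n) set" assume st: "0 \<le> s" "s \<le> t" and C[measurable]: "C \<in> sets borel"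
  interpret Q: prob_space Q by (rule prob_space_Q)
  \<comment> \<open>\<open>G x\<close> is the weighted probability of being in \<open>C\<close>
    after time \<open>t - s\<close> when starting from \<open>x\<close>; division by
    \<open>j x\<close> makes it the transition probability of an h-transform.\<close>
  define G where "G x = (\<integral>\<^sup>+w. indicator C (x + w (t - s)) * ennreal (\<psi> x w) \<partial>P)" for x
  define g where "g x = enn2real (G x) / j x" for x
  have c: "(\<lambda>w. w (t - s)) \<in> borel_measurable path_space" using st by (intro measurable_coordinate_path_space) simp
  have \<Phi>: "(\<lambda>(x, w). indicator C (x + w (t - s)) :: ennreal) \<in> borel_measurable (borel \<Otimes>\<^sub>M path_space)"
  proof -
    have "(\<lambda>x :: (real ^ 'n) \<times> (real \<Rightarrow> real ^ 'n). fst x + snd x (t - s)) \<in> borel_measurable (borel \<Otimes>\<^sub>M path_space)"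
      by (rule borel_measurable_add[OF measurable_fst measurable_compose[OF measurable_snd c]])
    from measurable_compose[OF this borel_measurable_indicator[OF C]] show ?thesis
      by (simp add: case_prod_beta')
  qed
  have "(\<lambda>(x, w). indicator C (x + w (t - s)) * ennreal (\<psi> x w)) \<in> borel_measurable (borel \<Otimes>\<^sub>M P)"
    using \<Phi> measurable_\<psi>_pair
    by (simp add: case_prod_beta' measurable_cong_sets[OF sets_pair_measure_cong[OF refl sets_P] refl])
  then have [measurable]: "G \<in> borel_measurable borel"
    unfolding G_def by (rule borel_measurable_nn_integral)
  then have gm[measurable]: "g \<in> borel_measurable borel" unfolding g_def[abs_def] by measurable
  have Gj: "G x \<le> ennreal (j x)" for x
    unfolding G_def nn_integral_\<psi>[symmetric] by (intro nn_integral_mono) (auto simp: indicator_def)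
  then have G_eq: "ennreal (g x) * ennreal (j x) = G x" for x
    using j_pos[of x] by (simp add: g_def ennreal_mult[symmetric])
      (metis ennreal_enn2real ennreal_less_top order_le_less_trans)
  have g01: "0 \<le> g x" "g x \<le> 1" for x
    using enn2real_mono[OF Gj[of x]] j_pos[of x] by (auto simp: g_def less_imp_le)
  have cs: "(\<lambda>w. w s) \<in> borel_measurable (\<F> s)" "(\<lambda>w. w s) \<in> borel_measurable P" "(\<lambda>w. w t) \<in> borel_measurable P"
    using st by (auto intro: measurable_coordinate_filtration measurable_coordinate)
  have key: "(LINT w:B|Q. indicator C (w t)) = (LINT w:B|Q. g (w s))" if B: "B \<in> sets (\<F> s)" for B
  proof -
    have BP: "B \<in> sets P" using B sets_filtration by auto
    have "(\<integral>\<^sup>+w. indicator B w * indicator C (w t) * ennreal (D w) \<partial>P) =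
        (\<integral>\<^sup>+w. indicator B w * indicator C (w s + path_shift s w (t - s)) * ennreal (D w) \<partial>P)"
      using st by (simp add: path_shift_def)
    also have "\<dots> = (\<integral>\<^sup>+w. indicator B w * ennreal (exp (- S s w)) * G (w s) \<partial>P)"
      unfolding G_def by (rule nn_integral_D_freeze[OF st(1) _ \<Phi>]) (use B in simp)
    also have "\<dots> = (\<integral>\<^sup>+w. (indicator B w * ennreal (g (w s))) * ennreal (exp (- S s w) * j (w s)) \<partial>P)"
      using j_pos by (simp add: G_eq[symmetric] ennreal_mult less_imp_le algebra_simps)
    also have "\<dots> = (\<integral>\<^sup>+w. (indicator B w * ennreal (g (w s))) * ennreal (D w) \<partial>P)"
      by (rule nn_integral_D[symmetric, OF st(1)]) (use B cs in measurable)
    finally have *: "(\<integral>\<^sup>+w. indicator B w * indicator C (w t) \<partial>Q) = (\<integral>\<^sup>+w. indicator B w * ennreal (g (w s)) \<partial>Q)"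
      using BP cs by (subst (1 2) nn_integral_Q) auto
    have "(LINT w:B|Q. indicator C (w t)) = enn2real (\<integral>\<^sup>+w. indicator B w * indicator C (w t) \<partial>Q)"
      unfolding set_lebesgue_integral_def using BP cs
      by (subst integral_eq_nn_integral)
        (auto simp: measurable_cong_sets[OF sets_Q refl] ennreal_mult ennreal_indicator intro!: arg_cong[where f=enn2real] nn_integral_cong)
    also have "\<dots> = (LINT w:B|Q. g (w s))"
      unfolding set_lebesgue_integral_def * using BP cs g01
      by (subst integral_eq_nn_integral)
        (auto simp: measurable_cong_sets[OF sets_Q refl] ennreal_mult ennreal_indicator intro!: arg_cong[where f=enn2real] nn_integral_cong)
    finally show ?thesis .
  qed
  \<comment> \<open>The same version \<open>g (w s)\<close> works for every sigma-algebra contained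
    in the past of \<open>s\<close> for which \<open>w s\<close> is measurable; both sides of the
    Markov property are instances.\<close>
  have cond: "AE w in Q. real_cond_exp Q F (\<lambda>w. indicator C (w t)) w = g (w s)"
    if F: "space F = space P" "sets F \<subseteq> sets (\<F> s)" "(\<lambda>w. w s) \<in> borel_measurable F" for F
  proof -
    have "subalgebra Q F" using F sets_filtration[of s] by (auto simp: subalgebra_def)
    then interpret finite_measure_subalgebra Q F by unfold_locales
    show ?thesis
    proof (rule real_cond_exp_charact)
      show "(LINT w:B|Q. indicator C (w t)) = (LINT w:B|Q. g (w s))" if "B \<in> sets F" for B
        using that F key by blast
      have "(\<lambda>w. indicator C (w t) :: real) \<in> borel_measurable Q"
        using measurable_compose[OF cs(3) borel_measurable_indicator[OF C]]
        unfolding measurable_cong_sets[OF sets_Q refl] .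
      then show "integrable Q (\<lambda>w. indicator C (w t) :: real)"
        by (rule Q.integrable_const_bound[where B=1, rotated]) (auto simp: indicator_def)
      show "integrable Q (\<lambda>w. g (w s))"
        using cs g01 by (auto intro!: Q.integrable_const_bound[where B=1] simp: measurable_cong_sets[OF sets_Q refl])
      show "(\<lambda>w. g (w s)) \<in> borel_measurable F" using F(3) by measurable
    qed
  qed
  have "AE w in Q. real_cond_exp Q (\<F> s) (\<lambda>w. indicator C (w t)) w = g (w s)"
    by (rule cond) (use cs in simp_all)
  moreover have "AE w in Q. real_cond_exp Q (vimage_algebra (space Q) (\<lambda>w. w s) borel) (\<lambda>w. indicator C (w t)) w = g (w s)"
  proof (rule cond)
    show "sets (vimage_algebra (space Q) (\<lambda>w. w s) borel) \<subseteq> sets (\<F> s)"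
      unfolding sets_natural_filtration sets_vimage_algebra space_Q
      by (rule sigma_sets_mono') (use st in auto)
    show "(\<lambda>w. w s) \<in> borel_measurable (vimage_algebra (space Q) (\<lambda>w. w s) borel)"
      by (rule measurable_vimage_algebra1) simp
  qed simp
  ultimately show "AE w in Q. real_cond_exp Q (coordinate_filtration Q s) (\<lambda>w. indicator C (w t)) w =
      real_cond_exp Q (vimage_algebra (space Q) (\<lambda>w. w s) borel) (\<lambda>w. indicator C (w t)) w"
    unfolding filtration_Q by eventually_elim simp
qed

end

section \<open>Moment estimates\<close>

lemma nn_integral_le_integral:
  assumes "has_bochner_integral M g c" "AE x in M. f x \<le> g x" "AE x in M. 0 \<le> g x" "c \<le> c'"
  shows "(\<integral>\<^sup>+x. ennreal (f x) \<partial>M) \<le> ennreal c'"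
proof -
  have "(\<integral>\<^sup>+x. ennreal (f x) \<partial>M) \<le> (\<integral>\<^sup>+x. ennreal (g x) \<partial>M)"
    using assms(2) by (intro nn_integral_mono_AE) (auto intro: ennreal_leI)
  also have "\<dots> = ennreal c"
    using assms(1,3) by (simp add: has_bochner_integral_iff nn_integral_eq_integral)
  finally show ?thesis using assms(4) ennreal_leI order_trans by blast
qed

text \<open>Error terms are bounded through nonnegative integrals, which exist without any
  integrability proof; this lemma is their calculus of linear combinations.\<close>

lemma nn_integral_add_le:
  assumes "f \<in> borel_measurable M" "g \<in> borel_measurable M"
    and "(\<integral>\<^sup>+x. ennreal (f x) \<partial>M) \<le> ennreal c" "(\<integral>\<^sup>+x. ennreal (g x) \<partial>M) \<le> ennreal d"
    and "0 \<le> a" "0 \<le> b" "0 \<le> c" "0 \<le> d"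
    and "\<And>x. x \<in> space M \<Longrightarrow> k x \<le> a * f x + b * g x" "\<And>x. 0 \<le> f x" "\<And>x. 0 \<le> g x" "a * c + b * d \<le> e"
  shows "(\<integral>\<^sup>+x. ennreal (k x) \<partial>M) \<le> ennreal e"
proof -
  have "(\<integral>\<^sup>+x. ennreal (k x) \<partial>M) \<le> (\<integral>\<^sup>+x. ennreal a * ennreal (f x) + ennreal b * ennreal (g x) \<partial>M)"
    using assms by (intro nn_integral_mono) (simp add: ennreal_mult[symmetric] ennreal_plus[symmetric] ennreal_leI del: ennreal_plus)
  also have "\<dots> = ennreal a * (\<integral>\<^sup>+x. ennreal (f x) \<partial>M) + ennreal b * (\<integral>\<^sup>+x. ennreal (g x) \<partial>M)"
    using assms(1,2) by (simp add: nn_integral_add nn_integral_cmult)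
  also have "\<dots> \<le> ennreal a * ennreal c + ennreal b * ennreal d"
    using assms by (intro add_mono mult_left_mono) auto
  also have "\<dots> = ennreal (a * c + b * d)"
    using assms by (simp add: ennreal_mult)
  finally show ?thesis using assms(12) ennreal_leI order_trans by blast
qed

lemma norm_vec_pow4_le:
  fixes x :: "real ^ 'n" shows "(norm x) ^ 4 \<le> CARD('n) * (\<Sum>k\<in>UNIV. (x $ k) ^ 4)"
proof -
  have "(norm x) ^ 4 = ((norm x)\<^sup>2)\<^sup>2" by simp
  also have "(norm x)\<^sup>2 = (\<Sum>k\<in>UNIV. (x $ k)\<^sup>2)"
    unfolding power2_norm_eq_inner by (simp add: inner_vec_def power2_eq_square)
  also have "(\<Sum>k\<in>UNIV. (x $ k)\<^sup>2)\<^sup>2 \<le> CARD('n) * (\<Sum>k\<in>UNIV. ((x $ k)\<^sup>2)\<^sup>2)"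
    using Cauchy_Schwarz_ineq_sum[of "\<lambda>_. 1" "\<lambda>k. (x $ k)\<^sup>2" UNIV] by simp
  finally show ?thesis by simp
qed

lemma add_pow_le:
  fixes a b :: real shows "(a + b)\<^sup>2 \<le> 2 * a\<^sup>2 + 2 * b\<^sup>2" "(a + b) ^ 4 \<le> 8 * a ^ 4 + 8 * b ^ 4"
proof -
  show 2: "(a + b)\<^sup>2 \<le> 2 * a\<^sup>2 + 2 * b\<^sup>2" for a b :: real
    using zero_le_power2[of "a - b"] by (simp add: power2_eq_square algebra_simps)
  have "(a + b) ^ 4 = ((a + b)\<^sup>2)\<^sup>2" by simp
  also have "\<dots> \<le> (2 * a\<^sup>2 + 2 * b\<^sup>2)\<^sup>2" using 2 by (intro power_mono) auto
  also have "\<dots> \<le> 2 * (2 * a\<^sup>2)\<^sup>2 + 2 * (2 * b\<^sup>2)\<^sup>2" by (rule 2)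
  finally show "(a + b) ^ 4 \<le> 8 * a ^ 4 + 8 * b ^ 4" by (simp add: power_mult_distrib)
qed

context drifted_brownian_law
begin

lemma has_bochner_integral_increment:
  fixes f :: "real ^ 'n \<Rightarrow> 'c::{banach, second_countable_topology}"
  assumes "0 \<le> r" "r < u" "has_bochner_integral (gauss (u - r)) f v"
  shows "has_bochner_integral P (\<lambda>w. f (w u - w r - (u - r) *\<^sub>R \<mu>)) v"
proof -
  have m: "(\<lambda>w. w u - w r - (u - r) *\<^sub>R \<mu>) \<in> borel_measurable P"
    using assms by (intro borel_measurable_diff measurable_coordinate) auto
  have d: "has_bochner_integral (distr P borel (\<lambda>w. w u - w r - (u - r) *\<^sub>R \<mu>)) f v"
    using assms by (simp add: increment_law)
  then have f: "f \<in> borel_measurable borel"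
    by (auto simp: has_bochner_integral_iff dest!: borel_measurable_integrable)
  show ?thesis
    using d unfolding has_bochner_integral_iff integrable_distr_eq[OF m f] integral_distr[OF m f] .
qed

lemma increment_moments:
  assumes ru: "0 \<le> r" "r < u"
  shows "has_bochner_integral P (\<lambda>w. (w u - w r) $ k) ((u - r) * \<mu> $ k)"
    and "has_bochner_integral P (\<lambda>w. (w u - w r) $ k * (w u - w r) $ l)
      ((if k = l then u - r else 0) + (u - r)\<^sup>2 * \<mu> $ k * \<mu> $ l)"
proof -
  let ?h = "u - r" and ?W = "\<lambda>w. w u - w r - (u - r) *\<^sub>R \<mu>"
  have h: "?h > 0" using ru by simp
  have W1: "has_bochner_integral P (\<lambda>w. ?W w $ k) 0" for k
    by (rule has_bochner_integral_increment[OF ru gauss_moments(1)[OF h]])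
  have W2: "has_bochner_integral P (\<lambda>w. ?W w $ k * ?W w $ l) (if k = l then ?h else 0)"
    by (rule has_bochner_integral_increment[OF ru gauss_moments(2)[OF h]])
  have const: "has_bochner_integral P (\<lambda>_. c) c" for c :: real
    by (simp add: has_bochner_integral_iff prob_space)
  show "has_bochner_integral P (\<lambda>w. (w u - w r) $ k) (?h * \<mu> $ k)"
    using has_bochner_integral_add[OF W1[of k] const[of "?h * \<mu> $ k"]] by simp
  have "(\<lambda>w. (w u - w r) $ k * (w u - w r) $ l) = (\<lambda>w. ?W w $ k * ?W w $ l
      + ((?h * \<mu> $ k) * ?W w $ l + ((?h * \<mu> $ l) * ?W w $ k + (?h * \<mu> $ k) * (?h * \<mu> $ l))))"
    by (simp add: fun_eq_iff algebra_simps)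
  moreover have "has_bochner_integral P (\<lambda>w. ?W w $ k * ?W w $ l
      + ((?h * \<mu> $ k) * ?W w $ l + ((?h * \<mu> $ l) * ?W w $ k + (?h * \<mu> $ k) * (?h * \<mu> $ l))))
      ((if k = l then ?h else 0) + ((?h * \<mu> $ k) * 0 + ((?h * \<mu> $ l) * 0 + (?h * \<mu> $ k) * (?h * \<mu> $ l))))"
    by (intro has_bochner_integral_add W2 has_bochner_integral_mult_right W1 const)
  ultimately show "has_bochner_integral P (\<lambda>w. (w u - w r) $ k * (w u - w r) $ l)
      ((if k = l then ?h else 0) + ?h\<^sup>2 * \<mu> $ k * \<mu> $ l)"
    by (simp add: power2_eq_square algebra_simps)
qed

lemma increment_pow2_bound:
  assumes "0 \<le> T"
  shows "\<exists>C\<ge>0. \<forall>r u. 0 \<le> r \<longrightarrow> r \<le> u \<longrightarrow> u \<le> T \<longrightarrow>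
    (\<integral>\<^sup>+w. ennreal ((norm (w u - w r))\<^sup>2) \<partial>P) \<le> ennreal (C * (u - r))"
proof -
  \<comment> \<open>Each coordinate has variance \<open>u - r\<close>; the drift contributes a term
    of order \<open>(u - r)\<^sup>2\<close>, of which one factor is absorbed by the horizon
    \<open>T\<close>.\<close>
  define C where "C = CARD('n) + T * (norm \<mu>)\<^sup>2"
  have "(\<integral>\<^sup>+w. ennreal ((norm (w u - w r))\<^sup>2) \<partial>P) \<le> ennreal (C * (u - r))"
    if ru: "0 \<le> r" "r \<le> u" "u \<le> T" for r u
  proof (cases "r = u")
    case False
    then have ru': "0 \<le> r" "r < u" using ru by auto
    have eq: "(\<lambda>w. (norm (w u - w r))\<^sup>2) = (\<lambda>w. \<Sum>k\<in>UNIV. (w u - w r) $ k * (w u - w r) $ k)" for w :: "real \<Rightarrow> real ^ 'n"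
      unfolding power2_norm_eq_inner inner_vec_def by simp
    have "has_bochner_integral P (\<lambda>w. \<Sum>k\<in>UNIV. (w u - w r) $ k * (w u - w r) $ k)
        (\<Sum>k\<in>UNIV. (if k = k then u - r else 0) + (u - r)\<^sup>2 * \<mu> $ k * \<mu> $ k)"
      by (intro has_bochner_integral_sum increment_moments(2)[OF ru'])
    also have "(\<Sum>k\<in>UNIV. (if k = k then u - r else 0) + (u - r)\<^sup>2 * \<mu> $ k * \<mu> $ k) =
        CARD('n) * (u - r) + (u - r)\<^sup>2 * (norm \<mu>)\<^sup>2"
      unfolding power2_norm_eq_inner inner_vec_def
      by (simp add: sum.distrib sum_distrib_left mult.assoc)
    finally show ?thesis
    proof (rule nn_integral_le_integral)
      have "(u - r)\<^sup>2 * (norm \<mu>)\<^sup>2 \<le> (T * (u - r)) * (norm \<mu>)\<^sup>2"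
        unfolding power2_eq_square[of "u - r"] using ru by (intro mult_right_mono) auto
      then show "CARD('n) * (u - r) + (u - r)\<^sup>2 * (norm \<mu>)\<^sup>2 \<le> C * (u - r)"
        by (simp add: C_def algebra_simps)
    qed (auto simp: eq[symmetric] power2_norm_eq_inner inner_vec_def intro!: sum_nonneg)
  qed simp
  moreover have "0 \<le> C" using assms by (simp add: C_def)
  ultimately show ?thesis by blast
qed

lemma increment_pow4_bound:
  assumes "0 \<le> T"
  shows "\<exists>C\<ge>0. \<forall>r u. 0 \<le> r \<longrightarrow> r \<le> u \<longrightarrow> u \<le> T \<longrightarrow>
    (\<integral>\<^sup>+w. ennreal ((norm (w u - w r)) ^ 4) \<partial>P) \<le> ennreal (C * (u - r)\<^sup>2)"
proof -
  \<comment> \<open>The factor 8 comes from the fourth power of a sum, one \<open>CARD('n)\<close>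
    from comparing the norm with the coordinates, the other from summing the fourth moments
    \<open>3 * (u - r)\<^sup>2\<close>. The drift term of order four is reduced to order two by
    \<open>T\<^sup>2\<close>.\<close>
  define C where "C = 24 * (real CARD('n))\<^sup>2 + 8 * T\<^sup>2 * (norm \<mu>) ^ 4"
  have "(\<integral>\<^sup>+w. ennreal ((norm (w u - w r)) ^ 4) \<partial>P) \<le> ennreal (C * (u - r)\<^sup>2)"
    if ru: "0 \<le> r" "r \<le> u" "u \<le> T" for r u
  proof (cases "r = u")
    case False
    let ?h = "u - r" and ?W = "\<lambda>w. w u - w r - (u - r) *\<^sub>R \<mu>"
    have ru': "0 \<le> r" "r < u" using ru False by auto
    then have h: "0 < ?h" by simp
    have "has_bochner_integral P (\<lambda>w. (8 * real CARD('n)) * (\<Sum>k\<in>UNIV. (?W w $ k) ^ 4) + 8 * (?h * norm \<mu>) ^ 4)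
        ((8 * real CARD('n)) * (\<Sum>k\<in>(UNIV :: 'n set). 3 * ?h\<^sup>2) + 8 * (?h * norm \<mu>) ^ 4)"
      by (intro has_bochner_integral_add has_bochner_integral_mult_right has_bochner_integral_sum
          has_bochner_integral_increment[OF ru' gauss_moments(3)[OF h]])
        (simp add: has_bochner_integral_iff prob_space)
    then show ?thesis
    proof (rule nn_integral_le_integral)
      have "?h\<^sup>2 * ?h\<^sup>2 \<le> T\<^sup>2 * ?h\<^sup>2" using ru by (intro mult_right_mono power_mono) auto
      then have "?h ^ 4 \<le> T\<^sup>2 * ?h\<^sup>2" by (simp add: power2_eq_square power4_eq_xxxx mult.assoc)
      then have "(8 * (norm \<mu>) ^ 4) * ?h ^ 4 \<le> (8 * (norm \<mu>) ^ 4) * (T\<^sup>2 * ?h\<^sup>2)" by (intro mult_left_mono) auto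
      then show "8 * real CARD('n) * (\<Sum>k\<in>(UNIV :: 'n set). 3 * ?h\<^sup>2) + 8 * (?h * norm \<mu>) ^ 4 \<le> C * ?h\<^sup>2"
      proof -
        have "8 * (?h * norm \<mu>) ^ 4 = (8 * (norm \<mu>) ^ 4) * ?h ^ 4" by (simp only: power_mult_distrib mult_ac)
        moreover have "8 * real CARD('n) * (\<Sum>k\<in>(UNIV :: 'n set). 3 * ?h\<^sup>2) = 24 * (real CARD('n))\<^sup>2 * ?h\<^sup>2"
          by (simp add: power2_eq_square[of "real CARD('n)"])
        moreover have "C * ?h\<^sup>2 = 24 * (real CARD('n))\<^sup>2 * ?h\<^sup>2 + (8 * (norm \<mu>) ^ 4) * (T\<^sup>2 * ?h\<^sup>2)"
          unfolding C_def by (simp only: distrib_right) (simp add: mult_ac)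
        ultimately show ?thesis using \<open>(8 * (norm \<mu>) ^ 4) * ?h ^ 4 \<le> (8 * (norm \<mu>) ^ 4) * (T\<^sup>2 * ?h\<^sup>2)\<close> by linarith
      qed
      have "(norm (w u - w r)) ^ 4 \<le> 8 * real CARD('n) * (\<Sum>k\<in>UNIV. (?W w $ k) ^ 4) + 8 * (?h * norm \<mu>) ^ 4" for w
      proof -
        have "norm (w u - w r) \<le> norm (?W w) + ?h * norm \<mu>"
          using norm_triangle_ineq[of "?W w" "?h *\<^sub>R \<mu>"] h by simp
        then have "(norm (w u - w r)) ^ 4 \<le> (norm (?W w) + ?h * norm \<mu>) ^ 4" by (intro power_mono) auto
        also have "\<dots> \<le> 8 * (norm (?W w)) ^ 4 + 8 * (?h * norm \<mu>) ^ 4" by (rule add_pow_le)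
        finally show ?thesis using norm_vec_pow4_le[of "?W w"] by simp
      qed
      then show "AE w in P. (norm (w u - w r)) ^ 4 \<le> 8 * real CARD('n) * (\<Sum>k\<in>UNIV. (?W w $ k) ^ 4) + 8 * (?h * norm \<mu>) ^ 4"
        by simp
    qed (auto intro!: add_nonneg_nonneg mult_nonneg_nonneg sum_nonneg)
  qed simp
  moreover have "0 \<le> C" using assms by (simp add: C_def)
  ultimately show ?thesis by blast
qed

lemma exp_moment:
  assumes "0 \<le> u"
  shows "has_bochner_integral P (\<lambda>w. exp (v \<bullet> w u)) (exp (u * (v \<bullet> \<mu>) + (norm v)\<^sup>2 * u / 2))"
\<comment> \<open>The Gaussian law is available for positive lags only; at time 0 the moment is read
  off from \<open>start\<close>.\<close>
proof (cases "u = 0")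
  case True
  have "has_bochner_integral P (\<lambda>w. exp (v \<bullet> w u)) 1 \<longleftrightarrow> has_bochner_integral P (\<lambda>w. 1 :: real) 1"
  proof (rule has_bochner_integral_cong_AE)
    show "(\<lambda>w. exp (v \<bullet> w u)) \<in> borel_measurable P" using measurable_coordinate[OF assms] by measurable
    show "AE w in P. exp (v \<bullet> w u) = 1" using start by eventually_elim (simp add: True)
  qed simp
  then show ?thesis using True by (simp add: has_bochner_integral_iff prob_space)
next
  case False
  then have u: "0 < u" using assms by simp
  have 1: "has_bochner_integral P (\<lambda>w. exp (u * (v \<bullet> \<mu>)) * exp (v \<bullet> (w u - w 0 - (u - 0) *\<^sub>R \<mu>)))
      (exp (u * (v \<bullet> \<mu>)) * exp ((norm v)\<^sup>2 * u / 2))"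
    using gauss_moments(4)[of u v] u
    by (intro has_bochner_integral_mult_right has_bochner_integral_increment) auto
  have "has_bochner_integral P (\<lambda>w. exp (v \<bullet> w u)) (exp (u * (v \<bullet> \<mu>)) * exp ((norm v)\<^sup>2 * u / 2)) \<longleftrightarrow>
     has_bochner_integral P (\<lambda>w. exp (u * (v \<bullet> \<mu>)) * exp (v \<bullet> (w u - w 0 - (u - 0) *\<^sub>R \<mu>)))
      (exp (u * (v \<bullet> \<mu>)) * exp ((norm v)\<^sup>2 * u / 2))"
  proof (rule has_bochner_integral_cong_AE)
    show "(\<lambda>w. exp (v \<bullet> w u)) \<in> borel_measurable P" using measurable_coordinate[OF assms] by measurable
    show "(\<lambda>w. exp (u * (v \<bullet> \<mu>)) * exp (v \<bullet> (w u - w 0 - (u - 0) *\<^sub>R \<mu>))) \<in> borel_measurable P"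
      using 1 by (simp add: has_bochner_integral_iff borel_measurable_integrable)
    show "AE w in P. exp (v \<bullet> w u) = exp (u * (v \<bullet> \<mu>)) * exp (v \<bullet> (w u - w 0 - (u - 0) *\<^sub>R \<mu>))"
      using start by eventually_elim (simp add: exp_add[symmetric] inner_diff_right)
  qed
  then show ?thesis using 1 by (simp add: exp_add)
qed

lemma integral_increment_indep:
  fixes U :: "(real \<Rightarrow> real ^ 'n) \<Rightarrow> complex"
  assumes ru: "0 \<le> r" "r \<le> u" and U: "U \<in> borel_measurable (\<F> r)" "integrable P U"
    and f: "f \<in> borel_measurable borel" "integrable P (\<lambda>w. f (w u - w r))"
  shows "integrable P (\<lambda>w. U w * f (w u - w r))"
    and "(CLINT w|P. U w * f (w u - w r)) = (CLINT w|P. U w) * (CLINT w|P. f (w u - w r))"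
proof -
  have \<xi>: "(\<lambda>w. w u - w r) \<in> borel_measurable P" using ru by (intro measurable_increment) auto
  have UP: "U \<in> borel_measurable P" using U(1) by (rule measurable_filtrationD)
  have f\<xi>: "(\<lambda>w. f (w u - w r)) \<in> borel_measurable P" using \<xi> f(1) by measurable
  have "indep_var borel U borel (\<lambda>w. f (w u - w r))"
    unfolding indep_var_eq
  proof (intro conjI UP f\<xi> indep_setI)
    show "sigma_sets (space P) {U -` B \<inter> space P |B. B \<in> sets borel} \<subseteq> sets P"
      using UP by (intro sets.sigma_sets_subset) (auto intro: measurable_sets)
    show "sigma_sets (space P) {(\<lambda>w. f (w u - w r)) -` B \<inter> space P |B. B \<in> sets borel} \<subseteq> sets P"
      using f\<xi> by (intro sets.sigma_sets_subset) (auto intro: measurable_sets)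
    fix a c
    assume a: "a \<in> sigma_sets (space P) {U -` B \<inter> space P |B. B \<in> sets borel}"
      and c: "c \<in> sigma_sets (space P) {(\<lambda>w. f (w u - w r)) -` B \<inter> space P |B. B \<in> sets borel}"
    have "sigma_sets (space (\<F> r)) {U -` B \<inter> space P |B. B \<in> sets borel} \<subseteq> sets (\<F> r)"
      using measurable_sets[OF U(1)] by (intro sets.sigma_sets_subset) auto
    then have a': "a \<in> sets (\<F> r)" using a by auto
    obtain B where B: "B \<in> sets borel" "c = (\<lambda>w. f (w u - w r)) -` B \<inter> space P"
      using c sets_vimage_algebra2[of "\<lambda>w. f (w u - w r)" "space P" borel]
      unfolding sets_vimage_algebra by auto
    have "c = (\<lambda>w. w u - w r) -` (f -` B) \<inter> space P" using B by auto
    moreover have "f -` B \<in> sets borel" using measurable_sets[OF f(1) B(1)] by simp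
    ultimately have "emeasure P (a \<inter> c) = emeasure P a * emeasure P c"
      using increment_indep'[OF ru a'] by simp
    then show "prob (a \<inter> c) = prob a * prob c"
      by (simp add: emeasure_eq_measure ennreal_mult[symmetric])
  qed
  then show "integrable P (\<lambda>w. U w * f (w u - w r))"
    "(CLINT w|P. U w * f (w u - w r)) = (CLINT w|P. U w) * (CLINT w|P. f (w u - w r))"
    using U(2) f(2) by (rule indep_var_integrable, rule indep_var_lebesgue_integral)
qed

lemma nn_integral_path_integral_le:
  assumes ru: "0 \<le> r" "r \<le> u"
    and meas: "\<And>s. r \<le> s \<Longrightarrow> s \<le> u \<Longrightarrow> (\<lambda>w. g w s) \<in> borel_measurable P"
    and cont: "\<And>w. w \<in> space P \<Longrightarrow> continuous_on {0..} (g w)"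
    and nonneg: "\<And>w s. 0 \<le> g w s"
    and le: "\<And>s. r \<le> s \<Longrightarrow> s \<le> u \<Longrightarrow> (\<integral>\<^sup>+w. ennreal (g w s) \<partial>P) \<le> ennreal c" and c: "0 \<le> c"
  shows "(\<integral>\<^sup>+w. ennreal (LINT s:{r..u}|lborel. g w s) \<partial>P) \<le> ennreal (c * (u - r))"
proof -
  \<comment> \<open>Clamping confines the measurability assumption to times in
    \<open>[r, u]\<close>; the indicator later hides the values outside.\<close>
  let ?cl = "\<lambda>s. max r (min u s)"
  have "(\<lambda>(w, s). g w (?cl s)) \<in> borel_measurable (P \<Otimes>\<^sub>M lborel)"
    by (rule borel_measurable_pair_continuous)
      (use meas ru in \<open>auto intro!: continuous_clamp(1) cont\<close>)
  then have gm: "(\<lambda>(w, s). indicator {r..u} s * ennreal (g w (?cl s))) \<in> borel_measurable (P \<Otimes>\<^sub>M lborel)"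
    by (simp add: case_prod_beta')
  interpret pair_sigma_finite P lborel by unfold_locales
  have "(\<integral>\<^sup>+w. ennreal (LINT s:{r..u}|lborel. g w s) \<partial>P) =
      (\<integral>\<^sup>+w. \<integral>\<^sup>+s. indicator {r..u} s * ennreal (g w (?cl s)) \<partial>lborel \<partial>P)"
  proof (rule nn_integral_cong)
    fix w assume w: "w \<in> space P"
    have "ennreal (LINT s:{r..u}|lborel. g w s) = (\<integral>\<^sup>+s. ennreal (indicator {r..u} s *\<^sub>R g w s) \<partial>lborel)"
      unfolding set_lebesgue_integral_def
      using set_integrable_continuous[OF cont[OF w] ru(1), of u] nonneg
      by (intro nn_integral_eq_integral[symmetric]) (auto simp: set_integrable_def)
    also have "\<dots> = (\<integral>\<^sup>+s. indicator {r..u} s * ennreal (g w (?cl s)) \<partial>lborel)"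
      by (intro nn_integral_cong) (auto simp: indicator_def)
    finally show "ennreal (LINT s:{r..u}|lborel. g w s) = \<dots>" .
  qed
  also have "\<dots> = (\<integral>\<^sup>+s. \<integral>\<^sup>+w. indicator {r..u} s * ennreal (g w (?cl s)) \<partial>P \<partial>lborel)"
    using Fubini[of "\<lambda>(w, s). indicator {r..u} s * ennreal (g w (?cl s))"] gm by simp
  also have "\<dots> \<le> (\<integral>\<^sup>+s. ennreal c * indicator {r..u} s \<partial>lborel)"
    using le ru by (intro nn_integral_mono) (auto simp: indicator_def)
  also have "\<dots> = ennreal (c * (u - r))"
    using ru c by (simp add: nn_integral_cmult_indicator ennreal_mult)
  finally show ?thesis .
qed

end

text \<open>The free parameter \<open>e\<close> balances factors of different size: it will be the
  square root of a time step, with \<open>a\<close> of order 1 and \<open>b\<close> of order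
  \<open>e\<close>, or \<open>a\<close> of order \<open>e\<close> and \<open>b\<close> of order
  \<open>e\<^sup>2\<close>.\<close>

lemma two_mult_le_scaled:
  fixes a b e :: real assumes "0 < e" shows "a * b \<le> (e / 2) * a\<^sup>2 + (1 / (2 * e)) * b\<^sup>2"
proof -
  have "0 \<le> (e * a - b)\<^sup>2 / (2 * e)" using assms by simp
  also have "\<dots> = (e / 2) * a\<^sup>2 + (1 / (2 * e)) * b\<^sup>2 - a * b"
    using assms by (simp add: power2_eq_square field_simps)
  finally show ?thesis by simp
qed

text \<open>Cauchy-Schwarz in time, obtained from the nonnegative integral of the squared deviation
  of \<open>f\<close> from its mean \<open>c\<close>.\<close>

lemma set_integral_square_le:
  fixes f :: "real \<Rightarrow> real"
  assumes "continuous_on {0..} f" "0 \<le> r" "r \<le> u"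
  shows "(LINT s:{r..u}|lborel. f s)\<^sup>2 \<le> (u - r) * (LINT s:{r..u}|lborel. (f s)\<^sup>2)"
proof (cases "r = u")
  case True
  have "(LINT s:{r..u}|lborel. f s) = 0"
    unfolding True set_lebesgue_integral_def
    by (rule integral_eq_zero_AE) (use AE_lborel_singleton[of u] in \<open>auto elim: eventually_mono\<close>)
  then show ?thesis using True by simp
next
  case False
  then have h: "0 < u - r" using assms by simp
  define I where "I = (LINT s:{r..u}|lborel. f s)"
  define c where "c = I / (u - r)"
  have int: "set_integrable lborel {r..u} g" if "continuous_on {0..} g" for g :: "real \<Rightarrow> real"
    using that assms(2) by (rule set_integrable_continuous)
  note f = assms(1)
  have "0 \<le> (LINT s:{r..u}|lborel. (f s - c)\<^sup>2)"
    by (simp add: set_lebesgue_integral_def integral_nonneg_AE)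
  also have "(LINT s:{r..u}|lborel. (f s - c)\<^sup>2) = (LINT s:{r..u}|lborel. (f s)\<^sup>2 - (2 * c) * f s + c\<^sup>2)"
    by (simp add: power2_diff algebra_simps)
  also have "\<dots> = (LINT s:{r..u}|lborel. (f s)\<^sup>2) - (2 * c) * I + c\<^sup>2 * (u - r)"
  proof -
    have "(LINT s:{r..u}|lborel. c\<^sup>2) = c\<^sup>2 * (u - r)"
      using assms unfolding set_lebesgue_integral_def by simp
    then show ?thesis
      unfolding I_def
      by (subst set_integral_add set_integral_diff; (intro int continuous_intros f)?)+ simp
  qed
  also have "\<dots> = (LINT s:{r..u}|lborel. (f s)\<^sup>2) - I\<^sup>2 / (u - r)"
  proof -
    have "x - 2 * (I / d) * I + (I / d)\<^sup>2 * d = x - I\<^sup>2 / d" if "0 < d" for x d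
      using that by (simp add: power2_eq_square field_simps)
    then show ?thesis using h by (simp add: c_def)
  qed
  finally show ?thesis using h unfolding I_def[symmetric] by (simp add: field_simps)
qed

context drifted_brownian_law
begin

text \<open>Interpolation between the second and the fourth moment with parameter sqrt h, h = u - r:
  both h times sqrt h and h^2 divided by sqrt h are of order h^(3/2).\<close>

lemma increment_pow3_bound:
  assumes T: "0 \<le> T"
  shows "\<exists>C\<ge>0. \<forall>r u. 0 \<le> r \<longrightarrow> r < u \<longrightarrow> u \<le> T \<longrightarrow>
    (\<integral>\<^sup>+w. ennreal ((norm (w u - w r)) ^ 3) \<partial>P) \<le> ennreal (C * ((u - r) * sqrt (u - r)))"
proof -
  obtain C2 where C2: "0 \<le> C2" "\<And>r u. 0 \<le> r \<Longrightarrow> r \<le> u \<Longrightarrow> u \<le> T \<Longrightarrow>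
      (\<integral>\<^sup>+w. ennreal ((norm (w u - w r))\<^sup>2) \<partial>P) \<le> ennreal (C2 * (u - r))"
    using increment_pow2_bound[OF T] by blast
  obtain C4 where C4: "0 \<le> C4" "\<And>r u. 0 \<le> r \<Longrightarrow> r \<le> u \<Longrightarrow> u \<le> T \<Longrightarrow>
      (\<integral>\<^sup>+w. ennreal ((norm (w u - w r)) ^ 4) \<partial>P) \<le> ennreal (C4 * (u - r)\<^sup>2)"
    using increment_pow4_bound[OF T] by blast
  have "(\<integral>\<^sup>+w. ennreal ((norm (w u - w r)) ^ 3) \<partial>P) \<le> ennreal (((C2 + C4) / 2) * ((u - r) * sqrt (u - r)))"
    if r: "0 \<le> r" "r < u" "u \<le> T" for r u
  proof (rule nn_integral_add_le[where a="sqrt (u - r) / 2" and b="1 / (2 * sqrt (u - r))" and c="C2 * (u - r)" and d="C4 * (u - r)\<^sup>2"])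
    have e: "0 < sqrt (u - r)" using r by simp
    have "x ^ 3 \<le> sqrt (u - r) / 2 * x\<^sup>2 + 1 / (2 * sqrt (u - r)) * x ^ 4" for x :: real
      using two_mult_le_scaled[OF e, of x "x\<^sup>2"] by (simp add: power3_eq_cube power2_eq_square power4_eq_xxxx)
    then show "(norm (w u - w r)) ^ 3 \<le> sqrt (u - r) / 2 * (norm (w u - w r))\<^sup>2 + 1 / (2 * sqrt (u - r)) * (norm (w u - w r)) ^ 4" for w .
    have "1 / (2 * e) * (C4 * (e * e)\<^sup>2) = C4 / 2 * (e * e * e)" if "0 < e" for e
      using that by (simp add: power2_eq_square field_simps)
    from this[OF e] have "1 / (2 * sqrt (u - r)) * (C4 * (u - r)\<^sup>2) = C4 / 2 * ((u - r) * sqrt (u - r))"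
      using r by simp
    then show "sqrt (u - r) / 2 * (C2 * (u - r)) + 1 / (2 * sqrt (u - r)) * (C4 * (u - r)\<^sup>2) \<le> (C2 + C4) / 2 * ((u - r) * sqrt (u - r))"
    proof -
      have "e / 2 * (C2 * d) + C4 / 2 * (d * e) = (C2 + C4) / 2 * (d * e)" for d e
        by (simp add: field_simps)
      then show ?thesis
        using \<open>1 / (2 * sqrt (u - r)) * (C4 * (u - r)\<^sup>2) = C4 / 2 * ((u - r) * sqrt (u - r))\<close>
        by (simp only: order_refl)
    qed
  qed (use r C2 C4 measurable_coordinate in \<open>auto intro!: borel_measurable_power borel_measurable_norm borel_measurable_diff\<close>)
  then show ?thesis using C2 C4 by (intro exI[of _ "(C2 + C4) / 2"]) auto
qed

end

context conditioned_brownian_law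
begin

text \<open>The square of \<open>exp (- 2 * (\<alpha> i \<bullet> x))\<close> is the exponential of
  a linear functional with vector \<open>- 4 *\<^sub>R \<alpha> i\<close>, whose moments are
  explicit. Cauchy-Schwarz over the indices costs the factor \<open>N\<close>, and the absolute
  value in \<open>C\<close> makes the bound monotone in time.\<close>

lemma V_moment:
  assumes T: "0 \<le> T"
  shows "\<exists>C\<ge>0. \<forall>s. 0 \<le> s \<longrightarrow> s \<le> T \<longrightarrow> (\<integral>\<^sup>+w. ennreal ((1 + V (w s))\<^sup>2) \<partial>P) \<le> ennreal C"
proof -
  let ?v = "\<lambda>i. - 4 *\<^sub>R \<alpha> i"
  define N where "N = real CARD('d)"
  define m where "m i s = exp (s * (?v i \<bullet> \<mu>) + (norm (?v i))\<^sup>2 * s / 2)" for i s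
  define C where "C = 2 + 2 * N * (\<Sum>i\<in>UNIV. (\<theta> $ i) ^ 4 * exp (T * \<bar>?v i \<bullet> \<mu>\<bar> + (norm (?v i))\<^sup>2 * T / 2))"
  have "(\<integral>\<^sup>+w. ennreal ((1 + V (w s))\<^sup>2) \<partial>P) \<le> ennreal C" if s: "0 \<le> s" "s \<le> T" for s
  proof (rule nn_integral_le_integral)
    show "has_bochner_integral P (\<lambda>w. 2 + 2 * N * (\<Sum>i\<in>UNIV. (\<theta> $ i) ^ 4 * exp (?v i \<bullet> w s)))
        (2 + 2 * N * (\<Sum>i\<in>UNIV. (\<theta> $ i) ^ 4 * m i s))"
      unfolding m_def using s
      by (intro has_bochner_integral_add has_bochner_integral_mult_right has_bochner_integral_sum exp_moment)
        (simp add: has_bochner_integral_iff prob_space)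
    have "(1 + V x)\<^sup>2 \<le> 2 + 2 * N * (\<Sum>i\<in>UNIV. (\<theta> $ i) ^ 4 * exp (?v i \<bullet> x))" for x
    proof -
      have "(V x)\<^sup>2 \<le> N * (\<Sum>i\<in>UNIV. (cost i x)\<^sup>2)"
        using Cauchy_Schwarz_ineq_sum[of "\<lambda>_. 1" "\<lambda>i. cost i x" UNIV] by (simp add: V_def N_def)
      moreover have "(cost i x)\<^sup>2 = (\<theta> $ i) ^ 4 * exp (?v i \<bullet> x)" for i
      proof -
        have "(exp (- 2 * (\<alpha> i \<bullet> x)))\<^sup>2 = exp (?v i \<bullet> x)" by (simp add: exp_double[symmetric])
        then show ?thesis by (simp add: cost_def power_mult_distrib)
      qed
      ultimately show ?thesis using add_pow_le(1)[of 1 "V x"] by simp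
    qed
    then show "AE w in P. (1 + V (w s))\<^sup>2 \<le> 2 + 2 * N * (\<Sum>i\<in>UNIV. (\<theta> $ i) ^ 4 * exp (?v i \<bullet> w s))" by simp
    show "AE w in P. 0 \<le> 2 + 2 * N * (\<Sum>i\<in>UNIV. (\<theta> $ i) ^ 4 * exp (?v i \<bullet> w s))"
      by (auto intro!: add_nonneg_nonneg mult_nonneg_nonneg sum_nonneg simp: N_def)
    have "m i s \<le> exp (T * \<bar>?v i \<bullet> \<mu>\<bar> + (norm (?v i))\<^sup>2 * T / 2)" for i
    proof -
      have "s * (?v i \<bullet> \<mu>) \<le> s * \<bar>?v i \<bullet> \<mu>\<bar>" using s by (intro mult_left_mono) auto
      also have "\<dots> \<le> T * \<bar>?v i \<bullet> \<mu>\<bar>" using s by (intro mult_right_mono) auto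
      finally have "s * (?v i \<bullet> \<mu>) \<le> T * \<bar>?v i \<bullet> \<mu>\<bar>" .
      moreover have "(norm (?v i))\<^sup>2 * s / 2 \<le> (norm (?v i))\<^sup>2 * T / 2"
        using s by (intro divide_right_mono mult_left_mono) auto
      ultimately show ?thesis by (simp only: m_def exp_le_cancel_iff add_mono)
    qed
    then show "2 + 2 * N * (\<Sum>i\<in>UNIV. (\<theta> $ i) ^ 4 * m i s) \<le> C"
      unfolding C_def by (intro add_left_mono mult_left_mono sum_mono) (auto simp: N_def)
  qed
  moreover have "0 \<le> C"
    unfolding C_def by (intro add_nonneg_nonneg mult_nonneg_nonneg sum_nonneg) (auto simp: N_def)
  ultimately show ?thesis by blast
qed

text \<open>The time \<open>s\<close> may lie inside \<open>[r, u]\<close>, so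
  \<open>V (w s)\<close> and the increment need not be independent; a weighted arithmetic-geometric
  inequality replaces independence. The separate \<open>h\<close> gives one bound for all
  subintervals of a step of that length.\<close>

lemma V_increment_bound:
  assumes T: "0 \<le> T"
  shows "\<exists>C\<ge>0. \<forall>s r u h. 0 \<le> s \<longrightarrow> s \<le> T \<longrightarrow> 0 \<le> r \<longrightarrow> r \<le> u \<longrightarrow> u \<le> T \<longrightarrow> 0 < h \<longrightarrow> u - r \<le> h \<longrightarrow>
    (\<integral>\<^sup>+w. ennreal ((1 + V (w s)) * norm (w u - w r)) \<partial>P) \<le> ennreal (C * sqrt h)"
proof -
  obtain C1 where C1: "0 \<le> C1" "\<And>s. 0 \<le> s \<Longrightarrow> s \<le> T \<Longrightarrow> (\<integral>\<^sup>+w. ennreal ((1 + V (w s))\<^sup>2) \<partial>P) \<le> ennreal C1"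
    using V_moment[OF T] by blast
  obtain C2 where C2: "0 \<le> C2" "\<And>r u. 0 \<le> r \<Longrightarrow> r \<le> u \<Longrightarrow> u \<le> T \<Longrightarrow>
      (\<integral>\<^sup>+w. ennreal ((norm (w u - w r))\<^sup>2) \<partial>P) \<le> ennreal (C2 * (u - r))"
    using increment_pow2_bound[OF T] by blast
  have "(\<integral>\<^sup>+w. ennreal ((1 + V (w s)) * norm (w u - w r)) \<partial>P) \<le> ennreal (((C1 + C2) / 2) * sqrt h)"
    if s: "0 \<le> s" "s \<le> T" and r: "0 \<le> r" "r \<le> u" "u \<le> T" and h: "0 < h" "u - r \<le> h" for s r u h
  proof (rule nn_integral_add_le[where a="sqrt h / 2" and b="1 / (2 * sqrt h)" and c=C1 and d="C2 * h"])
    show "(1 + V (w s)) * norm (w u - w r) \<le> sqrt h / 2 * (1 + V (w s))\<^sup>2 + 1 / (2 * sqrt h) * (norm (w u - w r))\<^sup>2" for w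
      using h by (intro two_mult_le_scaled) simp
    have "C2 * (u - r) \<le> C2 * h" using C2 h by (intro mult_left_mono) auto
    then show "(\<integral>\<^sup>+w. ennreal ((norm (w u - w r))\<^sup>2) \<partial>P) \<le> ennreal (C2 * h)"
      using C2(2)[OF r] ennreal_leI order_trans by blast
    have "1 / (2 * e) * (C2 * (e * e)) = C2 / 2 * e" if "0 < e" for e using that by (simp add: field_simps)
    from this[of "sqrt h"] have "1 / (2 * sqrt h) * (C2 * h) = C2 / 2 * sqrt h" using h by simp
    then show "sqrt h / 2 * C1 + 1 / (2 * sqrt h) * (C2 * h) \<le> (C1 + C2) / 2 * sqrt h"
      by (simp add: field_simps)
  qed (use s r h C1 C2 measurable_coordinate in \<open>auto intro!: borel_measurable_power borel_measurable_add measurable_compose[OF _ measurable_V] borel_measurable_norm borel_measurable_diff\<close>)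
  then show ?thesis using C1 C2 by (intro exI[of _ "(C1 + C2) / 2"]) auto
qed

text \<open>If \<open>L * norm \<xi> \<le> 1\<close>, the gradient term gives 2 and the Taylor
  remainder 10; for longer \<open>\<xi>\<close> the right-hand side exceeds 1, and values of
  \<open>j\<close> in the unit interval differ by at most that.\<close>

lemma j_lipschitz: "\<bar>j (x + \<xi>) - j x\<bar> \<le> 12 * L * norm \<xi>"
proof (cases "norm \<xi> * L \<le> 1")
  case True
  have "\<bar>J x \<bullet> \<xi>\<bar> \<le> 2 * L * norm \<xi>"
    using Cauchy_Schwarz_ineq2[of "J x" \<xi>] mult_right_mono[OF norm_J_le[of x], of "norm \<xi>"] by simp
  moreover have "10 * L\<^sup>2 * (norm \<xi>)\<^sup>2 \<le> 10 * L * norm \<xi>"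
    using mult_right_mono[OF True, of "norm \<xi> * L"] L_nonneg by (simp add: power2_eq_square algebra_simps)
  ultimately show ?thesis using j_taylor[of x \<xi>] by linarith
next
  case False
  have "\<bar>j (x + \<xi>) - j x\<bar> \<le> 1" using j_pos[of x] j_pos[of "x + \<xi>"] j_le_1[of x] j_le_1[of "x + \<xi>"] by linarith
  then show ?thesis using False by (simp add: mult.assoc mult.commute[of "norm \<xi>"])
qed

text \<open>\<open>j (x + \<xi>) (b (x + \<xi>) - b x) = (J (x + \<xi>) - J x) + ((j x - j (x + \<xi>)) / j x) J x\<close>\<close>

lemma b_increment_bound: "\<exists>C\<ge>0. \<forall>x y. j y * norm (b y - b x) \<le> C * ((1 + V x) * norm (y - x))"
proof -
  obtain C where C: "0 \<le> C" "\<And>x. norm (b x) \<le> C * (1 + V x)" using b_bound by blast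
  define C' where "C' = 60 * L\<^sup>2 + 12 * L * (C + norm \<mu>)"
  have "j y * norm (b y - b x) \<le> C' * ((1 + V x) * norm (y - x))" for x y
  proof -
    have "j y *\<^sub>R (b y - b x) = (J y - J x) + ((j x - j y) / j x) *\<^sub>R J x"
      using j_pos[of x] j_pos[of y]
      by (simp add: b_def scaleR_diff_right diff_divide_distrib scaleR_left_diff_distrib)
    then have "norm (j y *\<^sub>R (b y - b x)) \<le> norm (J y - J x) + norm (((j x - j y) / j x) *\<^sub>R J x)"
      by (simp only: norm_triangle_ineq)
    \<comment> \<open>The quotient of \<open>J x\<close> by \<open>j x\<close> is
      \<open>b x - \<mu>\<close>, for which the growth bound is already known; only
      \<open>j y\<close>, not \<open>j x\<close>, has to be supplied as a weight.\<close>
    also have "norm (((j x - j y) / j x) *\<^sub>R J x) = \<bar>j y - j x\<bar> * norm (b x - \<mu>)"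
      using j_pos[of x] by (simp add: b_def abs_minus_commute)
    also have "\<dots> \<le> (12 * L * norm (y - x)) * ((C + norm \<mu>) * (1 + V x))"
    proof (rule mult_mono)
      show "\<bar>j y - j x\<bar> \<le> 12 * L * norm (y - x)" using j_lipschitz[of x "y - x"] by simp
      have "norm (b x - \<mu>) \<le> C * (1 + V x) + norm \<mu> * 1"
        using norm_triangle_ineq4[of "b x" \<mu>] C(2)[of x] by simp
      also have "\<dots> \<le> C * (1 + V x) + norm \<mu> * (1 + V x)"
        using V_nonneg[of x] by (intro add_left_mono mult_left_mono) auto
      finally show "norm (b x - \<mu>) \<le> (C + norm \<mu>) * (1 + V x)" by (simp add: algebra_simps)
    qed (use L_nonneg in auto)
    also have "norm (J y - J x) \<le> 60 * L\<^sup>2 * norm (y - x) * 1" using J_lipschitz[of x "y - x"] by simp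
    also have "\<dots> \<le> 60 * L\<^sup>2 * norm (y - x) * (1 + V x)"
      using V_nonneg[of x] L_nonneg by (intro mult_left_mono) auto
    also have "60 * L\<^sup>2 * norm (y - x) * (1 + V x) + 12 * L * norm (y - x) * ((C + norm \<mu>) * (1 + V x)) =
        C' * ((1 + V x) * norm (y - x))"
      by (simp add: C'_def algebra_simps)
    finally show ?thesis using j_pos[of y] by (simp only: norm_scaleR abs_of_pos)
  qed
  moreover have "0 \<le> C'" using C L_nonneg by (simp add: C'_def)
  ultimately show ?thesis by blast
qed

text \<open>The increment of \<open>b\<close> is known at time \<open>s\<close>, so \<open>D\<close>
  may be replaced by \<open>exp (- S s w) * j (w s)\<close>; the factor \<open>j (w s)\<close> is
  exactly the weight under which increments of \<open>b\<close> are controlled.\<close>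

lemma D_b_increment_bound:
  assumes T: "0 \<le> T"
  shows "\<exists>C\<ge>0. \<forall>s r h. 0 \<le> r \<longrightarrow> r \<le> s \<longrightarrow> s \<le> T \<longrightarrow> 0 < h \<longrightarrow> s - r \<le> h \<longrightarrow>
    (\<integral>\<^sup>+w. ennreal (D w * norm (b (w s) - b (w r))) \<partial>P) \<le> ennreal (C * sqrt h)"
proof -
  obtain C where C: "0 \<le> C" "\<And>x y. j y * norm (b y - b x) \<le> C * ((1 + V x) * norm (y - x))"
    using b_increment_bound by blast
  obtain C1 where C1: "0 \<le> C1" "\<And>s r u h. 0 \<le> s \<Longrightarrow> s \<le> T \<Longrightarrow> 0 \<le> r \<Longrightarrow> r \<le> u \<Longrightarrow> u \<le> T \<Longrightarrow> 0 < h \<Longrightarrow> u - r \<le> h \<Longrightarrow>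
    (\<integral>\<^sup>+w. ennreal ((1 + V (w s)) * norm (w u - w r)) \<partial>P) \<le> ennreal (C1 * sqrt h)"
    using V_increment_bound[OF T] by blast
  have "(\<integral>\<^sup>+w. ennreal (D w * norm (b (w s) - b (w r))) \<partial>P) \<le> ennreal ((C * C1) * sqrt h)"
    if r: "0 \<le> r" "r \<le> s" "s \<le> T" and h: "0 < h" "s - r \<le> h" for s r h
  proof -
    have m: "(\<lambda>w. w s) \<in> borel_measurable (\<F> s)" "(\<lambda>w. w r) \<in> borel_measurable (\<F> s)"
      using r by (auto intro: measurable_coordinate_filtration)
    have mP: "(\<lambda>w. w s) \<in> borel_measurable P" "(\<lambda>w. w r) \<in> borel_measurable P"
      using m measurable_filtrationD by blast+
    have "(\<integral>\<^sup>+w. ennreal (D w * norm (b (w s) - b (w r))) \<partial>P) =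
        (\<integral>\<^sup>+w. ennreal (norm (b (w s) - b (w r))) * ennreal (D w) \<partial>P)"
      using D_pos by (intro nn_integral_cong) (simp add: ennreal_mult[symmetric] less_imp_le mult.commute)
    also have "\<dots> = (\<integral>\<^sup>+w. ennreal (norm (b (w s) - b (w r))) * ennreal (exp (- S s w) * j (w s)) \<partial>P)"
      using r m by (intro nn_integral_D) auto
    also have "\<dots> \<le> (\<integral>\<^sup>+w. ennreal C * ennreal ((1 + V (w r)) * norm (w s - w r)) \<partial>P)"
    proof (rule nn_integral_mono)
      fix w
      have "exp (- S s w) * (j (w s) * norm (b (w s) - b (w r))) \<le> 1 * (C * ((1 + V (w r)) * norm (w s - w r)))"
        by (rule mult_mono) (use C j_pos[of "w s"] S_nonneg[of s w] in \<open>auto simp: less_imp_le\<close>)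
      then show "ennreal (norm (b (w s) - b (w r))) * ennreal (exp (- S s w) * j (w s)) \<le>
          ennreal C * ennreal ((1 + V (w r)) * norm (w s - w r))"
        using C j_pos[of "w s"] V_nonneg[of "w r"]
        by (simp add: ennreal_mult[symmetric] ennreal_leI mult_ac)
    qed
    also have "\<dots> = ennreal C * (\<integral>\<^sup>+w. ennreal ((1 + V (w r)) * norm (w s - w r)) \<partial>P)"
      by (intro nn_integral_cmult measurable_compose[OF _ measurable_ennreal] borel_measurable_times
          borel_measurable_add borel_measurable_const measurable_compose[OF mP(2) measurable_V]
          measurable_compose[OF borel_measurable_diff[OF mP] borel_measurable_norm])
    also have "\<dots> \<le> ennreal C * ennreal (C1 * sqrt h)" using r h by (intro mult_left_mono C1(2)) auto
    finally show ?thesis using C C1 h by (simp add: ennreal_mult[symmetric] mult.assoc)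
  qed
  then show ?thesis using C C1 by (intro exI[of _ "C * C1"]) auto
qed

end

section \<open>Second-order expansion of the characteristic function of an increment\<close>

lemma norm_integral_le_nn_integral:
  fixes f :: "'a \<Rightarrow> 'b::{banach, second_countable_topology}"
  assumes "(\<integral>\<^sup>+x. ennreal (g x) \<partial>M) \<le> ennreal c" "0 \<le> c" "\<And>x. x \<in> space M \<Longrightarrow> norm (f x) \<le> g x"
  shows "norm (LINT x|M. f x) \<le> c"
proof (cases "integrable M f")
  case True
  have "ennreal (norm (LINT x|M. f x)) \<le> (\<integral>\<^sup>+x. norm (f x) \<partial>M)" by (rule integral_norm_bound_ennreal[OF True])
  also have "\<dots> \<le> (\<integral>\<^sup>+x. ennreal (g x) \<partial>M)" using assms(3) by (intro nn_integral_mono ennreal_leI)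
  also have "\<dots> \<le> ennreal c" by (rule assms)
  finally show ?thesis using assms(2) by simp
\<comment> \<open>A non-integrable \<open>f\<close> has integral 0 by convention, and the bound is
  trivial.\<close>
qed (simp add: not_integrable_integral_eq assms)

lemma iexp_bounds:
  fixes x :: real
  shows "cmod (iexp x - 1) \<le> \<bar>x\<bar>"
    and "cmod (iexp x - 1 - \<i> * x) \<le> x\<^sup>2 / 2"
    and "cmod (iexp x - 1 - (\<i> * x - x\<^sup>2 / 2)) \<le> \<bar>x\<bar> ^ 3 / 6"
  using iexp_approx1[of x 0] iexp_approx1[of x 1] iexp_approx1[of x 2]
  by (simp_all add: numeral_2_eq_2 power_mult_distrib diff_diff_eq fact_numeral power3_eq_cube power2_eq_square algebra_simps)

text \<open>Meant for \<open>a\<close> the increment of the path in direction \<open>v\<close>,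
  \<open>y\<close> the corresponding drift integral and \<open>c\<close> its value with the drift
  frozen. The three errors are the second order in \<open>y\<close>, the interaction of
  \<open>y\<close> with \<open>a\<close>, and the freezing.\<close>

lemma iexp_diff_expansion:
  fixes a y c :: real
  shows "cmod (iexp (a - y) - iexp a + \<i> * c) \<le> y\<^sup>2 / 2 + \<bar>y\<bar> * \<bar>a\<bar> + \<bar>y - c\<bar>"
proof -
  have "iexp (a - y) - iexp a + \<i> * c =
      iexp a * (iexp (- y) - 1 - \<i> * (- y)) + (- \<i> * y) * (iexp a - 1) + (- \<i>) * (y - c)"
    by (simp add: exp_add[symmetric] exp_diff exp_minus field_simps)
  also have "cmod \<dots> \<le> cmod (iexp a * (iexp (- y) - 1 - \<i> * (- y))) + cmod ((- \<i> * y) * (iexp a - 1)) + cmod ((- \<i>) * (y - c))"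
    by (intro order_trans[OF norm_triangle_ineq] add_right_mono norm_triangle_ineq)
  also have "cmod (iexp a * (iexp (- y) - 1 - \<i> * (- y))) \<le> y\<^sup>2 / 2"
    using iexp_bounds(2)[of "- y"] by (simp add: norm_mult)
  also have "cmod ((- \<i> * y) * (iexp a - 1)) \<le> \<bar>y\<bar> * \<bar>a\<bar>"
    using iexp_bounds(1)[of a] by (simp add: norm_mult mult_left_mono)
  also have "cmod ((- \<i>) * (y - c)) = \<bar>y - c\<bar>" by (simp add: norm_mult flip: of_real_diff)
  finally show ?thesis by simp
qed

context drifted_brownian_law
begin

text \<open>The third-order remainder of the exponential costs a third absolute moment, hence
  h^(3/2) for h = u - r. The version weighted by a coordinate of the increment is there because
  \<open>j\<close> will be expanded to first order in that increment.\<close>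

lemma increment_char_expansion:
  assumes T: "0 \<le> T"
  shows "\<exists>C\<ge>0. \<forall>r u. 0 \<le> r \<longrightarrow> r < u \<longrightarrow> u \<le> T \<longrightarrow>
    cmod ((CLINT w|P. iexp (v \<bullet> (w u - w r)) - 1) - (\<i> * ((u - r) * (v \<bullet> \<mu>)) - (norm v)\<^sup>2 / 2 * (u - r))) \<le> C * ((u - r) * sqrt (u - r)) \<and>
    (\<forall>k. cmod ((CLINT w|P. complex_of_real ((w u - w r) $ k) * (iexp (v \<bullet> (w u - w r)) - 1)) - \<i> * ((u - r) * v $ k)) \<le> C * ((u - r) * sqrt (u - r)))"
proof -
  obtain C3 where C3: "0 \<le> C3" "\<And>r u. 0 \<le> r \<Longrightarrow> r < u \<Longrightarrow> u \<le> T \<Longrightarrow>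
      (\<integral>\<^sup>+w. ennreal ((norm (w u - w r)) ^ 3) \<partial>P) \<le> ennreal (C3 * ((u - r) * sqrt (u - r)))"
    using increment_pow3_bound[OF T] by blast
  \<comment> \<open>Collects the terms of order h^2 that stem from the drift \<open>\<mu>\<close>;
    h^2 is at most sqrt T times h^(3/2).\<close>
  define q where "q = sqrt T * (\<bar>v \<bullet> \<mu>\<bar> * (\<bar>v \<bullet> \<mu>\<bar> + norm \<mu>))"
  define C where "C = C3 * (norm v ^ 3 + (norm v)\<^sup>2) + q"
  have q0: "0 \<le> q" by (simp add: q_def T)
  have C0: "0 \<le> C" using C3 q0 by (simp add: C_def)
  have "cmod ((CLINT w|P. iexp (v \<bullet> (w u - w r)) - 1) - (\<i> * ((u - r) * (v \<bullet> \<mu>)) - (norm v)\<^sup>2 / 2 * (u - r))) \<le> C * ((u - r) * sqrt (u - r)) \<and>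
    (\<forall>k. cmod ((CLINT w|P. complex_of_real ((w u - w r) $ k) * (iexp (v \<bullet> (w u - w r)) - 1)) - \<i> * ((u - r) * v $ k)) \<le> C * ((u - r) * sqrt (u - r)))"
    if ru: "0 \<le> r" "r < u" "u \<le> T" for r u
  proof -
    define h where "h = u - r"
    define e where "e = h * sqrt h"
    define \<xi> where "\<xi> w = w u - w r" for w :: "real \<Rightarrow> real ^ 'n"
    define a where "a w = v \<bullet> \<xi> w" for w
    have h: "0 < h" "h \<le> T" using ru by (auto simp: h_def)
    have e0: "0 \<le> e" using h by (simp add: e_def)
    have h2: "h\<^sup>2 \<le> sqrt T * e"
    proof -
      have "h\<^sup>2 = sqrt h * e" using h by (simp add: e_def power2_eq_square)
      also have "\<dots> \<le> sqrt T * e" using h e0 by (intro mult_right_mono) auto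
      finally show ?thesis .
    qed
    have meas: "\<xi> \<in> borel_measurable P" unfolding \<xi>_def[abs_def] using ru by (intro measurable_increment) auto
    then have meas'[measurable]: "a \<in> borel_measurable P" "(\<lambda>w. \<xi> w $ k) \<in> borel_measurable P" for k
      unfolding a_def[abs_def] by (auto intro: borel_measurable_inner measurable_compose[OF _ borel_measurable_nth])
    have a_sum: "a w = (\<Sum>k\<in>UNIV. v $ k * \<xi> w $ k)" for w by (simp add: a_def inner_vec_def)
    have m1: "has_bochner_integral P (\<lambda>w. \<xi> w $ k) (h * \<mu> $ k)" for k
      unfolding \<xi>_def h_def by (rule increment_moments(1)[OF ru(1,2)])
    have m2: "has_bochner_integral P (\<lambda>w. \<xi> w $ k * \<xi> w $ l) ((if k = l then h else 0) + h\<^sup>2 * \<mu> $ k * \<mu> $ l)" for k l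
      unfolding \<xi>_def h_def by (rule increment_moments(2)[OF ru(1,2)])
    have E1: "has_bochner_integral P a (h * (v \<bullet> \<mu>))"
    proof -
      have "has_bochner_integral P (\<lambda>w. \<Sum>k\<in>UNIV. v $ k * \<xi> w $ k) (\<Sum>k\<in>UNIV. v $ k * (h * \<mu> $ k))"
        by (intro has_bochner_integral_sum has_bochner_integral_mult_right m1)
      then show ?thesis unfolding a_sum[symmetric] by (simp add: inner_vec_def sum_distrib_left mult.left_commute)
    qed
    have Ek: "has_bochner_integral P (\<lambda>w. \<xi> w $ k * a w) (h * v $ k + h\<^sup>2 * \<mu> $ k * (v \<bullet> \<mu>))" for k
    proof -
      have "has_bochner_integral P (\<lambda>w. \<Sum>l\<in>UNIV. v $ l * (\<xi> w $ k * \<xi> w $ l))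
          (\<Sum>l\<in>UNIV. v $ l * ((if k = l then h else 0) + h\<^sup>2 * \<mu> $ k * \<mu> $ l))"
        by (intro has_bochner_integral_sum has_bochner_integral_mult_right m2)
      also have "(\<lambda>w. \<Sum>l\<in>UNIV. v $ l * (\<xi> w $ k * \<xi> w $ l)) = (\<lambda>w. \<xi> w $ k * a w)"
        by (simp add: a_sum sum_distrib_left mult_ac)
      also have "(\<Sum>l\<in>UNIV. v $ l * ((if k = l then h else 0) + h\<^sup>2 * \<mu> $ k * \<mu> $ l)) = h * v $ k + h\<^sup>2 * \<mu> $ k * (v \<bullet> \<mu>)"
        by (simp add: distrib_left sum.distrib inner_vec_def sum_distrib_left if_distrib[of "\<lambda>x. _ * x"] mult_ac cong: if_cong)
      finally show ?thesis .
    qed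
    have E2: "has_bochner_integral P (\<lambda>w. (a w)\<^sup>2) (h * (norm v)\<^sup>2 + h\<^sup>2 * (v \<bullet> \<mu>)\<^sup>2)"
    proof -
      have "has_bochner_integral P (\<lambda>w. \<Sum>k\<in>UNIV. v $ k * (\<xi> w $ k * a w)) (\<Sum>k\<in>UNIV. v $ k * (h * v $ k + h\<^sup>2 * \<mu> $ k * (v \<bullet> \<mu>)))"
        by (intro has_bochner_integral_sum has_bochner_integral_mult_right Ek)
      also have "(\<lambda>w. \<Sum>k\<in>UNIV. v $ k * (\<xi> w $ k * a w)) = (\<lambda>w. (a w)\<^sup>2)"
      proof
        fix w
        have "(\<Sum>k\<in>UNIV. v $ k * (\<xi> w $ k * a w)) = (\<Sum>k\<in>UNIV. v $ k * \<xi> w $ k) * a w"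
          by (simp add: sum_distrib_right mult.assoc)
        then show "(\<Sum>k\<in>UNIV. v $ k * (\<xi> w $ k * a w)) = (a w)\<^sup>2"
          unfolding a_sum[symmetric] power2_eq_square .
      qed
      also have "(\<Sum>k\<in>UNIV. v $ k * (h * v $ k + h\<^sup>2 * \<mu> $ k * (v \<bullet> \<mu>))) = h * (v \<bullet> v) + h\<^sup>2 * (v \<bullet> \<mu>) * (v \<bullet> \<mu>)"
        by (subst (2 3) inner_vec_def)
          (simp add: distrib_left sum.distrib sum_distrib_left sum_distrib_right mult_ac)
      finally show ?thesis by (simp add: power2_norm_eq_inner power2_eq_square[of "v \<bullet> \<mu>"] mult.assoc)
    qed
    have xi3: "(\<integral>\<^sup>+w. ennreal (c * (norm (\<xi> w)) ^ 3) \<partial>P) \<le> ennreal (c * (C3 * e))" if c: "0 \<le> c" for c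
    proof -
      have "(\<integral>\<^sup>+w. ennreal (c * (norm (\<xi> w)) ^ 3) \<partial>P) = ennreal c * (\<integral>\<^sup>+w. ennreal ((norm (\<xi> w)) ^ 3) \<partial>P)"
        using meas c by (simp add: ennreal_mult nn_integral_cmult)
      also have "\<dots> \<le> ennreal c * ennreal (C3 * e)"
        using C3(2)[OF ru] by (intro mult_left_mono) (simp_all add: \<xi>_def e_def h_def)
      finally show ?thesis using c C3 e0 by (simp add: ennreal_mult)
    qed
    have abs_a: "\<bar>a w\<bar> \<le> norm v * norm (\<xi> w)" for w unfolding a_def by (rule Cauchy_Schwarz_ineq2)
    have iexp_int: "integrable P (\<lambda>w. iexp (a w))"
      by (rule integrable_const_bound[where B=1]) auto
    have r1: "cmod (CLINT w|P. iexp (a w) - 1 - (\<i> * a w - (a w)\<^sup>2 / 2)) \<le> norm v ^ 3 * (C3 * e)"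
    proof (rule norm_integral_le_nn_integral[OF xi3])
      fix w
      have "cmod (iexp (a w) - 1 - (\<i> * a w - (a w)\<^sup>2 / 2)) \<le> \<bar>a w\<bar> ^ 3 / 6" by (rule iexp_bounds)
      also have "\<dots> \<le> \<bar>a w\<bar> ^ 3" by simp
      also have "\<dots> \<le> (norm v * norm (\<xi> w)) ^ 3" by (intro power_mono abs_a) auto
      finally show "cmod (iexp (a w) - 1 - (\<i> * a w - (a w)\<^sup>2 / 2)) \<le> norm v ^ 3 * norm (\<xi> w) ^ 3"
        by (simp add: power_mult_distrib)
    qed (use C3 e0 in auto)
    have i1: "(CLINT w|P. iexp (a w) - 1 - (\<i> * a w - (a w)\<^sup>2 / 2)) =
        (CLINT w|P. iexp (a w) - 1) - (\<i> * (h * (v \<bullet> \<mu>)) - (h * (norm v)\<^sup>2 + h\<^sup>2 * (v \<bullet> \<mu>)\<^sup>2) / 2)"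
    proof -
      have "has_bochner_integral P (\<lambda>w. complex_of_real (a w)) (of_real (h * (v \<bullet> \<mu>)))"
        "has_bochner_integral P (\<lambda>w. complex_of_real ((a w)\<^sup>2)) (of_real (h * (norm v)\<^sup>2 + h\<^sup>2 * (v \<bullet> \<mu>)\<^sup>2))"
        by (intro has_bochner_integral_of_real E1 E2)+
      then have "has_bochner_integral P (\<lambda>w. (iexp (a w) - 1) - (\<i> * complex_of_real (a w) - complex_of_real ((a w)\<^sup>2) / 2))
          ((CLINT w|P. iexp (a w) - 1) - (\<i> * of_real (h * (v \<bullet> \<mu>)) - of_real (h * (norm v)\<^sup>2 + h\<^sup>2 * (v \<bullet> \<mu>)\<^sup>2) / 2))"
        using iexp_int
        by (intro has_bochner_integral_diff has_bochner_integral_mult_right has_bochner_integral_divide_zero has_bochner_integral_integrable) auto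
      then show ?thesis by (simp add: has_bochner_integral_iff)
    qed
    have mu0: "\<bar>v \<bullet> \<mu>\<bar> * \<bar>v \<bullet> \<mu>\<bar> * h\<^sup>2 \<le> q * e" "\<bar>v \<bullet> \<mu>\<bar> * norm \<mu> * h\<^sup>2 \<le> q * e"
    proof -
      have "c * h\<^sup>2 \<le> q * e" if "0 \<le> c" "c \<le> \<bar>v \<bullet> \<mu>\<bar> * (\<bar>v \<bullet> \<mu>\<bar> + norm \<mu>)" for c
      proof -
        have "c * h\<^sup>2 \<le> (\<bar>v \<bullet> \<mu>\<bar> * (\<bar>v \<bullet> \<mu>\<bar> + norm \<mu>)) * (sqrt T * e)"
          using that h2 by (intro mult_mono) auto
        then show ?thesis by (simp add: q_def mult_ac)
      qed
      then show "\<bar>v \<bullet> \<mu>\<bar> * \<bar>v \<bullet> \<mu>\<bar> * h\<^sup>2 \<le> q * e" "\<bar>v \<bullet> \<mu>\<bar> * norm \<mu> * h\<^sup>2 \<le> q * e"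
        by (simp_all add: distrib_left del: abs_mult_self_eq)
    qed
    have Ce: "norm v ^ 3 * (C3 * e) + q * e \<le> C * e" "(norm v)\<^sup>2 * (C3 * e) + q * e \<le> C * e"
      using C3 e0 by (auto simp: C_def algebra_simps)
    have first: "cmod ((CLINT w|P. iexp (a w) - 1) - (\<i> * (h * (v \<bullet> \<mu>)) - (norm v)\<^sup>2 / 2 * h)) \<le> C * e"
    proof -
      have "(CLINT w|P. iexp (a w) - 1) - (\<i> * (h * (v \<bullet> \<mu>)) - (norm v)\<^sup>2 / 2 * h) =
          (CLINT w|P. iexp (a w) - 1 - (\<i> * a w - (a w)\<^sup>2 / 2)) + complex_of_real (- (h\<^sup>2 * (v \<bullet> \<mu>)\<^sup>2 / 2))"
        unfolding i1 by (simp add: field_simps)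
      also have "cmod \<dots> \<le> norm v ^ 3 * (C3 * e) + h\<^sup>2 * (v \<bullet> \<mu>)\<^sup>2 / 2"
        using r1 by (intro order_trans[OF norm_triangle_ineq] add_mono) (simp_all only: norm_of_real, simp)
      also have "h\<^sup>2 * (v \<bullet> \<mu>)\<^sup>2 / 2 \<le> q * e"
      proof -
        have "h\<^sup>2 * (v \<bullet> \<mu>)\<^sup>2 / 2 \<le> h\<^sup>2 * (v \<bullet> \<mu>)\<^sup>2" by simp
        also have "\<dots> = \<bar>v \<bullet> \<mu>\<bar> * \<bar>v \<bullet> \<mu>\<bar> * h\<^sup>2" by (simp add: power2_eq_square)
        finally show ?thesis using mu0(1) by linarith
      qed
      finally show ?thesis using Ce(1) by linarith
    qed
    have second: "cmod ((CLINT w|P. complex_of_real (\<xi> w $ k) * (iexp (a w) - 1)) - \<i> * (h * v $ k)) \<le> C * e" for k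
    proof -
      have r2: "cmod (CLINT w|P. complex_of_real (\<xi> w $ k) * (iexp (a w) - 1 - \<i> * a w)) \<le> (norm v)\<^sup>2 * (C3 * e)"
      proof (rule norm_integral_le_nn_integral[OF xi3])
        fix w
        have "cmod (complex_of_real (\<xi> w $ k) * (iexp (a w) - 1 - \<i> * a w)) \<le> norm (\<xi> w) * ((a w)\<^sup>2 / 2)"
          unfolding norm_mult norm_of_real by (intro mult_mono component_le_norm_cart iexp_bounds) auto
        also have "\<dots> \<le> norm (\<xi> w) * (norm v * norm (\<xi> w))\<^sup>2"
        proof (intro mult_left_mono norm_ge_zero)
          have "(a w)\<^sup>2 \<le> (norm v * norm (\<xi> w))\<^sup>2" using power_mono[OF abs_a[of w], of 2] by simp
          then show "(a w)\<^sup>2 / 2 \<le> (norm v * norm (\<xi> w))\<^sup>2"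
            using zero_le_power2[of "norm v * norm (\<xi> w)"] by linarith
        qed
        finally show "cmod (complex_of_real (\<xi> w $ k) * (iexp (a w) - 1 - \<i> * a w)) \<le> (norm v)\<^sup>2 * norm (\<xi> w) ^ 3"
          by (simp add: power_mult_distrib power3_eq_cube power2_eq_square mult_ac)
      qed (use C3 e0 in auto)
      have ki: "integrable P (\<lambda>w. complex_of_real (\<xi> w $ k) * (iexp (a w) - 1))"
      proof (rule Bochner_Integration.integrable_bound)
        show "integrable P (\<lambda>w. 2 * \<xi> w $ k)" using m1[of k] by (simp add: has_bochner_integral_iff)
        have "cmod (iexp (a w) - 1) \<le> 2" for w using norm_triangle_ineq4[of "iexp (a w)" 1] by simp
        then have "\<bar>\<xi> w $ k\<bar> * cmod (iexp (a w) - 1) \<le> \<bar>\<xi> w $ k\<bar> * 2" for w by (intro mult_left_mono) auto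
        then show "AE w in P. cmod (complex_of_real (\<xi> w $ k) * (iexp (a w) - 1)) \<le> norm (2 * \<xi> w $ k)"
          by (intro AE_I2) (simp add: norm_mult abs_mult mult.commute)
      qed measurable
      have i2: "(CLINT w|P. complex_of_real (\<xi> w $ k) * (iexp (a w) - 1 - \<i> * a w)) =
         (CLINT w|P. complex_of_real (\<xi> w $ k) * (iexp (a w) - 1)) - \<i> * (h * v $ k + h\<^sup>2 * \<mu> $ k * (v \<bullet> \<mu>))"
      proof -
        have "has_bochner_integral P (\<lambda>w. complex_of_real (\<xi> w $ k * a w)) (of_real (h * v $ k + h\<^sup>2 * \<mu> $ k * (v \<bullet> \<mu>)))"
          by (intro has_bochner_integral_of_real Ek)
        then have "has_bochner_integral P (\<lambda>w. complex_of_real (\<xi> w $ k) * (iexp (a w) - 1) - \<i> * complex_of_real (\<xi> w $ k * a w))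
            ((CLINT w|P. complex_of_real (\<xi> w $ k) * (iexp (a w) - 1)) - \<i> * of_real (h * v $ k + h\<^sup>2 * \<mu> $ k * (v \<bullet> \<mu>)))"
          by (intro has_bochner_integral_diff has_bochner_integral_mult_right has_bochner_integral_integrable ki)
        moreover have "(\<lambda>w. complex_of_real (\<xi> w $ k) * (iexp (a w) - 1) - \<i> * complex_of_real (\<xi> w $ k * a w)) =
            (\<lambda>w. complex_of_real (\<xi> w $ k) * (iexp (a w) - 1 - \<i> * a w))"
          by (simp add: fun_eq_iff algebra_simps)
        ultimately show ?thesis by (simp add: has_bochner_integral_iff)
      qed
      have "(CLINT w|P. complex_of_real (\<xi> w $ k) * (iexp (a w) - 1)) - \<i> * (h * v $ k) =
          (CLINT w|P. complex_of_real (\<xi> w $ k) * (iexp (a w) - 1 - \<i> * a w)) + \<i> * complex_of_real (h\<^sup>2 * \<mu> $ k * (v \<bullet> \<mu>))"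
        unfolding i2 by (simp add: algebra_simps)
      also have "cmod \<dots> \<le> (norm v)\<^sup>2 * (C3 * e) + \<bar>h\<^sup>2 * \<mu> $ k * (v \<bullet> \<mu>)\<bar>"
        using r2 by (intro order_trans[OF norm_triangle_ineq] add_mono) (simp_all only: norm_mult norm_of_real norm_ii mult_1)
      also have "\<bar>h\<^sup>2 * \<mu> $ k * (v \<bullet> \<mu>)\<bar> \<le> q * e"
      proof -
        have "\<bar>h\<^sup>2 * \<mu> $ k * (v \<bullet> \<mu>)\<bar> = \<bar>v \<bullet> \<mu>\<bar> * \<bar>\<mu> $ k\<bar> * h\<^sup>2" by (simp add: abs_mult mult_ac)
        also have "\<dots> \<le> \<bar>v \<bullet> \<mu>\<bar> * norm \<mu> * h\<^sup>2"
          by (intro mult_right_mono mult_left_mono component_le_norm_cart) auto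
        finally show ?thesis using mu0(2) by linarith
      qed
      finally show ?thesis using Ce(2) by linarith
    qed
    show ?thesis
      using first second unfolding a_def \<xi>_def e_def h_def by blast
  qed
  then show ?thesis using C0 by blast
qed

end

section \<open>The driving Brownian motion\<close>

context conditioned_brownian_law
begin

definition "\<beta> t w = w t - w 0 - (LINT s:{0..t}|lborel. b (w s))"

text \<open>Pathwise bounds by time integrals whose expectations the moment estimates control.
  \<open>D\<close> stays inside \<open>g3\<close> because increments of \<open>b\<close> are
  controlled only under this weight.\<close>

lemma drift_integral_bounds:
  fixes v :: "real ^ 'n"
  assumes w: "w \<in> space P" and ru: "0 \<le> r" "r < u" and C: "0 \<le> C" "\<And>x. norm (b x) \<le> C * (1 + V x)"
  defines "y \<equiv> LINT s:{r..u}|lborel. v \<bullet> b (w s)" and "\<xi> \<equiv> w u - w r"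
    and "g1 \<equiv> (u - r) * (LINT s:{r..u}|lborel. (1 + V (w s))\<^sup>2)"
    and "g2 \<equiv> (LINT s:{r..u}|lborel. (1 + V (w s)) * norm (w u - w r))"
    and "g3 \<equiv> (LINT s:{r..u}|lborel. D w * norm (b (w s) - b (w r)))"
  shows "y\<^sup>2 \<le> (norm v * C)\<^sup>2 * g1" and "\<bar>y\<bar> * \<bar>v \<bullet> \<xi>\<bar> \<le> ((norm v)\<^sup>2 * C) * g2"
    and "D w * \<bar>y - (u - r) * (v \<bullet> b (w r))\<bar> \<le> norm v * g3"
    and "\<bar>v \<bullet> \<xi>\<bar> * (S u w - S r w) \<le> norm v * g2"
proof -
  note cV = continuous_along_path[OF w continuous_V] and cb = continuous_along_path[OF w continuous_b]
  have int: "set_integrable lborel {r..u} f" if "continuous_on {0..} f" for f :: "real \<Rightarrow> real"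
    using that ru(1) by (rule set_integrable_continuous)
  have cvb: "continuous_on {0..} (\<lambda>s. v \<bullet> b (w s))" by (intro continuous_intros cb)
  \<comment> \<open>Up to constants \<open>I\<close> dominates both the drift integral and the
    growth of \<open>S\<close>, since \<open>norm (b x)\<close> is at most a multiple of
    \<open>1 + V x\<close>.\<close>
  define I where "I = (LINT s:{r..u}|lborel. 1 + V (w s))"
  have "\<bar>y\<bar> \<le> (LINT s:{r..u}|lborel. \<bar>v \<bullet> b (w s)\<bar>)"
    unfolding y_def using set_integral_norm_bound[OF int[OF cvb]] by simp
  also have "\<dots> \<le> (LINT s:{r..u}|lborel. norm v * C * (1 + V (w s)))"
  proof (rule set_integral_mono)
    fix s
    have "\<bar>v \<bullet> b (w s)\<bar> \<le> norm v * norm (b (w s))" by (rule Cauchy_Schwarz_ineq2)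
    also have "\<dots> \<le> norm v * (C * (1 + V (w s)))" by (intro mult_left_mono C) simp
    finally show "\<bar>v \<bullet> b (w s)\<bar> \<le> norm v * C * (1 + V (w s))" by (simp add: mult.assoc)
  qed (intro int continuous_intros cV cb)+
  finally have y: "\<bar>y\<bar> \<le> norm v * C * I" by (simp add: I_def)
  have I0: "0 \<le> I" unfolding I_def set_lebesgue_integral_def
    by (rule integral_nonneg_AE) (auto intro!: AE_I2 mult_nonneg_nonneg add_nonneg_nonneg V_nonneg)
  have "y\<^sup>2 \<le> (norm v * C * I)\<^sup>2" using power_mono[OF y, of 2] by simp
  also have "\<dots> = (norm v * C)\<^sup>2 * I\<^sup>2" by (simp add: power_mult_distrib)
  also have "\<dots> \<le> (norm v * C)\<^sup>2 * g1"
    unfolding g1_def I_def using ru by (intro mult_left_mono set_integral_square_le continuous_intros cV) auto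
  finally show "y\<^sup>2 \<le> (norm v * C)\<^sup>2 * g1" .
  have g2: "g2 = I * norm \<xi>" by (simp add: g2_def I_def \<xi>_def)
  have a: "\<bar>v \<bullet> \<xi>\<bar> \<le> norm v * norm \<xi>" by (rule Cauchy_Schwarz_ineq2)
  have "\<bar>y\<bar> * \<bar>v \<bullet> \<xi>\<bar> \<le> (norm v * C * I) * (norm v * norm \<xi>)"
    using y a C I0 by (intro mult_mono) auto
  then show "\<bar>y\<bar> * \<bar>v \<bullet> \<xi>\<bar> \<le> ((norm v)\<^sup>2 * C) * g2" by (simp add: g2 power2_eq_square mult_ac)
  have "S u w - S r w = (LINT s:{r..u}|lborel. V (w s))" using S_combine[OF w, of r u] ru by simp
  also have "\<dots> \<le> I" unfolding I_def by (rule set_integral_mono) (auto intro!: int continuous_intros cV)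
  finally have "\<bar>v \<bullet> \<xi>\<bar> * (S u w - S r w) \<le> (norm v * norm \<xi>) * I"
    using a I0 by (intro mult_mono') (auto simp: S_combine[OF w, of r u] ru less_imp_le set_lebesgue_integral_def V_nonneg intro!: integral_nonneg_AE)
  then show "\<bar>v \<bullet> \<xi>\<bar> * (S u w - S r w) \<le> norm v * g2" by (simp add: g2 mult_ac)
  have "(LINT s:{r..u}|lborel. v \<bullet> b (w r)) = (u - r) * (v \<bullet> b (w r))"
    using ru unfolding set_lebesgue_integral_def by simp
  then have "y - (u - r) * (v \<bullet> b (w r)) = (LINT s:{r..u}|lborel. v \<bullet> b (w s) - v \<bullet> b (w r))"
    unfolding y_def by (subst set_integral_diff) (auto intro!: int continuous_intros cb)
  then have "\<bar>y - (u - r) * (v \<bullet> b (w r))\<bar> \<le> (LINT s:{r..u}|lborel. \<bar>v \<bullet> b (w s) - v \<bullet> b (w r)\<bar>)"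
    using set_integral_norm_bound[OF int[OF continuous_on_diff[OF cvb continuous_on_const]]] by simp
  also have "\<dots> \<le> (LINT s:{r..u}|lborel. norm v * norm (b (w s) - b (w r)))"
    by (rule set_integral_mono)
      (auto intro!: int continuous_intros cb simp: inner_diff_right[symmetric] Cauchy_Schwarz_ineq2)
  finally have "D w * \<bar>y - (u - r) * (v \<bullet> b (w r))\<bar> \<le> D w * (norm v * (LINT s:{r..u}|lborel. norm (b (w s) - b (w r))))"
    using D_pos[of w] by (intro mult_left_mono) auto
  then show "D w * \<bar>y - (u - r) * (v \<bullet> b (w r))\<bar> \<le> norm v * g3" by (simp add: g3_def mult_ac)
qed

text \<open>The first three terms come from freezing the drift integral, the last two from replacing
  the density by its first-order expansion at time \<open>r\<close>. Each has expectation of order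
  h^(3/2), h = u - r; the square of the drift integral is even of order h^2.\<close>

lemma one_step_error_bound:
  assumes T: "0 \<le> T"
  shows "\<exists>C\<ge>0. \<forall>r u. 0 \<le> r \<longrightarrow> r < u \<longrightarrow> u \<le> T \<longrightarrow>
    (\<integral>\<^sup>+w. ennreal ((LINT s:{r..u}|lborel. v \<bullet> b (w s))\<^sup>2 / 2
      + \<bar>LINT s:{r..u}|lborel. v \<bullet> b (w s)\<bar> * \<bar>v \<bullet> (w u - w r)\<bar>
      + D w * \<bar>(LINT s:{r..u}|lborel. v \<bullet> b (w s)) - (u - r) * (v \<bullet> b (w r))\<bar>
      + \<bar>v \<bullet> (w u - w r)\<bar> * (S u w - S r w)
      + 10 * L\<^sup>2 * (\<bar>v \<bullet> (w u - w r)\<bar> * (norm (w u - w r))\<^sup>2)) \<partial>P) \<le> ennreal (C * ((u - r) * sqrt (u - r)))"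
proof -
  obtain Cb where Cb: "0 \<le> Cb" "\<And>x. norm (b x) \<le> Cb * (1 + V x)" using b_bound by blast
  obtain C1 where C1: "0 \<le> C1" "\<And>s. 0 \<le> s \<Longrightarrow> s \<le> T \<Longrightarrow> (\<integral>\<^sup>+w. ennreal ((1 + V (w s))\<^sup>2) \<partial>P) \<le> ennreal C1"
    using V_moment[OF T] by blast
  obtain C2 where C2: "0 \<le> C2" "\<And>s r u h. 0 \<le> s \<Longrightarrow> s \<le> T \<Longrightarrow> 0 \<le> r \<Longrightarrow> r \<le> u \<Longrightarrow> u \<le> T \<Longrightarrow> 0 < h \<Longrightarrow> u - r \<le> h \<Longrightarrow>
    (\<integral>\<^sup>+w. ennreal ((1 + V (w s)) * norm (w u - w r)) \<partial>P) \<le> ennreal (C2 * sqrt h)"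
    using V_increment_bound[OF T] by blast
  obtain C3 where C3: "0 \<le> C3" "\<And>s r h. 0 \<le> r \<Longrightarrow> r \<le> s \<Longrightarrow> s \<le> T \<Longrightarrow> 0 < h \<Longrightarrow> s - r \<le> h \<Longrightarrow>
    (\<integral>\<^sup>+w. ennreal (D w * norm (b (w s) - b (w r))) \<partial>P) \<le> ennreal (C3 * sqrt h)"
    using D_b_increment_bound[OF T] by blast
  obtain C4 where C4: "0 \<le> C4" "\<And>r u. 0 \<le> r \<Longrightarrow> r < u \<Longrightarrow> u \<le> T \<Longrightarrow>
      (\<integral>\<^sup>+w. ennreal ((norm (w u - w r)) ^ 3) \<partial>P) \<le> ennreal (C4 * ((u - r) * sqrt (u - r)))"
    using increment_pow3_bound[OF T] by blast
  define k1 k2 k4 where "k1 = (norm v * Cb)\<^sup>2 / 2" and "k2 = (norm v)\<^sup>2 * Cb + norm v" and "k4 = 10 * L\<^sup>2 * norm v"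
  have k: "0 \<le> k1" "0 \<le> k2" "0 \<le> k4" using Cb by (auto simp: k1_def k2_def k4_def)
  define C where "C = (k1 * (C1 * sqrt T) + k2 * C2) + (norm v * C3 + k4 * C4)"
  show ?thesis
  proof (intro exI[of _ C] conjI allI impI)
    show "0 \<le> C" using k C1 C2 C3 C4 T by (simp add: C_def)
    fix r u assume ru: "0 \<le> r" "r < u" "u \<le> T"
    define h where "h = u - r"
    define e where "e = h * sqrt h"
    have h: "0 < h" "h \<le> T" using ru by (auto simp: h_def)
    have e0: "0 \<le> e" using h by (simp add: e_def)
    have h2: "h * h \<le> sqrt T * e"
    proof -
      have "h * h = sqrt h * e" using h by (simp add: e_def)
      also have "\<dots> \<le> sqrt T * e" using h e0 by (intro mult_right_mono) auto
      finally show ?thesis .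
    qed
    note cV = continuous_along_path[OF _ continuous_V] and cb = continuous_along_path[OF _ continuous_b]
    define g1 where "g1 w = h * (LINT s:{r..u}|lborel. (1 + V (w s))\<^sup>2)" for w
    define g2 where "g2 w = (LINT s:{r..u}|lborel. (1 + V (w s)) * norm (w u - w r))" for w :: "real \<Rightarrow> real ^ 'n"
    define g3 where "g3 w = (LINT s:{r..u}|lborel. D w * norm (b (w s) - b (w r)))" for w
    define g4 where "g4 w = (norm (w u - w r)) ^ 3" for w :: "real \<Rightarrow> real ^ 'n"
    have mu: "(\<lambda>w. w t) \<in> borel_measurable P" if "0 \<le> t" for t using that by (rule measurable_coordinate)
    have m\<xi>: "(\<lambda>w. norm (w u - w r)) \<in> borel_measurable P"
      using ru by (intro measurable_compose[OF measurable_increment borel_measurable_norm]) auto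
    have mV: "(\<lambda>w. V (w t)) \<in> borel_measurable P" "(\<lambda>w. b (w t)) \<in> borel_measurable P" if "0 \<le> t" for t
      using mu[OF that] by measurable
    have nonneg: "0 \<le> g1 w" "0 \<le> g2 w" "0 \<le> g3 w" "0 \<le> g4 w" for w
      using h V_nonneg D_pos[of w]
      by (auto simp: g1_def g2_def g3_def g4_def set_lebesgue_integral_def less_imp_le intro!: integral_nonneg_AE mult_nonneg_nonneg)
    have m1: "g1 \<in> borel_measurable P"
      unfolding g1_def[abs_def] using ru
      by (intro borel_measurable_times borel_measurable_const measurable_filtrationD[OF measurable_path_integral[of "\<lambda>x. (1 + V x)\<^sup>2" r u]]
          continuous_intros continuous_V) auto
    have m2: "g2 \<in> borel_measurable P"
    proof -
      have "(\<lambda>w. LINT s:{r..u}|lborel. 1 + V (w s)) \<in> borel_measurable P"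
        using ru by (intro measurable_filtrationD[OF measurable_path_integral[of "\<lambda>x. 1 + V x" r u]] continuous_intros continuous_V) auto
      then have "(\<lambda>w. (LINT s:{r..u}|lborel. 1 + V (w s)) * norm (w u - w r)) \<in> borel_measurable P"
        using m\<xi> by (rule borel_measurable_times)
      then show ?thesis unfolding g2_def[abs_def] by simp
    qed
    have m3: "g3 \<in> borel_measurable P"
    proof -
      \<comment> \<open>The path is paired with its fixed value at time \<open>r\<close>, which
        makes the integrand a continuous function of a single process.\<close>
      have "(\<lambda>w. LINT s:{r..u}|lborel. (\<lambda>(x, y). norm (b x - b y)) (w s, w r)) \<in> borel_measurable P"
        using ru mu unfolding case_prod_beta'
        by (intro measurable_time_integral[where f="\<lambda>p. norm (b (fst p) - b (snd p))" and X="\<lambda>s w. (w s, w r)"] borel_measurable_Pair)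
          (auto intro!: continuous_intros continuous_path continuous_on_compose2[OF continuous_b])
      then have "(\<lambda>w. D w * (LINT s:{r..u}|lborel. norm (b (w s) - b (w r)))) \<in> borel_measurable P"
        by simp
      then show ?thesis unfolding g3_def[abs_def] by simp
    qed
    have m4: "g4 \<in> borel_measurable P" unfolding g4_def[abs_def] using m\<xi> by (intro borel_measurable_power)
    have b1: "(\<integral>\<^sup>+w. ennreal (g1 w) \<partial>P) \<le> ennreal (C1 * sqrt T * e)"
    proof -
      have "(\<lambda>w. LINT s:{r..u}|lborel. (1 + V (w s))\<^sup>2) \<in> borel_measurable P"
        using ru by (intro measurable_filtrationD[OF measurable_path_integral[of "\<lambda>x. (1 + V x)\<^sup>2" r u]]
          continuous_intros continuous_V) auto
      then have "(\<integral>\<^sup>+w. ennreal (g1 w) \<partial>P) = ennreal h * (\<integral>\<^sup>+w. ennreal (LINT s:{r..u}|lborel. (1 + V (w s))\<^sup>2) \<partial>P)"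
        unfolding g1_def using h by (subst nn_integral_cmult[symmetric])
          (auto simp: ennreal_mult set_lebesgue_integral_def intro!: nn_integral_cong integral_nonneg_AE)
      also have "\<dots> \<le> ennreal h * ennreal (C1 * (u - r))"
        using ru C1 mV by (intro mult_left_mono nn_integral_path_integral_le) (auto intro!: continuous_intros cV)
      also have "\<dots> = ennreal (C1 * (h * h))" using h C1 by (simp add: h_def ennreal_mult[symmetric] mult_ac)
      also have "\<dots> \<le> ennreal (C1 * sqrt T * e)"
        using mult_left_mono[OF h2 C1(1)] by (intro ennreal_leI) (simp add: mult.assoc)
      finally show ?thesis .
    qed
    have b2: "(\<integral>\<^sup>+w. ennreal (g2 w) \<partial>P) \<le> ennreal (C2 * e)"
    proof -
      have "(\<integral>\<^sup>+w. ennreal (g2 w) \<partial>P) \<le> ennreal (C2 * sqrt h * (u - r))"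
        unfolding g2_def using ru C2 mV h V_nonneg m\<xi>
        by (intro nn_integral_path_integral_le) (auto intro!: continuous_intros cV simp: h_def)
      then show ?thesis by (simp add: e_def h_def mult_ac)
    qed
    have b3: "(\<integral>\<^sup>+w. ennreal (g3 w) \<partial>P) \<le> ennreal (C3 * e)"
    proof -
      have "(\<integral>\<^sup>+w. ennreal (g3 w) \<partial>P) \<le> ennreal (C3 * sqrt h * (u - r))"
        unfolding g3_def using ru C3 mV h D_pos
        by (intro nn_integral_path_integral_le) (auto intro!: continuous_intros cb mult_nonneg_nonneg simp: h_def less_imp_le)
      then show ?thesis by (simp add: e_def h_def mult_ac)
    qed
    have b4: "(\<integral>\<^sup>+w. ennreal (g4 w) \<partial>P) \<le> ennreal (C4 * e)"
      unfolding g4_def e_def h_def by (rule C4(2)[OF ru])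
    have b12: "(\<integral>\<^sup>+w. ennreal (k1 * g1 w + k2 * g2 w) \<partial>P) \<le> ennreal (k1 * (C1 * sqrt T * e) + k2 * (C2 * e))"
      by (rule nn_integral_add_le[OF m1 m2 b1 b2 k(1,2)]) (use nonneg C1 C2 T e0 in auto)
    have b34: "(\<integral>\<^sup>+w. ennreal (norm v * g3 w + k4 * g4 w) \<partial>P) \<le> ennreal (norm v * (C3 * e) + k4 * (C4 * e))"
      by (rule nn_integral_add_le[OF m3 m4 b3 b4 norm_ge_zero k(3)]) (use nonneg C3 C4 e0 in auto)
    show "(\<integral>\<^sup>+w. ennreal ((LINT s:{r..u}|lborel. v \<bullet> b (w s))\<^sup>2 / 2
      + \<bar>LINT s:{r..u}|lborel. v \<bullet> b (w s)\<bar> * \<bar>v \<bullet> (w u - w r)\<bar>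
      + D w * \<bar>(LINT s:{r..u}|lborel. v \<bullet> b (w s)) - (u - r) * (v \<bullet> b (w r))\<bar>
      + \<bar>v \<bullet> (w u - w r)\<bar> * (S u w - S r w)
      + 10 * L\<^sup>2 * (\<bar>v \<bullet> (w u - w r)\<bar> * (norm (w u - w r))\<^sup>2)) \<partial>P) \<le> ennreal (C * ((u - r) * sqrt (u - r)))"
    proof (rule nn_integral_add_le[OF _ _ b12 b34, where a=1 and b=1])
      fix w assume w: "w \<in> space P"
      have "\<bar>v \<bullet> (w u - w r)\<bar> * (norm (w u - w r))\<^sup>2 \<le> (norm v * norm (w u - w r)) * (norm (w u - w r))\<^sup>2"
        by (intro mult_right_mono Cauchy_Schwarz_ineq2) auto
      also have "\<dots> = norm v * g4 w" by (simp add: g4_def power3_eq_cube power2_eq_square)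
      finally have "10 * L\<^sup>2 * (\<bar>v \<bullet> (w u - w r)\<bar> * (norm (w u - w r))\<^sup>2) \<le> 10 * L\<^sup>2 * (norm v * g4 w)"
        by (intro mult_left_mono) auto
      moreover note bounds = drift_integral_bounds[OF w ru(1,2) Cb, of v, folded h_def, folded g1_def g2_def g3_def]
      ultimately show "(LINT s:{r..u}|lborel. v \<bullet> b (w s))\<^sup>2 / 2
        + \<bar>LINT s:{r..u}|lborel. v \<bullet> b (w s)\<bar> * \<bar>v \<bullet> (w u - w r)\<bar>
        + D w * \<bar>(LINT s:{r..u}|lborel. v \<bullet> b (w s)) - (u - r) * (v \<bullet> b (w r))\<bar>
        + \<bar>v \<bullet> (w u - w r)\<bar> * (S u w - S r w)
        + 10 * L\<^sup>2 * (\<bar>v \<bullet> (w u - w r)\<bar> * (norm (w u - w r))\<^sup>2)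
        \<le> 1 * (k1 * g1 w + k2 * g2 w) + 1 * (norm v * g3 w + k4 * g4 w)"
        unfolding h_def[symmetric] k1_def k2_def k4_def by (simp add: distrib_right mult.assoc)
    next
      show "1 * (k1 * (C1 * sqrt T * e) + k2 * (C2 * e)) + 1 * (norm v * (C3 * e) + k4 * (C4 * e)) \<le> C * ((u - r) * sqrt (u - r))"
        unfolding h_def[symmetric] e_def[symmetric] by (simp add: C_def algebra_simps)
    qed (use nonneg k m1 m2 m3 m4 C1 C2 C3 C4 T e0 in auto)
  qed
qed

lemma measurable_\<beta>: "0 \<le> t \<Longrightarrow> \<beta> t \<in> borel_measurable (\<F> t)"
  unfolding \<beta>_def[abs_def]
  by (intro borel_measurable_diff measurable_coordinate_filtration measurable_path_integral continuous_b) auto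

lemma \<beta>_increment:
  assumes "w \<in> space P" "0 \<le> r" "r \<le> u"
  shows "v \<bullet> (\<beta> u w - \<beta> r w) = v \<bullet> (w u - w r) - (LINT s:{r..u}|lborel. v \<bullet> b (w s))"
proof -
  have cb: "continuous_on {0..} (\<lambda>s. b (w s))" using assms(1) continuous_b by (rule continuous_along_path)
  have "(LINT s:{0..u}|lborel. b (w s)) = (LINT s:{0..r}|lborel. b (w s)) + (LINT s:{r..u}|lborel. b (w s))"
    using assms by (intro set_integral_combine cb) auto
  then have "\<beta> u w - \<beta> r w = (w u - w r) - (LINT s:{r..u}|lborel. b (w s))"
    by (simp add: \<beta>_def)
  moreover have "v \<bullet> (LINT s:{r..u}|lborel. b (w s)) = (LINT s:{r..u}|lborel. v \<bullet> b (w s))"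
    using set_integrable_continuous[OF cb assms(2), of u]
    unfolding set_lebesgue_integral_def set_integrable_def by (simp flip: integral_inner_right)
  ultimately show ?thesis by (simp add: inner_diff_right)
qed

lemma integrable_b:
  assumes "0 \<le> r" shows "integrable P (\<lambda>w. v \<bullet> b (w r))"
proof -
  obtain C where C: "0 \<le> C" "\<And>x. norm (b x) \<le> C * (1 + V x)" using b_bound by blast
  obtain C1 where C1: "(\<integral>\<^sup>+w. ennreal ((1 + V (w r))\<^sup>2) \<partial>P) \<le> ennreal C1"
    using V_moment[OF assms] assms by blast
  have m: "(\<lambda>w. w r) \<in> borel_measurable P" using assms by (rule measurable_coordinate)
  have "integrable P (\<lambda>w. (1 + V (w r))\<^sup>2)"
    using m C1 by (intro integrableI_nonneg) (auto simp: order_le_less_trans intro: measurable_compose[OF _ measurable_V])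
  then have "integrable P (\<lambda>w. norm v * C * (1 + V (w r))\<^sup>2)" by simp
  then show ?thesis
  proof (rule Bochner_Integration.integrable_bound)
    show "(\<lambda>w. v \<bullet> b (w r)) \<in> borel_measurable P"
      using measurable_compose[OF m measurable_b] by simp
    show "AE w in P. norm (v \<bullet> b (w r)) \<le> norm (norm v * C * (1 + V (w r))\<^sup>2)"
    proof (intro AE_I2)
      fix w
      have "\<bar>v \<bullet> b (w r)\<bar> \<le> norm v * (C * (1 + V (w r)))"
        using order_trans[OF Cauchy_Schwarz_ineq2 mult_left_mono[OF C(2) norm_ge_zero]] .
      also have "\<dots> \<le> norm v * (C * (1 + V (w r))\<^sup>2)"
        using V_nonneg[of "w r"] C(1) by (intro mult_left_mono self_le_power) auto
      finally show "norm (v \<bullet> b (w r)) \<le> norm (norm v * C * (1 + V (w r))\<^sup>2)"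
        using C(1) by (simp add: mult.assoc)
    qed
  qed
qed

text \<open>Two changes occur between \<open>r\<close> and \<open>u\<close>:
  \<open>exp (- S)\<close> decreases by at most the growth of the nonnegative \<open>S\<close>, and
  \<open>j\<close> deviates from its Taylor polynomial by the global remainder. The cofactors
  \<open>j (w u)\<close> and \<open>exp (- S r w)\<close> are at most 1.\<close>

lemma density_increment_bound:
  assumes w: "w \<in> space P" and ru: "0 \<le> r" "r \<le> u"
  shows "\<bar>exp (- S u w) * j (w u) - exp (- S r w) * (j (w r) + J (w r) \<bullet> (w u - w r))\<bar>
    \<le> (S u w - S r w) + 10 * L\<^sup>2 * (norm (w u - w r))\<^sup>2"
proof -
  let ?E = "exp (- S u w)" and ?E' = "exp (- S r w)" and ?\<xi> = "w u - w r"
  have le: "S r w \<le> S u w"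
    using S_combine[OF w ru] by (simp add: set_lebesgue_integral_def integral_nonneg_AE V_nonneg)
  have "?E' - ?E = ?E' * (1 - exp (- (S u w - S r w)))" by (simp add: right_diff_distrib exp_add[symmetric])
  also have "\<dots> \<le> 1 * (S u w - S r w)"
  proof (rule mult_mono)
    show "1 - exp (- (S u w - S r w)) \<le> S u w - S r w"
      using exp_ge_add_one_self[of "- (S u w - S r w)"] by linarith
  qed (use S_nonneg[of r w] le in auto)
  finally have E: "\<bar>?E - ?E'\<bar> \<le> S u w - S r w" using le by simp
  have eq: "?E * j (w u) - ?E' * (j (w r) + J (w r) \<bullet> ?\<xi>) =
      (?E - ?E') * j (w u) + ?E' * (j (w u) - j (w r) - J (w r) \<bullet> ?\<xi>)" by (simp add: algebra_simps)
  have "\<bar>?E * j (w u) - ?E' * (j (w r) + J (w r) \<bullet> ?\<xi>)\<bar> \<le>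
      \<bar>?E - ?E'\<bar> * \<bar>j (w u)\<bar> + ?E' * \<bar>j (w u) - j (w r) - J (w r) \<bullet> ?\<xi>\<bar>"
    unfolding eq by (rule order_trans[OF abs_triangle_ineq]) (simp add: abs_mult)
  also have "\<dots> \<le> (S u w - S r w) * 1 + 1 * (10 * L\<^sup>2 * (norm ?\<xi>)\<^sup>2)"
    using E j_taylor[of "w r" ?\<xi>] j_pos[of "w u"] j_le_1[of "w u"] S_nonneg[of r w] le
    by (intro add_mono mult_mono) auto
  finally show ?thesis by simp
qed

text \<open>Replace the drift integral by \<open>(u - r) *\<^sub>R b (w r)\<close>, \<open>D\<close> by its conditional expectation and
  \<open>j\<close> by its first-order Taylor polynomial at \<open>w r\<close>.  The main terms cancel because \<open>j b = j \<mu> + J\<close>.\<close>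

lemma one_step:
  assumes T: "0 \<le> T"
  shows "\<exists>C\<ge>0. \<forall>r u Y. 0 \<le> r \<longrightarrow> r < u \<longrightarrow> u \<le> T \<longrightarrow> Y \<in> borel_measurable (\<F> r) \<longrightarrow> (\<forall>w. cmod (Y w) \<le> 1) \<longrightarrow>
    cmod (CLINT w|P. D w *\<^sub>R (Y w * (iexp (v \<bullet> (\<beta> u w - \<beta> r w)) - 1 + (norm v)\<^sup>2 / 2 * (u - r)))) \<le> C * ((u - r) * sqrt (u - r))"
proof -
  obtain C1 where C1: "0 \<le> C1" "\<And>r u. 0 \<le> r \<Longrightarrow> r < u \<Longrightarrow> u \<le> T \<Longrightarrow>
    (\<integral>\<^sup>+w. ennreal ((LINT s:{r..u}|lborel. v \<bullet> b (w s))\<^sup>2 / 2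
      + \<bar>LINT s:{r..u}|lborel. v \<bullet> b (w s)\<bar> * \<bar>v \<bullet> (w u - w r)\<bar>
      + D w * \<bar>(LINT s:{r..u}|lborel. v \<bullet> b (w s)) - (u - r) * (v \<bullet> b (w r))\<bar>
      + \<bar>v \<bullet> (w u - w r)\<bar> * (S u w - S r w)
      + 10 * L\<^sup>2 * (\<bar>v \<bullet> (w u - w r)\<bar> * (norm (w u - w r))\<^sup>2)) \<partial>P) \<le> ennreal (C1 * ((u - r) * sqrt (u - r)))"
    using one_step_error_bound[OF T] by blast
  obtain C2 where C2: "0 \<le> C2" "\<And>r u. 0 \<le> r \<Longrightarrow> r < u \<Longrightarrow> u \<le> T \<Longrightarrow>
    cmod ((CLINT w|P. iexp (v \<bullet> (w u - w r)) - 1) - (\<i> * ((u - r) * (v \<bullet> \<mu>)) - (norm v)\<^sup>2 / 2 * (u - r))) \<le> C2 * ((u - r) * sqrt (u - r))"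
    "\<And>r u k. 0 \<le> r \<Longrightarrow> r < u \<Longrightarrow> u \<le> T \<Longrightarrow>
    cmod ((CLINT w|P. complex_of_real ((w u - w r) $ k) * (iexp (v \<bullet> (w u - w r)) - 1)) - \<i> * ((u - r) * v $ k)) \<le> C2 * ((u - r) * sqrt (u - r))"
    using increment_char_expansion[OF T, of v] by blast
  \<comment> \<open>\<open>C1\<close> pays for the replacements. \<open>C2\<close> pays for the
    expansion of the increment, multiplied by expectations of size at most 1 (from \<open>j\<close>)
    and at most \<open>2 * L\<close> for each coordinate of \<open>J\<close>.\<close>
  define C where "C = C1 + (C2 + CARD('n) * (2 * L * C2))"
  show ?thesis
  proof (intro exI[of _ C] conjI allI impI)
    show "0 \<le> C" using C1 C2 L_nonneg by (simp add: C_def)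
    fix r u and Y :: "(real \<Rightarrow> real ^ 'n) \<Rightarrow> complex"
    assume ru: "0 \<le> r" "r < u" "u \<le> T" and Y: "Y \<in> borel_measurable (\<F> r)" and Y1: "\<forall>w. cmod (Y w) \<le> 1"
    define h where "h = u - r"
    define e where "e = h * sqrt h"
    define \<kappa> where "\<kappa> = (norm v)\<^sup>2 / 2"
    define \<xi> where "\<xi> w = w u - w r" for w :: "real \<Rightarrow> real ^ 'n"
    define a where "a w = v \<bullet> \<xi> w" for w
    define y where "y w = (LINT s:{r..u}|lborel. v \<bullet> b (w s))" for w
    define c where "c w = v \<bullet> b (w r)" for w
    define U where "U w = complex_of_real (exp (- S r w)) * Y w" for w
    \<comment> \<open>\<open>M1\<close> is compared with \<open>F2 + F3\<close>: \<open>F2\<close>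
      keeps the increment of the path, \<open>F3\<close> the drift frozen at \<open>r\<close> and
      the Gaussian compensator. \<open>G2\<close> is \<open>F2\<close> with \<open>D\<close>
      replaced by its conditional expectation at \<open>u\<close>, and \<open>M2\<close> is
      \<open>G2\<close> with \<open>S\<close> frozen at \<open>r\<close> and \<open>j\<close>
      replaced by its Taylor polynomial.\<close>
    define M1 where "M1 w = D w *\<^sub>R (Y w * (iexp (v \<bullet> (\<beta> u w - \<beta> r w)) - 1 + \<kappa> * h))" for w
    define F2 where "F2 w = D w *\<^sub>R (Y w * (iexp (a w) - 1))" for w
    define F3 where "F3 w = D w *\<^sub>R (Y w * (\<kappa> * h - \<i> * (h * c w)))" for w
    define G2 where "G2 w = (exp (- S u w) * j (w u)) *\<^sub>R (Y w * (iexp (a w) - 1))" for w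
    define M2 where "M2 w = U w * j (w r) * (iexp (a w) - 1) + (\<Sum>k\<in>UNIV. U w * J (w r) $ k * (\<xi> w $ k * (iexp (a w) - 1)))" for w
    define p where "p = (CLINT w|P. U w * j (w r))"
    define q where "q k = (CLINT w|P. U w * J (w r) $ k)" for k
    have h: "0 < h" "h \<le> T" using ru by (auto simp: h_def)
    have e0: "0 \<le> e" using h by (simp add: e_def)
    have mr: "(\<lambda>w. w r) \<in> borel_measurable (\<F> r)" "(\<lambda>w. w r) \<in> borel_measurable (\<F> u)"
      "(\<lambda>w. w u) \<in> borel_measurable (\<F> u)" "S r \<in> borel_measurable (\<F> r)" "S u \<in> borel_measurable (\<F> u)"
      "\<beta> r \<in> borel_measurable (\<F> r)" "\<beta> u \<in> borel_measurable (\<F> u)" "Y \<in> borel_measurable (\<F> u)"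
      using ru Y by (auto intro: measurable_coordinate_filtration measurable_S measurable_\<beta> measurable_filtration_mono[of r u])
    have mF: "\<xi> \<in> borel_measurable (\<F> u)" "a \<in> borel_measurable (\<F> u)"
      using mr(2,3) unfolding \<xi>_def[abs_def] a_def[abs_def] by (auto intro!: borel_measurable_inner)
    have mU: "U \<in> borel_measurable (\<F> r)"
      unfolding U_def[abs_def] using mr(4) Y by (auto intro!: borel_measurable_times borel_measurable_of_real measurable_compose[OF _ borel_measurable_exp])
    have mUj: "(\<lambda>w. U w * j (w r)) \<in> borel_measurable (\<F> r)" "(\<lambda>w. U w * J (w r) $ k) \<in> borel_measurable (\<F> r)" for k
      using mU measurable_compose[OF mr(1) measurable_j] measurable_compose[OF measurable_compose[OF mr(1) measurable_J] borel_measurable_nth]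
      by (auto intro!: borel_measurable_times borel_measurable_of_real)
    note mP = mr[THEN measurable_filtrationD] mF[THEN measurable_filtrationD] mU[THEN measurable_filtrationD]
      mUj[THEN measurable_filtrationD] Y[THEN measurable_filtrationD]
    have mP': "(\<lambda>w. \<xi> w $ k) \<in> borel_measurable P" "c \<in> borel_measurable P" for k
      using mP(1) mP(9) measurable_compose[OF mP(1) measurable_b]
      unfolding c_def[abs_def] by (auto intro: measurable_compose[OF _ borel_measurable_nth])
    note [measurable] = mP mP'
    have U1: "cmod (U w) \<le> 1" for w
      using Y1 S_nonneg[of r w] mult_mono[of "exp (- S r w)" 1 "cmod (Y w)" 1] by (simp add: U_def norm_mult)
    have Uj: "cmod (U w * j (w r)) \<le> 1" for w
      using mult_mono[OF U1[of w] j_le_1[of "w r"]] j_pos[of "w r"] by (simp add: norm_mult)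
    have UJ: "cmod (U w * J (w r) $ k) \<le> 2 * L" for w k
      using mult_mono[OF U1[of w] order_trans[OF component_le_norm_cart[of "J (w r)" k] norm_J_le]] by (simp add: norm_mult)
    have p1: "cmod p \<le> 1" and q1: "cmod (q k) \<le> 2 * L" for k
      using norm_integral_mono_AE[of P "\<lambda>_. 1" "\<lambda>w. U w * j (w r)"]
        norm_integral_mono_AE[of P "\<lambda>_. 2 * L" "\<lambda>w. U w * J (w r) $ k"] Uj UJ
      by (auto simp: p_def q_def prob_space)
    have iUj: "integrable P (\<lambda>w. U w * j (w r))" "integrable P (\<lambda>w. U w * J (w r) $ k)" for k
      by (rule integrable_const_bound[where B=1], use Uj in auto)
        (rule integrable_const_bound[where B="2 * L"], use UJ in auto)
    have ie2: "cmod (iexp x - 1) \<le> 2" for x :: real using norm_triangle_ineq4[of "iexp x" 1] by simp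
    have D1: "\<bar>D w\<bar> \<le> 1" for w using D_pos[of w] D_le_1[of w] by simp
    have Dnorm: "norm (D w *\<^sub>R z) \<le> norm z" for w and z :: complex
      using mult_right_mono[OF D1[of w], of "norm z"] by simp
    have Ynorm: "norm (Y w * z) \<le> norm z" for w z
      using mult_right_mono[OF spec[OF Y1], of "norm z" w] by (simp add: norm_mult)
    have DYnorm: "norm (D w *\<^sub>R (Y w * z)) \<le> norm z" for w z
      using Dnorm Ynorm order_trans by blast
    have iM1: "integrable P M1"
    proof (rule integrable_const_bound[where B="2 + \<bar>\<kappa> * h\<bar>"])
      show "AE w in P. norm (M1 w) \<le> 2 + \<bar>\<kappa> * h\<bar>"
      proof (rule AE_I2)
        fix w
        have "norm (M1 w) \<le> norm (iexp (v \<bullet> (\<beta> u w - \<beta> r w)) - 1 + \<kappa> * h)" unfolding M1_def by (rule DYnorm)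
        also have "\<dots> \<le> 2 + \<bar>\<kappa> * h\<bar>"
          using norm_triangle_ineq[of "iexp (v \<bullet> (\<beta> u w - \<beta> r w)) - 1" "complex_of_real (\<kappa> * h)"] ie2[of "v \<bullet> (\<beta> u w - \<beta> r w)"]
          unfolding norm_of_real by simp
        finally show "norm (M1 w) \<le> 2 + \<bar>\<kappa> * h\<bar>" .
      qed
      show "M1 \<in> borel_measurable P" unfolding M1_def[abs_def] by measurable
    qed
    have iF2: "integrable P F2"
    proof (rule integrable_const_bound[where B=2])
      show "AE w in P. norm (F2 w) \<le> 2"
        unfolding F2_def using order_trans[OF DYnorm ie2] by (intro AE_I2)
      show "F2 \<in> borel_measurable P" unfolding F2_def[abs_def] by measurable
    qed
    have iF3: "integrable P F3"
    proof (rule Bochner_Integration.integrable_bound)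
      show "integrable P (\<lambda>w. \<bar>\<kappa> * h\<bar> + h * \<bar>c w\<bar>)"
        using integrable_b[OF ru(1), of v] by (auto simp: c_def)
      show "AE w in P. norm (F3 w) \<le> norm (\<bar>\<kappa> * h\<bar> + h * \<bar>c w\<bar>)"
      proof (rule AE_I2)
        fix w
        have "norm (F3 w) \<le> norm (complex_of_real (\<kappa> * h) - \<i> * complex_of_real (h * c w))"
          unfolding F3_def using DYnorm[of w] by simp
        also have "\<dots> \<le> \<bar>\<kappa> * h\<bar> + h * \<bar>c w\<bar>"
          using norm_triangle_ineq4[of "complex_of_real (\<kappa> * h)" "\<i> * complex_of_real (h * c w)"] h
          unfolding norm_mult[of \<i>] norm_of_real by (simp add: abs_mult)
        finally show "norm (F3 w) \<le> norm (\<bar>\<kappa> * h\<bar> + h * \<bar>c w\<bar>)" by simp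
      qed
      show "F3 \<in> borel_measurable P" unfolding F3_def[abs_def] by measurable
    qed
    have iG2: "integrable P G2"
    proof (rule integrable_const_bound[where B=2])
      show "AE w in P. norm (G2 w) \<le> 2"
      proof (rule AE_I2)
        fix w
        have "norm (G2 w) \<le> 1 * 2"
          unfolding G2_def norm_scaleR
          using mult_mono[of "exp (- S u w)" 1 "j (w u)" 1] S_nonneg[of u w] j_pos[of "w u"] j_le_1[of "w u"]
            order_trans[OF Ynorm ie2]
          by (intro mult_mono) (auto simp: abs_mult)
        then show "norm (G2 w) \<le> 2" by simp
      qed
      show "G2 \<in> borel_measurable P"
        unfolding G2_def[abs_def] using measurable_compose[OF mP(3) measurable_j] by measurable
    qed
    \<comment> \<open>Every term of \<open>M2\<close> is a factor known at time \<open>r\<close>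
      times a function of the increment, so independence splits its integral into a product.\<close>
    have expand: "integrable P (\<lambda>w. U w * j (w r) * (iexp (a w) - 1))"
        "(CLINT w|P. U w * j (w r) * (iexp (a w) - 1)) = p * (CLINT w|P. iexp (a w) - 1)"
        "integrable P (\<lambda>w. U w * J (w r) $ k * (\<xi> w $ k * (iexp (a w) - 1)))"
        "(CLINT w|P. U w * J (w r) $ k * (\<xi> w $ k * (iexp (a w) - 1))) = q k * (CLINT w|P. \<xi> w $ k * (iexp (a w) - 1))" for k
    proof -
      have i1: "integrable P (\<lambda>w. iexp (v \<bullet> (w u - w r)) - 1)"
        using mP(10) unfolding a_def[abs_def] \<xi>_def[abs_def]
        by (intro integrable_const_bound[where B=2] AE_I2 ie2) measurable
      have i2: "integrable P (\<lambda>w. complex_of_real ((w u - w r) $ k) * (iexp (v \<bullet> (w u - w r)) - 1))"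
      proof (rule Bochner_Integration.integrable_bound)
        show "integrable P (\<lambda>w. 2 * (w u - w r) $ k)"
          using increment_moments(1)[OF ru(1,2), of k] unfolding has_bochner_integral_iff
          by (intro integrable_mult_right) blast
        have "\<bar>x\<bar> * cmod (iexp z - 1) \<le> \<bar>x\<bar> * 2" for x z by (intro mult_left_mono ie2) simp
        then show "AE w in P. norm (complex_of_real ((w u - w r) $ k) * (iexp (v \<bullet> (w u - w r)) - 1)) \<le> norm (2 * (w u - w r) $ k)"
          by (intro AE_I2) (simp add: norm_mult abs_mult mult.commute[of 2] del: vector_minus_component)
        show "(\<lambda>w. complex_of_real ((w u - w r) $ k) * (iexp (v \<bullet> (w u - w r)) - 1)) \<in> borel_measurable P"
          using mP(10) mP'(1)[of k] unfolding a_def[abs_def] \<xi>_def[abs_def] by measurable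
      qed
      note ind = integral_increment_indep[OF ru(1) less_imp_le[OF ru(2)]]
      show "integrable P (\<lambda>w. U w * j (w r) * (iexp (a w) - 1))"
        "(CLINT w|P. U w * j (w r) * (iexp (a w) - 1)) = p * (CLINT w|P. iexp (a w) - 1)"
        using ind[OF mUj(1) iUj(1) _ i1] by (simp_all add: a_def \<xi>_def p_def)
      show "integrable P (\<lambda>w. U w * J (w r) $ k * (\<xi> w $ k * (iexp (a w) - 1)))"
        "(CLINT w|P. U w * J (w r) $ k * (\<xi> w $ k * (iexp (a w) - 1))) = q k * (CLINT w|P. \<xi> w $ k * (iexp (a w) - 1))"
        using ind[where f="\<lambda>x. complex_of_real (x $ k) * (iexp (v \<bullet> x) - 1)", OF mUj(2)[of k] iUj(2)[of k] _ i2]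
        by (simp_all add: a_def \<xi>_def q_def)
    qed
    have iM2: "integrable P M2"
      unfolding M2_def[abs_def] by (intro Bochner_Integration.integrable_add Bochner_Integration.integrable_sum expand)
    have M2: "(CLINT w|P. M2 w) = p * (CLINT w|P. iexp (a w) - 1) + (\<Sum>k\<in>UNIV. q k * (CLINT w|P. \<xi> w $ k * (iexp (a w) - 1)))"
      unfolding M2_def by (subst Bochner_Integration.integral_add Bochner_Integration.integral_sum; (intro Bochner_Integration.integrable_sum expand)?)+ (simp only: expand)
    \<comment> \<open>\<open>F2\<close> needs the path up to \<open>u\<close>, so \<open>D\<close>
      is conditioned at \<open>u\<close>; the integrand of \<open>F3\<close> is known at
      \<open>r\<close>, so there \<open>D\<close> is conditioned at \<open>r\<close>.\<close>
    have F2G2: "(CLINT w|P. F2 w) = (CLINT w|P. G2 w)"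
      unfolding F2_def G2_def using ru mr mF
      by (intro integral_D) (auto intro!: borel_measurable_times borel_measurable_diff measurable_compose[OF _ borel_measurable_exp] borel_measurable_of_real)
    have F3: "(CLINT w|P. F3 w) = (\<kappa> * h - \<i> * (h * (v \<bullet> \<mu>))) * p - (\<Sum>k\<in>UNIV. (\<i> * (h * v $ k)) * q k)"
    proof -
      have "(CLINT w|P. F3 w) = (CLINT w|P. (exp (- S r w) * j (w r)) *\<^sub>R (Y w * (\<kappa> * h - \<i> * (h * c w))))"
        unfolding F3_def c_def using ru Y measurable_compose[OF mr(1) measurable_b]
        by (intro integral_D) (auto intro!: borel_measurable_times borel_measurable_diff borel_measurable_of_real borel_measurable_inner)
      also have "\<dots> = (CLINT w|P. (\<kappa> * h - \<i> * (h * (v \<bullet> \<mu>))) * (U w * j (w r)) - (\<Sum>k\<in>UNIV. (\<i> * (h * v $ k)) * (U w * J (w r) $ k)))"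
      proof (rule Bochner_Integration.integral_cong[OF refl])
        fix w
        have "j (w r) * c w = j (w r) * (v \<bullet> \<mu>) + (\<Sum>k\<in>UNIV. v $ k * J (w r) $ k)"
          using j_pos[of "w r"] by (simp add: c_def b_def inner_add_right distrib_left inner_vec_def[of v "J (w r)"])
        then have jc: "complex_of_real (j (w r)) * complex_of_real (c w) =
            complex_of_real (j (w r)) * complex_of_real (v \<bullet> \<mu>) + (\<Sum>k\<in>UNIV. complex_of_real (v $ k) * complex_of_real (J (w r) $ k))"
          by (simp flip: of_real_mult of_real_add of_real_sum)
        have "(exp (- S r w) * j (w r)) *\<^sub>R (Y w * (\<kappa> * h - \<i> * (h * c w))) =
            \<kappa> * h * (U w * j (w r)) - \<i> * h * (U w * (complex_of_real (j (w r)) * complex_of_real (c w)))"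
          by (simp add: U_def scaleR_conv_of_real algebra_simps)
        also have "\<dots> = (\<kappa> * h - \<i> * (h * (v \<bullet> \<mu>))) * (U w * j (w r)) - (\<Sum>k\<in>UNIV. (\<i> * (h * v $ k)) * (U w * J (w r) $ k))"
          unfolding jc by (simp add: algebra_simps sum_distrib_left)
        finally show "(exp (- S r w) * j (w r)) *\<^sub>R (Y w * (\<kappa> * h - \<i> * (h * c w))) = \<dots>" .
      qed
      also have "\<dots> = (\<kappa> * h - \<i> * (h * (v \<bullet> \<mu>))) * p - (\<Sum>k\<in>UNIV. (\<i> * (h * v $ k)) * q k)"
        unfolding p_def q_def using iUj
        by (subst Bochner_Integration.integral_diff Bochner_Integration.integral_sum; (intro Bochner_Integration.integrable_sum integrable_mult_right iUj)?)+ simp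
      finally show ?thesis .
    qed
    have rest: "norm (CLINT w|P. (M1 w - F2 w - F3 w) + (G2 w - M2 w)) \<le> C1 * e"
      unfolding e_def h_def
    proof (rule norm_integral_le_nn_integral[OF C1(2)[OF ru]])
      show "0 \<le> C1 * ((u - r) * sqrt (u - r))" using C1 ru by simp
      fix w assume w: "w \<in> space P"
      have \<beta>: "v \<bullet> (\<beta> u w - \<beta> r w) = a w - y w"
        unfolding a_def y_def \<xi>_def using ru by (intro \<beta>_increment w) auto
      have eq1: "M1 w - F2 w - F3 w = D w *\<^sub>R (Y w * (iexp (a w - y w) - iexp (a w) + \<i> * complex_of_real (h * c w)))"
        unfolding M1_def F2_def F3_def \<beta> scaleR_diff_right[symmetric] right_diff_distrib[symmetric]
        by (simp add: algebra_simps)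
      have "norm (M1 w - F2 w - F3 w) \<le> D w * ((y w)\<^sup>2 / 2 + \<bar>y w\<bar> * \<bar>a w\<bar> + \<bar>y w - h * c w\<bar>)"
        unfolding eq1 norm_scaleR abs_of_pos[OF D_pos]
        using D_pos[of w] order_trans[OF Ynorm iexp_diff_expansion[of "a w" "y w" "h * c w"]] by (intro mult_left_mono) auto
      also have "\<dots> \<le> (y w)\<^sup>2 / 2 + \<bar>y w\<bar> * \<bar>a w\<bar> + D w * \<bar>y w - h * c w\<bar>"
        unfolding distrib_left using mult_right_mono[OF D_le_1[of w], of "(y w)\<^sup>2 / 2"] mult_right_mono[OF D_le_1[of w], of "\<bar>y w\<bar> * \<bar>a w\<bar>"]
        by (intro add_mono) auto
      finally have n1: "norm (M1 w - F2 w - F3 w) \<le> (y w)\<^sup>2 / 2 + \<bar>y w\<bar> * \<bar>a w\<bar> + D w * \<bar>y w - h * c w\<bar>" .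
      have "M2 w = (exp (- S r w) * (j (w r) + J (w r) \<bullet> \<xi> w)) *\<^sub>R (Y w * (iexp (a w) - 1))"
        by (simp add: M2_def U_def inner_vec_def scaleR_conv_of_real sum_distrib_left sum_distrib_right algebra_simps)
      then have eq2: "G2 w - M2 w = (exp (- S u w) * j (w u) - exp (- S r w) * (j (w r) + J (w r) \<bullet> \<xi> w)) *\<^sub>R (Y w * (iexp (a w) - 1))"
        by (simp add: G2_def scaleR_diff_left)
      have n2: "norm (G2 w - M2 w) \<le> ((S u w - S r w) + 10 * L\<^sup>2 * (norm (\<xi> w))\<^sup>2) * \<bar>a w\<bar>"
        unfolding eq2 norm_scaleR \<xi>_def using ru density_increment_bound[OF w, of r u] order_trans[OF Ynorm iexp_bounds(1)]
        by (intro mult_mono') auto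
      show "norm ((M1 w - F2 w - F3 w) + (G2 w - M2 w)) \<le> (LINT s:{r..u}|lborel. v \<bullet> b (w s))\<^sup>2 / 2
        + \<bar>LINT s:{r..u}|lborel. v \<bullet> b (w s)\<bar> * \<bar>v \<bullet> (w u - w r)\<bar>
        + D w * \<bar>(LINT s:{r..u}|lborel. v \<bullet> b (w s)) - (u - r) * (v \<bullet> b (w r))\<bar>
        + \<bar>v \<bullet> (w u - w r)\<bar> * (S u w - S r w)
        + 10 * L\<^sup>2 * (\<bar>v \<bullet> (w u - w r)\<bar> * (norm (w u - w r))\<^sup>2)"
        using order_trans[OF norm_triangle_ineq add_mono[OF n1 n2]]
        unfolding a_def y_def c_def \<xi>_def h_def by (simp add: distrib_left distrib_right mult_ac add.assoc)
    qed
    have "(CLINT w|P. M1 w) = (CLINT w|P. (M1 w - F2 w - F3 w) + (G2 w - M2 w)) + ((CLINT w|P. M2 w) + (CLINT w|P. F3 w))"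
      using iM1 iF2 iF3 iG2 iM2 F2G2 by simp
    moreover have "cmod ((CLINT w|P. M2 w) + (CLINT w|P. F3 w)) \<le> (C2 + CARD('n) * (2 * L * C2)) * e"
    proof -
      let ?d = "(CLINT w|P. iexp (a w) - 1) - (\<i> * (h * (v \<bullet> \<mu>)) - \<kappa> * h)"
      let ?dk = "\<lambda>k. (CLINT w|P. \<xi> w $ k * (iexp (a w) - 1)) - \<i> * (h * v $ k)"
      have d: "cmod ?d \<le> C2 * e" "cmod (?dk k) \<le> C2 * e" for k
        using C2(2)[OF ru] C2(3)[OF ru, of k] unfolding a_def \<xi>_def e_def h_def \<kappa>_def by simp_all
      \<comment> \<open>The integral of \<open>F3\<close> is minus the main part of that of
        \<open>M2\<close>: the terms with \<open>p\<close> cancel through \<open>\<mu>\<close> and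
        \<open>\<kappa>\<close>, those with \<open>q k\<close> through the component
        \<open>J\<close> of the drift. Only expansion errors remain.\<close>
      have eq3: "(CLINT w|P. M2 w) + (CLINT w|P. F3 w) = p * ?d + (\<Sum>k\<in>UNIV. q k * ?dk k)"
        unfolding M2 F3 by (simp add: right_diff_distrib left_diff_distrib sum_subtractf mult_ac)
      have "cmod ((CLINT w|P. M2 w) + (CLINT w|P. F3 w)) \<le> cmod (p * ?d) + (\<Sum>k\<in>UNIV. cmod (q k * ?dk k))"
        unfolding eq3 by (intro order_trans[OF norm_triangle_ineq] add_left_mono norm_sum)
      also have "\<dots> \<le> 1 * (C2 * e) + (\<Sum>k\<in>(UNIV :: 'n set). 2 * L * (C2 * e))"
        unfolding norm_mult using p1 q1 d L_nonneg by (intro add_mono sum_mono mult_mono) auto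
      also have "\<dots> = (C2 + CARD('n) * (2 * L * C2)) * e" by (simp add: algebra_simps)
      finally show ?thesis .
    qed
    ultimately have "cmod (CLINT w|P. M1 w) \<le> C1 * e + (C2 + CARD('n) * (2 * L * C2)) * e"
      using order_trans[OF norm_triangle_ineq add_mono[OF rest]] by (simp only:)
    then show "cmod (CLINT w|P. D w *\<^sub>R (Y w * (iexp (v \<bullet> (\<beta> u w - \<beta> r w)) - 1 + (norm v)\<^sup>2 / 2 * (u - r)))) \<le> C * ((u - r) * sqrt (u - r))"
      unfolding M1_def \<kappa>_def h_def[symmetric] e_def[symmetric] by (simp add: C_def distrib_right)
  qed
qed

end

section \<open>From one step to Gaussian increments of \<open>\<beta>\<close> under
  \<open>Q\<close>\<close>

lemma constant_of_holder:
  fixes g :: "real \<Rightarrow> 'b::real_normed_vector"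
  assumes "s \<le> t" and holder: "\<And>x y. s \<le> x \<Longrightarrow> x < y \<Longrightarrow> y \<le> t \<Longrightarrow> norm (g y - g x) \<le> C * ((y - x) * sqrt (y - x))"
  shows "g t = g s"
proof -
  have "(g has_derivative (\<lambda>_. 0)) (at x within {s..t})" if x: "x \<in> {s..t}" for x
    unfolding has_derivative_within
  proof (intro conjI bounded_linear_zero)
    \<comment> \<open>The difference quotients are of order sqrt of the distance, so the derivative
      exists and is zero on the whole interval.\<close>
    have bound: "norm ((1 / norm (y - x)) *\<^sub>R (g y - (g x + 0))) \<le> C * sqrt \<bar>y - x\<bar>" if y: "y \<in> {s..t}" "y \<noteq> x" for y
    proof -
      have "norm (g y - g x) \<le> C * (\<bar>y - x\<bar> * sqrt \<bar>y - x\<bar>)"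
        using holder[of x y] holder[of y x] x y by (cases "x < y") (auto simp: norm_minus_commute)
      moreover have "norm ((1 / norm (y - x)) *\<^sub>R (g y - (g x + 0))) = norm (g y - g x) / \<bar>y - x\<bar>"
        by (simp only: norm_scaleR add_0_right) simp
      ultimately show ?thesis using y(2) by (simp add: pos_divide_le_eq mult_ac)
    qed
    have lim: "((\<lambda>y. C * sqrt \<bar>y - x\<bar>) \<longlongrightarrow> C * sqrt \<bar>x - x\<bar>) (at x within {s..t})" by (intro tendsto_intros)
    show "((\<lambda>y. (1 / norm (y - x)) *\<^sub>R (g y - (g x + 0))) \<longlongrightarrow> 0) (at x within {s..t})"
      by (rule Lim_null_comparison[where g="\<lambda>y. C * sqrt \<bar>y - x\<bar>"])
        (use bound lim in \<open>auto simp: eventually_at_filter intro!: always_eventually\<close>)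
  qed
  then obtain c where "\<forall>x\<in>{s..t}. g x = c" using has_derivative_zero_constant[of "{s..t}" g] by auto
  then show ?thesis using assms(1) by auto
qed

text \<open>Compares the factor 1 - x of a single step with exp (- x). It follows from 1 - x \<le>
  exp (- x) \<le> 1 / (1 + x) \<le> 1 - x + x^2.\<close>

lemma exp_times_one_minus_bound:
  fixes x :: real assumes "0 \<le> x" shows "\<bar>exp x * (1 - x) - 1\<bar> \<le> exp x * x\<^sup>2"
proof -
  have "exp (- x) \<le> 1 / (1 + x)"
    using exp_ge_add_one_self[of x] assms by (simp add: exp_minus inverse_eq_divide divide_left_mono)
  also have "\<dots> \<le> 1 - x + x\<^sup>2"
  proof -
    have "1 \<le> (1 - x + x\<^sup>2) * (1 + x)" using assms by (simp add: algebra_simps power2_eq_square)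
    then show ?thesis using assms by (simp add: pos_divide_le_eq)
  qed
  finally have u: "exp (- x) \<le> 1 - x + x\<^sup>2" .
  have l: "1 - x \<le> exp (- x)" using exp_ge_add_one_self[of "- x"] by simp
  have e: "exp x * exp (- x) = 1" by (simp add: exp_add[symmetric])
  have "exp x * (1 - x) - 1 = exp x * ((1 - x) - exp (- x))" using e by (simp add: right_diff_distrib)
  then have "\<bar>exp x * (1 - x) - 1\<bar> = exp x * \<bar>(1 - x) - exp (- x)\<bar>" by (simp add: abs_mult)
  also have "\<dots> \<le> exp x * x\<^sup>2" using u l by (intro mult_left_mono) auto
  finally show ?thesis .
qed

context conditioned_brownian_law
begin

text \<open>The exponential of \<open>v \<bullet> (\<beta> r w - \<beta> s w)\<close> restricted to
  \<open>B\<close> is known at time \<open>r\<close> and bounded by 1, so the one-step estimate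
  applies with it as \<open>Y\<close>. Hence \<open>g\<close>, the expectation \<open>G\<close> with
  its expected decay \<open>exp (- \<kappa> * (r - s))\<close> divided out, has zero
  derivative.\<close>

lemma char_\<beta>_increment_D:
  assumes st: "0 \<le> s" "s \<le> t" and B: "B \<in> sets (\<F> s)"
  shows "(CLINT w|P. D w *\<^sub>R (indicator B w * iexp (v \<bullet> (\<beta> t w - \<beta> s w)))) =
    exp (- (norm v)\<^sup>2 * (t - s) / 2) * (CLINT w|P. D w *\<^sub>R indicator B w)"
proof -
  define \<kappa> where "\<kappa> = (norm v)\<^sup>2 / 2"
  define Y where "Y r w = (indicator B w * iexp (v \<bullet> (\<beta> r w - \<beta> s w)) :: complex)" for r w
  define G where "G r = (CLINT w|P. D w *\<^sub>R Y r w)" for r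
  define g where "g r = complex_of_real (exp (\<kappa> * (r - s))) * G r" for r
  have t: "0 \<le> t" using st by simp
  obtain C where C: "0 \<le> C" "\<And>r u Y. 0 \<le> r \<Longrightarrow> r < u \<Longrightarrow> u \<le> t \<Longrightarrow> Y \<in> borel_measurable (\<F> r) \<Longrightarrow> (\<forall>w. cmod (Y w) \<le> 1) \<Longrightarrow>
    cmod (CLINT w|P. D w *\<^sub>R (Y w * (iexp (v \<bullet> (\<beta> u w - \<beta> r w)) - 1 + (norm v)\<^sup>2 / 2 * (u - r)))) \<le> C * ((u - r) * sqrt (u - r))"
    using one_step[OF t, of v] by blast
  have \<kappa>: "0 \<le> \<kappa>" by (simp add: \<kappa>_def)
  have Y1: "cmod (Y r w) \<le> 1" for r w by (simp add: Y_def norm_mult indicator_def)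
  have mY: "Y r \<in> borel_measurable (\<F> r)" if "s \<le> r" for r
  proof -
    have "\<beta> r \<in> borel_measurable (\<F> r)" "\<beta> s \<in> borel_measurable (\<F> r)"
      using st that by (auto intro: measurable_\<beta> measurable_filtration_mono[of s r])
    moreover have "B \<in> sets (\<F> r)" using B sets_natural_filtration_mono[OF that] by blast
    ultimately show ?thesis unfolding Y_def[abs_def] by measurable
  qed
  have iDY: "integrable P (\<lambda>w. D w *\<^sub>R Y r w)" if "s \<le> r" for r
  proof (rule integrable_const_bound[where B=1])
    show "(\<lambda>w. D w *\<^sub>R Y r w) \<in> borel_measurable P"
      using measurable_filtrationD[OF mY[OF that]] by measurable
    have "norm (D w *\<^sub>R Y r w) \<le> 1" for w
      using mult_mono[OF D_le_1[of w] Y1[of r w]] D_pos[of w] by simp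
    then show "AE w in P. norm (D w *\<^sub>R Y r w) \<le> 1" by simp
  qed
  have G1: "cmod (G r) \<le> 1" for r
  proof -
    have "norm (D w *\<^sub>R Y r w) \<le> 1" for w
      using mult_mono[OF D_le_1[of w] Y1[of r w]] D_pos[of w] by simp
    then have "cmod (G r) \<le> (LINT w|P. 1)" unfolding G_def by (intro norm_integral_mono_AE) auto
    then show ?thesis by (simp add: prob_space)
  qed
  \<comment> \<open>\<open>exp (\<kappa> * t)\<close> bounds all prefactors; \<open>C\<close> is the
    one-step constant, and \<open>\<kappa>\<^sup>2 * sqrt t\<close> pays for a term of order h^2
    with h \<le> t.\<close>
  define K where "K = exp (\<kappa> * t) * (C + \<kappa>\<^sup>2 * sqrt t)"
  have "g t = g s"
  proof (rule constant_of_holder[OF st(2), where C=K])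
    fix r u assume ru: "s \<le> r" "r < u" "u \<le> t"
    define h where "h = u - r"
    have h: "0 < h" "h \<le> t" using ru st by (auto simp: h_def)
    have e0: "0 \<le> h * sqrt h" using h by simp
    have step: "cmod (G u - (1 - \<kappa> * h) * G r) \<le> C * (h * sqrt h)"
    proof -
      have "D w *\<^sub>R (Y r w * (iexp (v \<bullet> (\<beta> u w - \<beta> r w)) - 1 + (norm v)\<^sup>2 / 2 * (u - r))) =
          D w *\<^sub>R Y u w - (1 - \<kappa> * h) * (D w *\<^sub>R Y r w)" for w
      proof -
        have "Y u w = Y r w * iexp (v \<bullet> (\<beta> u w - \<beta> r w))"
          by (simp add: Y_def exp_add[symmetric] inner_diff_right algebra_simps)
        then show ?thesis by (simp add: \<kappa>_def h_def scaleR_conv_of_real algebra_simps)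
      qed
      then have "(CLINT w|P. D w *\<^sub>R (Y r w * (iexp (v \<bullet> (\<beta> u w - \<beta> r w)) - 1 + (norm v)\<^sup>2 / 2 * (u - r)))) =
          G u - (1 - \<kappa> * h) * G r"
        unfolding G_def using iDY[of u] iDY[of r] ru
        by (simp only: Bochner_Integration.integral_diff integrable_mult_right integral_mult_right_zero less_imp_le order_trans)
      then show ?thesis using C(2)[of r u "Y r"] ru st mY Y1 by (simp add: h_def)
    qed
    \<comment> \<open>The first summand is the one-step error, the second the mismatch between
      \<open>1 - \<kappa> * h\<close> and \<open>exp (- (\<kappa> * h))\<close>.\<close>
    have "g u - g r = complex_of_real (exp (\<kappa> * (u - s))) * (G u - (1 - \<kappa> * h) * G r) +
        complex_of_real (exp (\<kappa> * (r - s)) * (exp (\<kappa> * h) * (1 - \<kappa> * h) - 1)) * G r"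
    proof -
      have "exp (\<kappa> * (u - s)) = exp (\<kappa> * (r - s)) * exp (\<kappa> * h)"
        by (simp add: h_def exp_add[symmetric] algebra_simps)
      then show ?thesis unfolding g_def by (simp add: algebra_simps)
    qed
    then have "norm (g u - g r) \<le> cmod (complex_of_real (exp (\<kappa> * (u - s))) * (G u - (1 - \<kappa> * h) * G r)) +
        cmod (complex_of_real (exp (\<kappa> * (r - s)) * (exp (\<kappa> * h) * (1 - \<kappa> * h) - 1)) * G r)"
      by (simp only: norm_triangle_ineq)
    also have "cmod (complex_of_real (exp (\<kappa> * (u - s))) * (G u - (1 - \<kappa> * h) * G r)) \<le> exp (\<kappa> * t) * (C * (h * sqrt h))"
      unfolding norm_mult norm_of_real using ru st \<kappa> step by (intro mult_mono) (auto intro!: mult_left_mono)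
    also have "cmod (complex_of_real (exp (\<kappa> * (r - s)) * (exp (\<kappa> * h) * (1 - \<kappa> * h) - 1)) * G r) \<le>
        exp (\<kappa> * t) * (\<kappa>\<^sup>2 * sqrt t * (h * sqrt h))"
    proof -
      have "\<bar>exp (\<kappa> * (r - s)) * (exp (\<kappa> * h) * (1 - \<kappa> * h) - 1)\<bar> \<le> exp (\<kappa> * (r - s)) * (exp (\<kappa> * h) * (\<kappa> * h)\<^sup>2)"
        unfolding abs_mult abs_exp_cancel using exp_times_one_minus_bound[of "\<kappa> * h"] \<kappa> h by (intro mult_left_mono) auto
      also have "\<dots> = exp (\<kappa> * (u - s)) * (\<kappa>\<^sup>2 * (sqrt h * (h * sqrt h)))"
        using h by (simp add: h_def[symmetric] mult.assoc[symmetric] exp_add[symmetric] power_mult_distrib power2_eq_square[of h])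
          (simp add: h_def algebra_simps)
      also have "\<dots> \<le> exp (\<kappa> * t) * (\<kappa>\<^sup>2 * (sqrt t * (h * sqrt h)))"
        using ru st \<kappa> h e0 by (intro mult_mono mult_left_mono mult_right_mono) (auto intro!: mult_left_mono)
      finally show ?thesis
        unfolding norm_mult[of _ "G r"] norm_of_real mult.assoc
        using order_trans[OF mult_left_le[OF G1[of r] abs_ge_zero]] by (simp only: mult.assoc)
    qed
    finally show "norm (g u - g r) \<le> K * ((u - r) * sqrt (u - r))"
      by (simp add: K_def h_def[symmetric] algebra_simps)
  qed
  then have "complex_of_real (exp (\<kappa> * (t - s))) * G t = G s" by (simp add: g_def)
  then have "complex_of_real (exp (- (\<kappa> * (t - s)))) * (complex_of_real (exp (\<kappa> * (t - s))) * G t) = complex_of_real (exp (- (\<kappa> * (t - s)))) * G s"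
    by simp
  then have "G t = complex_of_real (exp (- (\<kappa> * (t - s)))) * G s"
    by (simp add: mult.assoc[symmetric] of_real_mult[symmetric] exp_add[symmetric] del: of_real_mult)
  moreover have "- (\<kappa> * (t - s)) = - (norm v)\<^sup>2 * (t - s) / 2" by (simp add: \<kappa>_def)
  ultimately show ?thesis by (simp add: G_def Y_def)
qed

lemma integral_Q:
  fixes f :: "(real \<Rightarrow> real ^ 'n) \<Rightarrow> complex"
  assumes "f \<in> borel_measurable P"
  shows "(LINT w|Q. f w) = (1 / j 0) *\<^sub>R (LINT w|P. D w *\<^sub>R f w)"
proof -
  have "(LINT w|Q. f w) = (LINT w|P. (D w / j 0) *\<^sub>R f w)"
    unfolding Q_def using assms D_pos j_pos[of 0] by (subst integral_density) (auto simp: less_imp_le)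
  also have "\<dots> = (LINT w|P. (1 / j 0) *\<^sub>R (D w *\<^sub>R f w))" by simp
  finally show ?thesis by (simp only: integral_scaleR_right)
qed

text \<open>The image under the increment of \<open>Q\<close> restricted to \<open>B\<close> and the
  Gaussian law scaled by the probability of \<open>B\<close> have the same characteristic function.
  With \<open>B\<close> the whole space this is the law of the increment; in general it is its
  independence of the past.\<close>

lemma emeasure_\<beta>_increment:
  assumes st: "0 \<le> s" "s < t" and B: "B \<in> sets (\<F> s)" and C: "C \<in> sets borel"
  shows "emeasure Q (B \<inter> ((\<lambda>w. \<beta> t w - \<beta> s w) -` C \<inter> space P)) = emeasure Q B * emeasure (gauss (t - s)) C"
proof -
  interpret Q: prob_space Q by (rule prob_space_Q)
  interpret gauss: prob_space "gauss (t - s) :: (real ^ 'n) measure" using st by (intro prob_space_gauss) simp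
  let ?Y = "\<lambda>w. \<beta> t w - \<beta> s w"
  have BP: "B \<in> sets P" using B sets_filtration by auto
  have "\<beta> t \<in> borel_measurable P" "\<beta> s \<in> borel_measurable P"
    using st by (auto intro!: measurable_filtrationD measurable_\<beta>)
  then have Y: "?Y \<in> borel_measurable P" by simp
  then have YQ: "?Y \<in> borel_measurable (density Q (indicator B))" by (simp add: measurable_cong_sets[OF sets_Q refl])
  have BQ: "indicator B \<in> borel_measurable Q" "B \<in> sets Q" using BP by simp_all
  have dens: "density Q (indicator B) = density Q (\<lambda>w. ennreal (indicator B w))" by (simp add: ennreal_indicator)
  have "distr (density Q (indicator B)) borel ?Y = density (gauss (t - s)) (\<lambda>_. ennreal (measure Q B))"
  proof (rule char_uniqueness_vec)
    show "finite_measure (distr (density Q (indicator B)) borel ?Y)"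
      by (intro finite_measure.finite_measure_distr YQ finite_measureI)
        (use BQ in \<open>simp add: emeasure_density Q.emeasure_eq_measure flip: indicator_inter_arith\<close>)
    show "finite_measure (density (gauss (t - s) :: (real ^ 'n) measure) (\<lambda>_. ennreal (measure Q B)))"
      using gauss.emeasure_space_1
      by (intro finite_measureI) (simp add: emeasure_density_const gauss.emeasure_eq_measure ennreal_mult[symmetric])
    fix v :: "real ^ 'n"
    have m: "(\<lambda>x. iexp (v \<bullet> x)) \<in> borel_measurable borel" by measurable
    have mQ: "(\<lambda>w. iexp (v \<bullet> ?Y w)) \<in> borel_measurable Q"
      using measurable_compose[OF Y m] unfolding measurable_cong_sets[OF sets_Q refl] .
    have indm: "(\<lambda>w. indicator B w * iexp (v \<bullet> ?Y w)) \<in> borel_measurable P"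
      using measurable_compose[OF Y m] BP by (intro borel_measurable_times) auto
    have "(CLINT x|distr (density Q (indicator B)) borel ?Y. iexp (v \<bullet> x)) = (CLINT w|Q. indicator B w * iexp (v \<bullet> ?Y w))"
      unfolding integral_distr[OF YQ m] unfolding dens using BQ mQ
      by (subst integral_density) (auto simp: scaleR_conv_of_real intro!: Bochner_Integration.integral_cong split: split_indicator)
    also have "\<dots> = (1 / j 0) *\<^sub>R (CLINT w|P. D w *\<^sub>R (indicator B w * iexp (v \<bullet> ?Y w)))"
      by (rule integral_Q[OF indm])
    also have "\<dots> = exp (- (norm v)\<^sup>2 * (t - s) / 2) * ((1 / j 0) *\<^sub>R (CLINT w|P. D w *\<^sub>R indicator B w))"
      using st by (subst char_\<beta>_increment_D[OF _ _ B]) auto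
    also have "(1 / j 0) *\<^sub>R (CLINT w|P. D w *\<^sub>R (indicator B w :: complex)) = (CLINT w|Q. indicator B w)"
      using BP by (intro integral_Q[symmetric]) simp
    also have "(CLINT w|Q. indicator B w) = complex_of_real (measure Q B)"
    proof -
      have "(CLINT w|Q. indicator B w) = (CLINT w|Q. complex_of_real (indicator B w))"
        by (intro Bochner_Integration.integral_cong) (auto split: split_indicator)
      also have "\<dots> = complex_of_real (LINT w|Q. indicator B w)" by (rule integral_complex_of_real)
      finally show ?thesis using BQ by simp
    qed
    also have "exp (- (norm v)\<^sup>2 * (t - s) / 2) * complex_of_real (measure Q B) =
        (CLINT x|density (gauss (t - s)) (\<lambda>_. ennreal (measure Q B)). iexp (v \<bullet> x))"
      using gauss_moments(5)[of "t - s" v] st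
      by (subst integral_density) (auto simp: scaleR_conv_of_real mult.commute)
    finally show "(CLINT x|distr (density Q (indicator B)) borel ?Y. iexp (v \<bullet> x)) =
        (CLINT x|density (gauss (t - s)) (\<lambda>_. ennreal (measure Q B)). iexp (v \<bullet> x))" .
  qed simp_all
  then have "emeasure (distr (density Q (indicator B)) borel ?Y) C = emeasure (density (gauss (t - s)) (\<lambda>_. ennreal (measure Q B))) C"
    by simp
  moreover have "emeasure (distr (density Q (indicator B)) borel ?Y) C = emeasure Q (B \<inter> (?Y -` C \<inter> space P))"
    using measurable_sets[OF Y C] BQ
    by (simp add: emeasure_distr[OF YQ C] emeasure_density flip: indicator_inter_arith)
  moreover have "emeasure (density (gauss (t - s)) (\<lambda>_. ennreal (measure Q B))) C = emeasure Q B * emeasure (gauss (t - s)) C"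
    using C by (simp add: emeasure_density_const Q.emeasure_eq_measure)
  ultimately show ?thesis by simp
qed

lemma continuous_\<beta>:
  assumes w: "w \<in> space P" shows "continuous_on {0..} (\<lambda>t. \<beta> t w)"
proof -
  have cb: "continuous_on {0..} (\<lambda>s. b (w s))" using w continuous_b by (rule continuous_along_path)
  have "continuous_on {0..} (\<lambda>t. LINT s:{0..t}|lborel. b (w s))"
  proof (rule continuous_on_eq)
    show "continuous_on {0..} (\<lambda>t. integral {0..t} (\<lambda>s. b (w s)))"
      unfolding continuous_on_eq_continuous_within
    proof
      fix t :: real assume t: "t \<in> {0..}"
      have "continuous_on {0..t + 1} (\<lambda>t. integral {0..t} (\<lambda>s. b (w s)))"
        by (intro indefinite_integral_continuous_1 integrable_continuous_real continuous_on_subset[OF cb]) auto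
      then have "continuous (at t within {0..t + 1}) (\<lambda>t. integral {0..t} (\<lambda>s. b (w s)))"
        using t by (simp add: continuous_on_eq_continuous_within)
      moreover have "at t within {0..t + 1} = at t within {0..}"
        by (rule at_within_nhd[of _ "{..<t + 1}"]) auto
      ultimately show "continuous (at t within {0..}) (\<lambda>t. integral {0..t} (\<lambda>s. b (w s)))" by simp
    qed
    show "integral {0..t} (\<lambda>s. b (w s)) = (LINT s:{0..t}|lborel. b (w s))" if "t \<in> {0..}" for t
      using set_integrable_continuous[OF cb order_refl, of t] by (simp add: set_borel_integral_eq_integral)
  qed
  then show ?thesis unfolding \<beta>_def by (intro continuous_intros continuous_path[OF w])
qed

lemma brownian_motion_\<beta>: "brownian_motion_wrt Q \<F> \<beta>"
  unfolding brownian_motion_wrt_def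
proof (intro conjI allI impI ballI)
  interpret Q: prob_space Q by (rule prob_space_Q)
  show "prob_space Q" by (rule prob_space_Q)
  show "filtration (space Q) \<F>" using filtration_natural_filtration[of P] by simp
  show "sets (\<F> t) \<subseteq> sets Q" for t using sets_filtration by simp
  show "\<beta> t \<in> borel_measurable (\<F> t)" if "0 \<le> t" for t using that by (rule measurable_\<beta>)
  show "\<beta> 0 w = 0" if "w \<in> space Q" for w
  proof -
    have "continuous_on {0..} (\<lambda>s. b (w s))" using that continuous_b by (intro continuous_along_path) auto
    \<comment> \<open>Joining the point interval to itself shows that the integral equals twice
      itself, hence is 0.\<close>
    then have "(LINT s:{0..0}|lborel. b (w s)) = (LINT s:{0..0}|lborel. b (w s)) + (LINT s:{0..0}|lborel. b (w s))"
      by (rule set_integral_combine) auto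
    then show ?thesis by (simp add: \<beta>_def)
  qed
  show "continuous_on {0..} (\<lambda>t. \<beta> t w)" if "w \<in> space Q" for w using that by (simp add: continuous_\<beta>)
  fix s t :: real assume st: "0 \<le> s" "s < t"
  let ?Y = "\<lambda>w. \<beta> t w - \<beta> s w"
  have "\<beta> t \<in> borel_measurable P" "\<beta> s \<in> borel_measurable P"
    using st by (auto intro!: measurable_filtrationD measurable_\<beta>)
  then have Y: "?Y \<in> borel_measurable Q" by (simp add: measurable_cong_sets[OF sets_Q refl])
  have law: "emeasure Q (?Y -` C \<inter> space Q) = emeasure (gauss (t - s)) C" if "C \<in> sets borel" for C
    using emeasure_\<beta>_increment[OF st _ that, of "space P"] sets.top[of "\<F> s"] Q.emeasure_space_1
    by (simp add: Int_absorb1)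
  have "distr Q lborel ?Y = gauss (t - s)"
    using Y law by (intro measure_eqI) (simp_all add: emeasure_distr)
  then show "distributed Q lborel ?Y (\<lambda>x. ennreal (\<Prod>i\<in>UNIV. normal_density 0 (sqrt (t - s)) (x $ i)))"
    using Y by (simp add: distributed_def gauss_def)
  show "prob_space.indep_set Q (sets (\<F> s)) (sets (vimage_algebra (space Q) ?Y borel))"
  proof (rule Q.indep_setI)
    show "sets (\<F> s) \<subseteq> sets Q" using sets_filtration by simp
    show "sets (vimage_algebra (space Q) ?Y borel) \<subseteq> sets Q"
      using measurable_sets[OF Y] by (subst sets_vimage_algebra2) auto
    fix B c assume B: "B \<in> sets (\<F> s)" and "c \<in> sets (vimage_algebra (space Q) ?Y borel)"
    then obtain C where C: "C \<in> sets borel" "c = ?Y -` C \<inter> space Q" by (subst (asm) sets_vimage_algebra2) auto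
    have "emeasure Q (B \<inter> c) = emeasure Q B * emeasure Q c"
      using emeasure_\<beta>_increment[OF st B C(1)] law[OF C(1)] C(2) by simp
    then show "measure Q (B \<inter> c) = measure Q B * measure Q c"
      by (simp add: Q.emeasure_eq_measure ennreal_mult[symmetric])
  qed
qed

text \<open>The coordinate process under \<open>Q\<close> is itself the solution: the integrated
  equation merely restates the definition of \<open>\<beta>\<close>, and the content lies in
  \<open>\<beta>\<close> being a Brownian motion for the coordinate filtration.\<close>

theorem solves_sde_Q: "solves_sde_in_law b Q"
  unfolding solves_sde_in_law_def
proof (intro exI conjI)
  show "brownian_motion_wrt Q \<F> \<beta>" by (rule brownian_motion_\<beta>)
  show "\<forall>t\<ge>0. (\<lambda>w. w t) \<in> borel_measurable (\<F> t)" by (auto intro: measurable_coordinate_filtration)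
  show "\<forall>w\<in>space Q. continuous_on {0..} (\<lambda>t. w t)" using continuous_path by simp
  show "path_law Q (\<lambda>t w. w t) = Q"
  proof -
    have "(\<lambda>t\<in>{0..}. w t) = w" if "w \<in> space P" for w
      using that by (auto simp: space_P space_path_space extensional_def)
    then have "path_law Q (\<lambda>t w. w t) = distr Q path_space (\<lambda>w. w)"
      unfolding path_law_def by (intro distr_cong) auto
    also have "\<dots> = Q" by (rule distr_id2) (simp add: sets_P)
    finally show ?thesis .
  qed
  show "AE w in Q. \<forall>t\<ge>0. set_integrable lborel {0..t} (\<lambda>s. b (w s)) \<and>
      w t = w 0 + (LINT s:{0..t}|lborel. b (w s)) + \<beta> t w"
  proof (rule AE_I2)
    fix w assume "w \<in> space Q"
    then have "continuous_on {0..} (\<lambda>s. b (w s))" using continuous_b by (intro continuous_along_path) auto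
    then show "\<forall>t\<ge>0. set_integrable lborel {0..t} (\<lambda>s. b (w s)) \<and>
      w t = w 0 + (LINT s:{0..t}|lborel. b (w s)) + \<beta> t w"
      by (auto simp: \<beta>_def intro: set_integrable_continuous)
  qed
qed

end

section \<open>Conditioning on the law of a functional\<close>

text \<open>Integrating the conditional probability of \<open>E\<close> against a density
  \<open>v\<close> with respect to the law of \<open>T\<close> gives the expectation of
  \<open>v (T w)\<close> over \<open>E\<close>. Absolute continuity of the prescribed law makes the
  choice of versions irrelevant.\<close>

lemma conditioned_law_density:
  fixes T :: "'a \<Rightarrow> 'c::topological_space"
  assumes P: "prob_space P" and T: "T \<in> borel_measurable P" and v: "v \<in> borel_measurable borel"
  shows "conditioned_law P T (density (distr P borel T) v) = density P (\<lambda>w. v (T w))"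
proof -
  interpret prob_space P by fact
  let ?L = "distr P borel T"
  interpret L: prob_space ?L using T by (rule prob_space_distr)
  have *: "(\<integral>\<^sup>+y. cond_prob_given P T E y \<partial>density ?L v) = emeasure (density P (\<lambda>w. v (T w))) E"
    if E: "E \<in> sets P" for E
  proof -
    let ?LE = "distr (density P (indicator E)) borel T"
    have TE: "T \<in> borel_measurable (density P (indicator E))" using T by simp
    \<comment> \<open>The Radon-Nikodym derivative has its meaning only under this condition, which
      holds because the event \<open>E\<close> can only lower the probability that \<open>T\<close>
      lies in \<open>A\<close>.\<close>
    have "absolutely_continuous ?L ?LE"
      unfolding absolutely_continuous_def
    proof
      fix A assume "A \<in> null_sets ?L"
      then have A: "A \<in> sets borel" "emeasure P (T -` A \<inter> space P) = 0"
        using T by (auto simp: null_sets_def emeasure_distr)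
      have "emeasure ?LE A = emeasure P (E \<inter> (T -` A \<inter> space P))"
        using A E measurable_sets[OF T A(1)]
        by (simp add: emeasure_distr[OF TE A(1)] emeasure_density flip: indicator_inter_arith)
      also have "\<dots> \<le> emeasure P (T -` A \<inter> space P)"
        using measurable_sets[OF T A(1)] by (intro emeasure_mono) auto
      finally show "A \<in> null_sets ?LE" using A by (simp add: null_sets_def)
    qed
    then have RN: "density ?L (RN_deriv ?L ?LE) = ?LE" by (intro L.density_RN_deriv) simp_all
    have "(\<integral>\<^sup>+y. cond_prob_given P T E y \<partial>density ?L v) = (\<integral>\<^sup>+y. RN_deriv ?L ?LE y * v y \<partial>?L)"
      unfolding cond_prob_given_def using v by (subst nn_integral_density) (auto simp: mult.commute)
    also have "\<dots> = (\<integral>\<^sup>+y. v y \<partial>density ?L (RN_deriv ?L ?LE))"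
      using v by (subst nn_integral_density) auto
    also have "\<dots> = (\<integral>\<^sup>+w. v (T w) * indicator E w \<partial>P)"
      unfolding RN using v T E TE
      by (subst nn_integral_distr) (auto simp: nn_integral_density mult.commute)
    also have "\<dots> = emeasure (density P (\<lambda>w. v (T w))) E"
      using v T E by (subst emeasure_density) auto
    finally show ?thesis .
  qed
  have "conditioned_law P T (density ?L v) = measure_of (space P) (sets P) (emeasure (density P (\<lambda>w. v (T w))))"
    unfolding conditioned_law_def by (rule measure_of_eq) (auto simp: sets.space_closed sets.sigma_sets_eq *)
  also have "\<dots> = density P (\<lambda>w. v (T w))"
    using measure_of_of_measure[of "density P (\<lambda>w. v (T w))"] by simp
  finally show ?thesis .
qed

lemma AE_lborel_vec_nth_neq: "AE y in (lborel :: (real ^ 'd) measure). y $ i \<noteq> c"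
proof -
  have "negligible {y :: real ^ 'd. y \<bullet> axis i 1 = c}"
    by (rule negligible_standard_hyperplane) (auto simp: Basis_vec_def)
  then have "{y :: real ^ 'd. y $ i = c} \<in> null_sets lebesgue"
    by (simp add: negligible_iff_null_sets inner_axis)
  moreover have "{y :: real ^ 'd. y $ i = c} \<in> sets lborel" by simp
  ultimately have "{y :: real ^ 'd. y $ i = c} \<in> null_sets lborel"
    by (simp add: null_sets_completion_iff)
  then show ?thesis by (rule AE_I') auto
qed

lemma exp_functional_cong: "(\<And>s. 0 \<le> s \<Longrightarrow> f s = g s) \<Longrightarrow> exp_functional \<alpha> f = exp_functional \<alpha> g"
  unfolding exp_functional_def set_lebesgue_integral_def
  by (intro arg_cong[where f=vec_lambda] ext Bochner_Integration.integral_cong) (auto simp: indicator_def)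

text \<open>The drift is deterministic, so the path map takes the past of \<open>B\<close> to the
  past of the coordinates, and increments differ by the constant
  \<open>(t - s) *\<^sub>R \<mu>\<close>; both Brownian properties pass to the image law.\<close>

lemma drifted_brownian_law_path_law:
  fixes B :: "real \<Rightarrow> 'a \<Rightarrow> real ^ 'n"
  assumes B: "standard_brownian_motion M B"
  shows "(\<lambda>\<omega>. \<lambda>t\<in>{0..}. drifted B \<mu> t \<omega>) \<in> measurable M path_space"
    and "drifted_brownian_law (path_law M (drifted B \<mu>)) \<mu>"
proof -
  let ?F = "natural_filtration M B" and ?\<Phi> = "\<lambda>\<omega>. \<lambda>t\<in>{0..}. drifted B \<mu> t \<omega>"
  define P where "P = path_law M (drifted B \<mu>)"
  note bm = B[unfolded standard_brownian_motion_def brownian_motion_wrt_def]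
  interpret prob_space M using bm by blast
  have BF: "B t \<in> borel_measurable (?F t)" if "0 \<le> t" for t using that by (simp add: measurable_natural_filtration)
  have BM: "B t \<in> borel_measurable M" if "0 \<le> t" for t
  proof -
    have "subalgebra M (?F t)" using bm by (simp add: subalgebra_def)
    then show ?thesis using BF[OF that] by (rule measurable_from_subalg)
  qed
  have incrM: "(\<lambda>\<omega>. B t \<omega> - B s \<omega>) \<in> borel_measurable M" if "0 \<le> s" "s < t" for s t
    using BM that by simp
  show \<Phi>: "?\<Phi> \<in> measurable M path_space"
  proof (rule measurable_into_path_space)
    show "drifted B \<mu> t \<in> borel_measurable M" if "0 \<le> t" for t
      unfolding drifted_def[abs_def] using BM[OF that] by simp
    show "continuous_on {0..} (\<lambda>t. drifted B \<mu> t \<omega>)" if "\<omega> \<in> space M" for \<omega>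
      unfolding drifted_def using bm that by (intro continuous_intros) auto
  qed
  have P: "P = distr M path_space ?\<Phi>" by (simp add: P_def path_law_def)
  have spP: "space P = space path_space" by (simp add: P)
  have coord: "(\<lambda>w :: real \<Rightarrow> real ^ 'n. w t) \<in> borel_measurable path_space" if "0 \<le> t" for t
    using that by (rule measurable_coordinate_path_space)
  have "drifted_brownian_law P \<mu>"
  proof (intro drifted_brownian_law.intro drifted_brownian_law_axioms.intro)
    show "prob_space P" unfolding P by (rule prob_space_distr[OF \<Phi>])
    show "sets P = sets path_space" by (simp add: P)
    have "{w \<in> space path_space. w 0 = 0} \<in> sets (path_space :: (real \<Rightarrow> real ^ 'n) measure)"
      using measurable_sets[OF coord[of 0], of "{0}"] by (simp add: vimage_def Int_def conj_commute)
    then show "AE w in P. w 0 = 0"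
      unfolding P using bm by (subst AE_distr_iff[OF \<Phi>]) (auto simp: drifted_def intro!: AE_I2)
    fix s t :: real assume st: "0 \<le> s" "s < t"
    have eq: "?\<Phi> \<omega> t - ?\<Phi> \<omega> s = (B t \<omega> - B s \<omega>) + (t - s) *\<^sub>R \<mu>" for \<omega>
      using st by (simp add: drifted_def scaleR_diff_left)
    have cdiff: "(\<lambda>w :: real \<Rightarrow> real ^ 'n. w t - w s) \<in> borel_measurable path_space" using coord st by (intro borel_measurable_diff) auto
    have dist: "distributed M lborel (\<lambda>\<omega>. B t \<omega> - B s \<omega>) (\<lambda>x. ennreal (\<Prod>i\<in>UNIV. normal_density 0 (sqrt (t - s)) (x $ i)))"
      and ind: "indep_set (sets (?F s)) (sets (vimage_algebra (space M) (\<lambda>\<omega>. B t \<omega> - B s \<omega>) borel))"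
      using bm st by blast+
    have "distr P borel (\<lambda>w. w t - w s - (t - s) *\<^sub>R \<mu>) = distr M borel (\<lambda>\<omega>. B t \<omega> - B s \<omega>)"
    proof -
      have "(\<lambda>w. w t - w s - (t - s) *\<^sub>R \<mu>) \<in> borel_measurable path_space" using cdiff by simp
      from distr_distr[OF this \<Phi>]
      have "distr P borel (\<lambda>w. w t - w s - (t - s) *\<^sub>R \<mu>) = distr M borel (\<lambda>\<omega>. ?\<Phi> \<omega> t - ?\<Phi> \<omega> s - (t - s) *\<^sub>R \<mu>)"
        unfolding P by (simp only: comp_def)
      then show ?thesis unfolding eq by simp
    qed
    also have "\<dots> = distr M lborel (\<lambda>\<omega>. B t \<omega> - B s \<omega>)" by (intro distr_cong) simp_all
    also have "\<dots> = gauss (t - s)" using dist by (simp add: distributed_def gauss_def)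
    finally show "distr P borel (\<lambda>w. w t - w s - (t - s) *\<^sub>R \<mu>) = gauss (t - s)" .
    fix A C assume A: "A \<in> sets (coordinate_filtration P s)" and C: "C \<in> sets (borel :: (real ^ 'n) measure)"
    \<comment> \<open>It suffices to pull back the generators: a coordinate at time \<open>r\<close>
      composed with the path map is \<open>B r \<omega> + r *\<^sub>R \<mu>\<close>, which is known
      at time \<open>s\<close> when \<open>r \<le> s\<close>.\<close>
    have \<Phi>F: "?\<Phi> \<in> measurable (?F s) (coordinate_filtration P s)"
    proof (rule measurable_sigma_sets[OF sets_natural_filtration])
      show "?\<Phi> \<in> space (?F s) \<rightarrow> space P" using measurable_space[OF \<Phi>] by (simp add: spP)
      fix y assume "y \<in> {(\<lambda>w. w r) -` C \<inter> space P |r C. 0 \<le> r \<and> r \<le> s \<and> C \<in> sets borel}"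
      then obtain r C where r: "0 \<le> r" "r \<le> s" "C \<in> sets borel" "y = (\<lambda>w. w r) -` C \<inter> space P" by blast
      have "(\<lambda>\<omega>. B r \<omega> + r *\<^sub>R \<mu>) \<in> borel_measurable (?F s)"
        using measurable_natural_filtration[OF r(1,2), of B M] by simp
      then have "(\<lambda>\<omega>. B r \<omega> + r *\<^sub>R \<mu>) -` C \<inter> space (?F s) \<in> sets (?F s)" using r(3) by (rule measurable_sets)
      also have "(\<lambda>\<omega>. B r \<omega> + r *\<^sub>R \<mu>) -` C \<inter> space (?F s) = ?\<Phi> -` y \<inter> space (?F s)"
        using r measurable_space[OF \<Phi>] by (auto simp: drifted_def spP)
      finally show "?\<Phi> -` y \<inter> space (?F s) \<in> sets (?F s)" .
    qed auto
    define A' where "A' = ?\<Phi> -` A \<inter> space M"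
    \<comment> \<open>Translating \<open>C\<close> by the drift expresses the event through the
      increment of \<open>B\<close>, to which the given independence refers.\<close>
    define C' where "C' = (\<lambda>x. x + (t - s) *\<^sub>R \<mu>) -` C"
    define E where "E = (\<lambda>\<omega>. B t \<omega> - B s \<omega>) -` C' \<inter> space M"
    have A': "A' \<in> sets (?F s)" using measurable_sets[OF \<Phi>F A] by (simp add: A'_def)
    have "(\<lambda>x. x + (t - s) *\<^sub>R \<mu>) \<in> borel_measurable (borel :: (real ^ 'n) measure)" by simp
    from measurable_sets[OF this C] have C': "C' \<in> sets borel" by (simp add: C'_def)
    have E: "E \<in> sets (vimage_algebra (space M) (\<lambda>\<omega>. B t \<omega> - B s \<omega>) borel)"
      unfolding E_def by (rule in_vimage_algebra[OF C'])
    have "sets (coordinate_filtration P s) \<subseteq> sets P"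
      by (rule sets_natural_filtration_subset) (use coord in \<open>simp add: P\<close>)
    then have AP: "A \<in> sets path_space" using A by (auto simp: P)
    have Cp: "(\<lambda>w. w t - w s) -` C \<inter> space P \<in> sets path_space"
      using measurable_sets[OF cdiff C] by (simp add: spP)
    have pre: "?\<Phi> -` ((\<lambda>w. w t - w s) -` C \<inter> space P) \<inter> space M = E"
      using measurable_space[OF \<Phi>] eq by (auto simp: E_def C'_def spP simp del: restrict_apply)
    have "emeasure P (A \<inter> ((\<lambda>w. w t - w s) -` C \<inter> space P)) = emeasure M (A' \<inter> E)"
    proof -
      have "?\<Phi> -` (A \<inter> ((\<lambda>w. w t - w s) -` C \<inter> space P)) \<inter> space M = A' \<inter> E"
        unfolding pre[symmetric] A'_def by blast
      then show ?thesis unfolding P using AP Cp by (subst emeasure_distr[OF \<Phi>]) (auto simp: P)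
    qed
    also have "\<dots> = emeasure M A' * emeasure M E"
      using indep_setD[OF ind A' E] by (simp add: emeasure_eq_measure ennreal_mult[symmetric])
    also have "emeasure M A' = emeasure P A" unfolding P A'_def by (rule emeasure_distr[OF \<Phi> AP, symmetric])
    also have "emeasure M E = emeasure P ((\<lambda>w. w t - w s) -` C \<inter> space P)"
      unfolding pre[symmetric] using emeasure_distr[OF \<Phi> Cp] by (simp only: P)
    finally show "emeasure P (A \<inter> ((\<lambda>w. w t - w s) -` C \<inter> space P)) =
      emeasure P A * emeasure P ((\<lambda>w. w t - w s) -` C \<inter> space P)" .
  qed
  then show "drifted_brownian_law (path_law M (drifted B \<mu>)) \<mu>" by (simp add: P_def)
qed

theorem corollary3p2:
  fixes M :: "'a measure"
    and B :: "real \<Rightarrow> 'a \<Rightarrow> real ^ 'n"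
    and \<alpha> :: "'d::finite \<Rightarrow> real ^ 'n"
    and \<mu> :: "real ^ 'n"
    and \<theta> :: "real ^ 'd"
    and p :: "real ^ 'd \<Rightarrow> real"
  assumes "inj \<alpha>" and "\<And>i. \<alpha> i \<noteq> 0"
    and "\<mu> \<in> chamber \<alpha>"
    and "standard_brownian_motion M B"
    and "\<And>x. p x \<ge> 0"
    and "distributed M lborel (\<lambda>\<omega>. exp_functional \<alpha> (\<lambda>s. drifted B \<mu> s \<omega>)) (\<lambda>x. ennreal (p x))"
  shows "let
      \<nu> = density lborel (\<lambda>x. ennreal
            (exp (- (\<Sum>i\<in>UNIV. (\<theta> $ i)\<^sup>2 * x $ i)) / j_fun M B \<alpha> \<mu> \<theta> 0 * p x));
      Q = conditioned_law (path_law M (drifted B \<mu>)) (exp_functional \<alpha>) \<nu>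
    in markov_process Q (\<lambda>t w. w t) \<and>
       (\<exists>b. (\<forall>x. GDERIV (\<lambda>y. ln (h_fun M B \<alpha> \<mu> \<theta> y)) x :> b x) \<and> solves_sde_in_law b Q)"
proof -
  define P where "P = path_law M (drifted B \<mu>)"
  let ?\<Phi> = "\<lambda>\<omega>. \<lambda>t\<in>{0..}. drifted B \<mu> t \<omega>"
  note \<Phi> = drifted_brownian_law_path_law(1)[OF assms(4), of \<mu>]
  interpret D: drifted_brownian_law P \<mu>
    unfolding P_def by (rule drifted_brownian_law_path_law(2)[OF assms(4)])
  have P: "P = distr M path_space ?\<Phi>" by (simp add: P_def path_law_def)
  have T: "exp_functional \<alpha> \<in> borel_measurable P"
    using measurable_exp_functional by (simp add: measurable_cong_sets[OF D.sets_P refl])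
  have ef: "exp_functional \<alpha> (?\<Phi> \<omega>) = exp_functional \<alpha> (\<lambda>s. drifted B \<mu> s \<omega>)" for \<omega>
    by (rule exp_functional_cong) simp
  have pm: "(\<lambda>x. ennreal (p x)) \<in> borel_measurable borel"
    using assms(6) by (simp add: distributed_def)
  have law: "distr P borel (exp_functional \<alpha>) = density lborel (\<lambda>x. ennreal (p x))"
  proof -
    have "distr P borel (exp_functional \<alpha>) = distr M borel (\<lambda>\<omega>. exp_functional \<alpha> (?\<Phi> \<omega>))"
      unfolding P using distr_distr[OF measurable_exp_functional \<Phi>] by (simp only: comp_def)
    also have "\<dots> = distr M lborel (\<lambda>\<omega>. exp_functional \<alpha> (\<lambda>s. drifted B \<mu> s \<omega>))"
      unfolding ef by (intro distr_cong) simp_all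
    finally show ?thesis using assms(6) by (simp add: distributed_def)
  qed
  \<comment> \<open>A component whose integral diverges is \<open>0\<close>, and the law with density \<open>p\<close> does not charge
    the coordinate hyperplanes.\<close>
  have fin: "AE w in P. \<forall>i. set_integrable lborel {0..} (\<lambda>s. exp (- 2 * (\<alpha> i \<bullet> w s)))"
  proof -
    have "AE w in P. exp_functional \<alpha> w $ i \<noteq> 0" for i
    proof -
      have "AE y in density lborel (\<lambda>x. ennreal (p x)). y $ i \<noteq> 0"
        using AE_lborel_vec_nth_neq[of i 0] pm by (subst AE_density) auto
      then have "AE y in distr P borel (exp_functional \<alpha>). y $ i \<noteq> 0" by (simp only: law)
      then show ?thesis by (rule AE_distrD[OF T])
    qed
    then have "AE w in P. \<forall>i. exp_functional \<alpha> w $ i \<noteq> 0" by (simp add: AE_finite_all[of UNIV, simplified])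
    then show ?thesis
    proof eventually_elim
      fix w assume nz: "\<forall>i. exp_functional \<alpha> w $ i \<noteq> 0"
      show "\<forall>i. set_integrable lborel {0..} (\<lambda>s. exp (- 2 * (\<alpha> i \<bullet> w s)))"
        using nz not_integrable_integral_eq
        unfolding exp_functional_def set_lebesgue_integral_def set_integrable_def vec_lambda_beta by blast
    qed
  qed
  interpret conditioned_brownian_law P \<mu> \<alpha> \<theta> by unfold_locales (rule fin)
  have jfun: "j_fun M B \<alpha> \<mu> \<theta> x = j x" for x
  proof -
    have "j x = (LINT w|distr M path_space ?\<Phi>. \<psi> x w)" by (simp only: j_def P[symmetric])
    also have "\<dots> = (LINT \<omega>|M. \<psi> x (?\<Phi> \<omega>))" by (rule integral_distr[OF \<Phi> measurable_\<psi>])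
    finally show ?thesis by (simp add: j_fun_def \<psi>_def Z_def cost_def ef)
  qed
  \<comment> \<open>\<open>v\<close> is the density of the prescribed law relative to the law of the
    functional, which itself has density \<open>p\<close>; this brings the conditioned law into the
    form of a density with respect to \<open>P\<close>.\<close>
  define v where "v y = ennreal (exp (- (\<Sum>i\<in>UNIV. (\<theta> $ i)\<^sup>2 * y $ i)) / j 0)" for y :: "real ^ 'd"
  have vm: "v \<in> borel_measurable borel" unfolding v_def[abs_def] by measurable
  have "density lborel (\<lambda>x. ennreal (exp (- (\<Sum>i\<in>UNIV. (\<theta> $ i)\<^sup>2 * x $ i)) / j_fun M B \<alpha> \<mu> \<theta> 0 * p x)) =
      density (distr P borel (exp_functional \<alpha>)) v"
  proof -
    have "ennreal (exp (- (\<Sum>i\<in>UNIV. (\<theta> $ i)\<^sup>2 * x $ i)) / j_fun M B \<alpha> \<mu> \<theta> 0 * p x) = ennreal (p x) * v x" for x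
      using assms(5)[of x] j_pos[of 0] by (simp add: v_def jfun ennreal_mult[symmetric] mult.commute)
    then show ?thesis unfolding law using pm vm by (simp add: density_density_eq)
  qed
  then have "conditioned_law P (exp_functional \<alpha>)
      (density lborel (\<lambda>x. ennreal (exp (- (\<Sum>i\<in>UNIV. (\<theta> $ i)\<^sup>2 * x $ i)) / j_fun M B \<alpha> \<mu> \<theta> 0 * p x))) =
      density P (\<lambda>w. v (exp_functional \<alpha> w))"
    using conditioned_law_density[OF D.prob_space_axioms T vm] by simp
  also have "\<dots> = Q"
    by (simp add: Q_def v_def D_def \<psi>_def Z_def cost_def)
  finally have cond: "conditioned_law (path_law M (drifted B \<mu>)) (exp_functional \<alpha>)
      (density lborel (\<lambda>x. ennreal (exp (- (\<Sum>i\<in>UNIV. (\<theta> $ i)\<^sup>2 * x $ i)) / j_fun M B \<alpha> \<mu> \<theta> 0 * p x))) = Q"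
    unfolding P_def .
  have "GDERIV (\<lambda>y. ln (h_fun M B \<alpha> \<mu> \<theta> y)) x :> b x" for x
    using GDERIV_log_j[of x] by (simp add: h_fun_def jfun)
  then show ?thesis unfolding Let_def cond using markov_Q solves_sde_Q by blast
qed

end
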